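(* Let $\mathcal C$ and $\mathcal M$ be pivotal categories, $\Phi^{\mathcal Z}:\mathcal C\to\mathcal Z(\mathcal M)$ a pivotal tensor functor, $\Phi=F\circ\Phi^{\mathcal Z}:\mathcal C\to\mathcal M$ with $F:\mathcal Z(\mathcal M)\to\mathcal M$ the forgetful functor, and let $\mathrm{Tr}_{\mathcal C}:\mathcal M\to\mathcal C$ be the right adjoint of $\Phi$. Given $w,x,y,z\in\mathcal M$, the following two morphisms $\mathrm{Tr}_{\mathcal C}(w)\otimes\mathrm{Tr}_{\mathcal C}(x\otimes y)\otimes\mathrm{Tr}_{\mathcal C}(z)\to\mathrm{Tr}_{\mathcal C}(w\otimes x\otimes z\otimes y)$ are equal: $$\tau_{y,\,w\otimes x\otimes z}^{-}\circ\mu_{y\otimes w\otimes x,\,z}\circ(\tau_{w\otimes x,\,y}\otimes\mathrm{id})\circ(\mu_{w,\,x\otimes y}\otimes\mathrm{id})$$ $$=\ \mu_{w,\,x\otimes z\otimes y}\circ(\mathrm{id}\otimes\tau^-_{y,\,x\otimes z})\circ(\mathrm{id}\otimes\mu_{y\otimes x,\,z})\circ(\mathrm{id}\otimes\tau_{x,y}\otimes\mathrm{id}).$$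
   Context: Tensor functors are strong monoidal; associators, unitors and the isomorphisms $\Phi(c)\otimes\Phi(d)\cong\Phi(c\otimes d)$, $1\cong\Phi(1)$ are suppressed. Duals: $\mathrm{ev}_a:a^*\otimes a\to1$, $\mathrm{coev}_a:1\to a\otimes a^*$ satisfying the zig-zag equations. Pivotal: rigid with a monoidal natural isomorphism $\varphi_a:a\to a^{**}$. A tensor functor $G$ between pivotal categories has canonical isomorphisms $\delta_x:G(x^* )\to G(x)^*$; it is pivotal if $G(\varphi_x)=\delta_{x^*}^{-1}\circ\delta_x^*\circ\varphi_{G(x)}$. The Drinfel'd center $\mathcal Z(\mathcal M)$ has as objects pairs $(a,e_a)$ with $e_{a,b}:a\otimes b\to b\otimes a$ isomorphisms natural in $b$ satisfying $e_{a,b\otimes c}=(\mathrm{id}_b\otimes e_{a,c})\circ(e_{a,b}\otimes\mathrm{id}_c)$; morphisms are morphisms of $\mathcal M$ commuting with the half-braidings; $e_{a\otimes b,c}=(e_{a,c}\otimes\mathrm{id}_b)\circ(\mathrm{id}_a\otimes e_{b,c})$; it is pivotal with the same $\varphi_a$. For $c\in\mathcal C$, $y\in\mathcal M$ one has $e_{\Phi(c),y}:\Phi(c)\otimes y\to y\otimes\Phi(c)$. Let $\varepsilon_x:\Phi(\mathrm{Tr}_{\mathcal C}(x))\to x$ be the counit of $\Phi\dashv\mathrm{Tr}_{\mathcal C}$. The mate of $g:c\to\mathrm{Tr}_{\mathcal C}(x)$ is $\varepsilon_x\circ\Phi(g):\Phi(c)\to x$. The multiplication map $\mu_{x,y}:\mathrm{Tr}_{\mathcal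 C}(x)\otimes\mathrm{Tr}_{\mathcal C}(y)\to\mathrm{Tr}_{\mathcal C}(x\otimes y)$ is the morphism whose mate is $\varepsilon_x\otimes\varepsilon_y$. Let $\widetilde{\mathrm{ev}}_y=\mathrm{ev}_{y^*}\circ(\varphi_y\otimes\mathrm{id}_{y^*}):y\otimes y^*\to1$. The traciator $\tau_{x,y}:\mathrm{Tr}_{\mathcal C}(x\otimes y)\to\mathrm{Tr}_{\mathcal C}(y\otimes x)$ is the morphism whose mate is, with $c=\mathrm{Tr}_{\mathcal C}(x\otimes y)$, $$(\mathrm{id}_{y\otimes x}\otimes\widetilde{\mathrm{ev}}_y)\circ(\mathrm{id}_y\otimes\varepsilon_{x\otimes y}\otimes\mathrm{id}_{y^*})\circ(e_{\Phi(c),y}\otimes\mathrm{id}_{y^*})\circ(\mathrm{id}_{\Phi(c)}\otimes\mathrm{coev}_y).$$ It is invertible; put $\tau^-_{x,y}=\tau_{y,x}^{-1}:\mathrm{Tr}_{\mathcal C}(x\otimes y)\to\mathrm{Tr}_{\mathcal C}(y\otimes x)$. *)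

theory Defs
  imports "HOL-Library.FuncSet"
begin

section \<open>Categories\<close>

text \<open>
  A category is given by a set of objects and a hom-set for each pair of objects.  Hom-sets of
  different pairs need not be disjoint, so that a morphism of the Drinfel'd center below is a
  morphism of the underlying category and the forgetful functor is the identity on morphisms.
  Every category, in the usual sense with domains and codomains, is of this form.
  The tensor product of morphisms below binds tighter than composition.
\<close>

record ('o, 'm) cat =
  Obj :: "'o set"
  Hom :: "'o \<Rightarrow> 'o \<Rightarrow> 'm set"
  Ident :: "'o \<Rightarrow> 'm" ("\<iota>\<index>")
  Comp :: "'m \<Rightarrow> 'm \<Rightarrow> 'm" (infixr "\<bullet>\<index>" 55)

locale category =
  fixes M :: "('o, 'm, 'z) cat_scheme" (structure)
  assumes id_in_hom: "a \<in> Obj M \<Longrightarrow> \<iota> a \<in> Hom M a a"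
    and comp_in_hom:
      "\<lbrakk>a \<in> Obj M; b \<in> Obj M; c \<in> Obj M; g \<in> Hom M b c; f \<in> Hom M a b\<rbrakk>
        \<Longrightarrow> g \<bullet> f \<in> Hom M a c"
    and comp_id_right: "\<lbrakk>a \<in> Obj M; b \<in> Obj M; f \<in> Hom M a b\<rbrakk> \<Longrightarrow> f \<bullet> \<iota> a = f"
    and comp_id_left: "\<lbrakk>a \<in> Obj M; b \<in> Obj M; f \<in> Hom M a b\<rbrakk> \<Longrightarrow> \<iota> b \<bullet> f = f"
    and comp_assoc:
      "\<lbrakk>a \<in> Obj M; b \<in> Obj M; c \<in> Obj M; d \<in> Obj M;
        h \<in> Hom M c d; g \<in> Hom M b c; f \<in> Hom M a b\<rbrakk>
        \<Longrightarrow> (h \<bullet> g) \<bullet> f = h \<bullet> (g \<bullet> f)"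

definition is_inverse :: "('o, 'm, 'z) cat_scheme \<Rightarrow> 'o \<Rightarrow> 'o \<Rightarrow> 'm \<Rightarrow> 'm \<Rightarrow> bool" where
  "is_inverse M a b f g \<longleftrightarrow>
     g \<in> Hom M b a \<and> g \<bullet>\<^bsub>M\<^esub> f = \<iota>\<^bsub>M\<^esub> a \<and> f \<bullet>\<^bsub>M\<^esub> g = \<iota>\<^bsub>M\<^esub> b"

definition Iso :: "('o, 'm, 'z) cat_scheme \<Rightarrow> 'o \<Rightarrow> 'o \<Rightarrow> 'm set" where
  "Iso M a b = {f \<in> Hom M a b. \<exists>g. is_inverse M a b f g}"

text \<open>The inverse of an isomorphism \<open>f : a \<rightarrow> b\<close>.\<close>

definition inv_arr :: "('o, 'm, 'z) cat_scheme \<Rightarrow> 'o \<Rightarrow> 'o \<Rightarrow> 'm \<Rightarrow> 'm" where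
  "inv_arr M a b f = (THE g. is_inverse M a b f g)"


section \<open>Monoidal categories\<close>

record ('o, 'm) moncat = "('o, 'm) cat" +
  TensorO :: "'o \<Rightarrow> 'o \<Rightarrow> 'o" (infixr "\<otimes>\<index>" 70)
  TensorA :: "'m \<Rightarrow> 'm \<Rightarrow> 'm" (infixr "\<odot>\<index>" 65)
  Unit :: "'o" ("\<one>\<index>")
  Assoc :: "'o \<Rightarrow> 'o \<Rightarrow> 'o \<Rightarrow> 'm" ("\<alpha>\<index>")
  LUnit :: "'o \<Rightarrow> 'm" ("\<ell>\<index>")
  RUnit :: "'o \<Rightarrow> 'm" ("\<rho>\<index>")

definition AssocInv :: "('o, 'm, 'z) moncat_scheme \<Rightarrow> 'o \<Rightarrow> 'o \<Rightarrow> 'o \<Rightarrow> 'm" ("\<alpha>\<^sup>-\<index>") where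
  "AssocInv M a b c =
     inv_arr M ((a \<otimes>\<^bsub>M\<^esub> b) \<otimes>\<^bsub>M\<^esub> c) (a \<otimes>\<^bsub>M\<^esub> (b \<otimes>\<^bsub>M\<^esub> c)) (\<alpha>\<^bsub>M\<^esub> a b c)"

definition LUnitInv :: "('o, 'm, 'z) moncat_scheme \<Rightarrow> 'o \<Rightarrow> 'm" ("\<ell>\<^sup>-\<index>") where
  "LUnitInv M a = inv_arr M (\<one>\<^bsub>M\<^esub> \<otimes>\<^bsub>M\<^esub> a) a (\<ell>\<^bsub>M\<^esub> a)"

definition RUnitInv :: "('o, 'm, 'z) moncat_scheme \<Rightarrow> 'o \<Rightarrow> 'm" ("\<rho>\<^sup>-\<index>") where
  "RUnitInv M a = inv_arr M (a \<otimes>\<^bsub>M\<^esub> \<one>\<^bsub>M\<^esub>) a (\<rho>\<^bsub>M\<^esub> a)"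

locale monoidal_category = category M for M :: "('o, 'm, 'z) moncat_scheme" (structure) +
  assumes unit_in_obj: "\<one> \<in> Obj M"
    and tensor_in_obj: "\<lbrakk>a \<in> Obj M; b \<in> Obj M\<rbrakk> \<Longrightarrow> a \<otimes> b \<in> Obj M"
    and tensor_in_hom:
      "\<lbrakk>a \<in> Obj M; b \<in> Obj M; c \<in> Obj M; d \<in> Obj M; f \<in> Hom M a b; g \<in> Hom M c d\<rbrakk>
        \<Longrightarrow> f \<odot> g \<in> Hom M (a \<otimes> c) (b \<otimes> d)"
    and tensor_id: "\<lbrakk>a \<in> Obj M; b \<in> Obj M\<rbrakk> \<Longrightarrow> \<iota> a \<odot> \<iota> b = \<iota> (a \<otimes> b)"
    and interchange:
      "\<lbrakk>a \<in> Obj M; b \<in> Obj M; c \<in> Obj M; a' \<in> Obj M; b' \<in> Obj M; c' \<in> Obj M;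
        g \<in> Hom M b c; f \<in> Hom M a b; g' \<in> Hom M b' c'; f' \<in> Hom M a' b'\<rbrakk>
        \<Longrightarrow> (g \<bullet> f) \<odot> (g' \<bullet> f') = (g \<odot> g') \<bullet> (f \<odot> f')"
    and assoc_iso:
      "\<lbrakk>a \<in> Obj M; b \<in> Obj M; c \<in> Obj M\<rbrakk>
        \<Longrightarrow> \<alpha> a b c \<in> Iso M ((a \<otimes> b) \<otimes> c) (a \<otimes> (b \<otimes> c))"
    and lunit_iso: "a \<in> Obj M \<Longrightarrow> \<ell> a \<in> Iso M (\<one> \<otimes> a) a"
    and runit_iso: "a \<in> Obj M \<Longrightarrow> \<rho> a \<in> Iso M (a \<otimes> \<one>) a"
    and assoc_natural:
      "\<lbrakk>a \<in> Obj M; b \<in> Obj M; c \<in> Obj M; a' \<in> Obj M; b' \<in> Obj M; c' \<in> Obj M;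
        f \<in> Hom M a a'; g \<in> Hom M b b'; h \<in> Hom M c c'\<rbrakk>
        \<Longrightarrow> \<alpha> a' b' c' \<bullet> ((f \<odot> g) \<odot> h) = (f \<odot> (g \<odot> h)) \<bullet> \<alpha> a b c"
    and lunit_natural:
      "\<lbrakk>a \<in> Obj M; b \<in> Obj M; f \<in> Hom M a b\<rbrakk> \<Longrightarrow> \<ell> b \<bullet> (\<iota> \<one> \<odot> f) = f \<bullet> \<ell> a"
    and runit_natural:
      "\<lbrakk>a \<in> Obj M; b \<in> Obj M; f \<in> Hom M a b\<rbrakk> \<Longrightarrow> \<rho> b \<bullet> (f \<odot> \<iota> \<one>) = f \<bullet> \<rho> a"
    and pentagon:
      "\<lbrakk>a \<in> Obj M; b \<in> Obj M; c \<in> Obj M; d \<in> Obj M\<rbrakk>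
        \<Longrightarrow> (\<iota> a \<odot> \<alpha> b c d) \<bullet> \<alpha> a (b \<otimes> c) d \<bullet> (\<alpha> a b c \<odot> \<iota> d)
            = \<alpha> a b (c \<otimes> d) \<bullet> \<alpha> (a \<otimes> b) c d"
    and triangle:
      "\<lbrakk>a \<in> Obj M; b \<in> Obj M\<rbrakk> \<Longrightarrow> (\<iota> a \<odot> \<ell> b) \<bullet> \<alpha> a \<one> b = \<rho> a \<odot> \<iota> b"


section \<open>Pivotal categories\<close>

record ('o, 'm) pivcat = "('o, 'm) moncat" +
  Dual :: "'o \<Rightarrow> 'o"
  Ev :: "'o \<Rightarrow> 'm"
  Coev :: "'o \<Rightarrow> 'm"
  Piv :: "'o \<Rightarrow> 'm"

text \<open>A pairing \<open>p : b \<otimes> a \<rightarrow> 1\<close> induces a morphism \<open>b \<rightarrow> a\<^sup>*\<close>.\<close>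

definition transpose :: "('o, 'm, 'z) pivcat_scheme \<Rightarrow> 'o \<Rightarrow> 'o \<Rightarrow> 'm \<Rightarrow> 'm" where
  "transpose M b a p =
     \<ell>\<^bsub>M\<^esub> (Dual M a) \<bullet>\<^bsub>M\<^esub> (p \<odot>\<^bsub>M\<^esub> \<iota>\<^bsub>M\<^esub> (Dual M a)) \<bullet>\<^bsub>M\<^esub> \<alpha>\<^sup>-\<^bsub>M\<^esub> b a (Dual M a)
       \<bullet>\<^bsub>M\<^esub> (\<iota>\<^bsub>M\<^esub> b \<odot>\<^bsub>M\<^esub> Coev M a) \<bullet>\<^bsub>M\<^esub> \<rho>\<^sup>-\<^bsub>M\<^esub> b"

text \<open>The dual \<open>f\<^sup>* : b\<^sup>* \<rightarrow> a\<^sup>*\<close> of \<open>f : a \<rightarrow> b\<close>.\<close>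

definition dual_arr :: "('o, 'm, 'z) pivcat_scheme \<Rightarrow> 'o \<Rightarrow> 'o \<Rightarrow> 'm \<Rightarrow> 'm" where
  "dual_arr M a b f =
     transpose M (Dual M b) a (Ev M b \<bullet>\<^bsub>M\<^esub> (\<iota>\<^bsub>M\<^esub> (Dual M b) \<odot>\<^bsub>M\<^esub> f))"

text \<open>The canonical isomorphisms \<open>b\<^sup>* \<otimes> a\<^sup>* \<rightarrow> (a \<otimes> b)\<^sup>*\<close> and \<open>1 \<rightarrow> 1\<^sup>*\<close>.\<close>

definition dual_tensor :: "('o, 'm, 'z) pivcat_scheme \<Rightarrow> 'o \<Rightarrow> 'o \<Rightarrow> 'm" where
  "dual_tensor M a b =
     transpose M (Dual M b \<otimes>\<^bsub>M\<^esub> Dual M a) (a \<otimes>\<^bsub>M\<^esub> b)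
       (Ev M b \<bullet>\<^bsub>M\<^esub> (\<iota>\<^bsub>M\<^esub> (Dual M b) \<odot>\<^bsub>M\<^esub>
          (\<ell>\<^bsub>M\<^esub> b \<bullet>\<^bsub>M\<^esub> (Ev M a \<odot>\<^bsub>M\<^esub> \<iota>\<^bsub>M\<^esub> b) \<bullet>\<^bsub>M\<^esub> \<alpha>\<^sup>-\<^bsub>M\<^esub> (Dual M a) a b))
        \<bullet>\<^bsub>M\<^esub> \<alpha>\<^bsub>M\<^esub> (Dual M b) (Dual M a) (a \<otimes>\<^bsub>M\<^esub> b))"

definition dual_unit :: "('o, 'm, 'z) pivcat_scheme \<Rightarrow> 'm" where
  "dual_unit M = transpose M \<one>\<^bsub>M\<^esub> \<one>\<^bsub>M\<^esub> (\<ell>\<^bsub>M\<^esub> \<one>\<^bsub>M\<^esub>)"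

text \<open>
  The tensor structure of the double dual functor is the composite of
  \<^term>\<open>dual_tensor M (Dual M b) (Dual M a)\<close>\<open> : a\<^sup>*\<^sup>* \<otimes> b\<^sup>*\<^sup>* \<rightarrow> (b\<^sup>* \<otimes> a\<^sup>*)\<^sup>*\<close> with the inverse of
  the dual of \<^term>\<open>dual_tensor M a b\<close>; the laws \<open>piv_tensor\<close> and \<open>piv_unit\<close>, which say that
  \<^term>\<open>Piv M\<close> is monoidal, are written with the inverses moved to the other side.
\<close>

locale pivotal_category = monoidal_category M
  for M :: "('o, 'm, 'z) pivcat_scheme" (structure) +
  assumes dual_in_obj: "a \<in> Obj M \<Longrightarrow> Dual M a \<in> Obj M"
    and ev_in_hom: "a \<in> Obj M \<Longrightarrow> Ev M a \<in> Hom M (Dual M a \<otimes> a) \<one>"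
    and coev_in_hom: "a \<in> Obj M \<Longrightarrow> Coev M a \<in> Hom M \<one> (a \<otimes> Dual M a)"
    and zigzag:
      "a \<in> Obj M \<Longrightarrow>
        \<rho> a \<bullet> (\<iota> a \<odot> Ev M a) \<bullet> \<alpha> a (Dual M a) a \<bullet> (Coev M a \<odot> \<iota> a) \<bullet> \<ell>\<^sup>- a = \<iota> a"
    and zigzag_dual:
      "a \<in> Obj M \<Longrightarrow>
        \<ell> (Dual M a) \<bullet> (Ev M a \<odot> \<iota> (Dual M a)) \<bullet> \<alpha>\<^sup>- (Dual M a) a (Dual M a)
          \<bullet> (\<iota> (Dual M a) \<odot> Coev M a) \<bullet> \<rho>\<^sup>- (Dual M a) = \<iota> (Dual M a)"
    and piv_iso: "a \<in> Obj M \<Longrightarrow> Piv M a \<in> Iso M a (Dual M (Dual M a))"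
    and piv_natural:
      "\<lbrakk>a \<in> Obj M; b \<in> Obj M; f \<in> Hom M a b\<rbrakk>
        \<Longrightarrow> Piv M b \<bullet> f = dual_arr M (Dual M b) (Dual M a) (dual_arr M a b f) \<bullet> Piv M a"
    and piv_tensor:
      "\<lbrakk>a \<in> Obj M; b \<in> Obj M\<rbrakk>
        \<Longrightarrow> dual_arr M (Dual M b \<otimes> Dual M a) (Dual M (a \<otimes> b)) (dual_tensor M a b)
              \<bullet> Piv M (a \<otimes> b)
            = dual_tensor M (Dual M b) (Dual M a) \<bullet> (Piv M a \<odot> Piv M b)"
    and piv_unit: "dual_arr M \<one> (Dual M \<one>) (dual_unit M) \<bullet> Piv M \<one> = dual_unit M"

text \<open>The evaluation \<open>a \<otimes> a\<^sup>* \<rightarrow> 1\<close> on the other side.\<close>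

definition ev_tilde :: "('o, 'm, 'z) pivcat_scheme \<Rightarrow> 'o \<Rightarrow> 'm" where
  "ev_tilde M a = Ev M (Dual M a) \<bullet>\<^bsub>M\<^esub> (Piv M a \<odot>\<^bsub>M\<^esub> \<iota>\<^bsub>M\<^esub> (Dual M a))"


section \<open>Functors\<close>

record ('c, 'f, 'o, 'm) cfunctor =
  FObj :: "'c \<Rightarrow> 'o"
  FArr :: "'f \<Rightarrow> 'm"

definition is_functor ::
  "('c, 'f, 'y) cat_scheme \<Rightarrow> ('o, 'm, 'z) cat_scheme \<Rightarrow> ('c, 'f, 'o, 'm, 'w) cfunctor_scheme \<Rightarrow> bool"
where
  "is_functor C D G \<longleftrightarrow>
     (\<forall>a\<in>Obj C. FObj G a \<in> Obj D) \<and>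
     (\<forall>a\<in>Obj C. \<forall>b\<in>Obj C. \<forall>f\<in>Hom C a b. FArr G f \<in> Hom D (FObj G a) (FObj G b)) \<and>
     (\<forall>a\<in>Obj C. FArr G (\<iota>\<^bsub>C\<^esub> a) = \<iota>\<^bsub>D\<^esub> (FObj G a)) \<and>
     (\<forall>a\<in>Obj C. \<forall>b\<in>Obj C. \<forall>c\<in>Obj C. \<forall>g\<in>Hom C b c. \<forall>f\<in>Hom C a b.
        FArr G (g \<bullet>\<^bsub>C\<^esub> f) = FArr G g \<bullet>\<^bsub>D\<^esub> FArr G f)"

text \<open>\<open>FMult G a b : G a \<otimes> G b \<rightarrow> G (a \<otimes> b)\<close> and \<open>FUnit G : 1 \<rightarrow> G 1\<close>.\<close>

record ('c, 'f, 'o, 'm) tfunctor = "('c, 'f, 'o, 'm) cfunctor" +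
  FMult :: "'c \<Rightarrow> 'c \<Rightarrow> 'm"
  FUnit :: 'm

definition is_tensor_functor ::
  "('c, 'f, 'y) moncat_scheme \<Rightarrow> ('o, 'm, 'z) moncat_scheme \<Rightarrow> ('c, 'f, 'o, 'm, 'w) tfunctor_scheme
    \<Rightarrow> bool"
where
  "is_tensor_functor C D G \<longleftrightarrow>
     is_functor C D G \<and>
     (\<forall>a\<in>Obj C. \<forall>b\<in>Obj C.
        FMult G a b \<in> Iso D (FObj G a \<otimes>\<^bsub>D\<^esub> FObj G b) (FObj G (a \<otimes>\<^bsub>C\<^esub> b))) \<and>
     FUnit G \<in> Iso D \<one>\<^bsub>D\<^esub> (FObj G \<one>\<^bsub>C\<^esub>) \<and>
     (\<forall>a\<in>Obj C. \<forall>b\<in>Obj C. \<forall>a'\<in>Obj C. \<forall>b'\<in>Obj C. \<forall>f\<in>Hom C a a'. \<forall>g\<in>Hom C b b'.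
        FMult G a' b' \<bullet>\<^bsub>D\<^esub> (FArr G f \<odot>\<^bsub>D\<^esub> FArr G g) = FArr G (f \<odot>\<^bsub>C\<^esub> g) \<bullet>\<^bsub>D\<^esub> FMult G a b) \<and>
     (\<forall>a\<in>Obj C. \<forall>b\<in>Obj C. \<forall>c\<in>Obj C.
        FArr G (\<alpha>\<^bsub>C\<^esub> a b c) \<bullet>\<^bsub>D\<^esub> FMult G (a \<otimes>\<^bsub>C\<^esub> b) c \<bullet>\<^bsub>D\<^esub> (FMult G a b \<odot>\<^bsub>D\<^esub> \<iota>\<^bsub>D\<^esub> (FObj G c))
        = FMult G a (b \<otimes>\<^bsub>C\<^esub> c) \<bullet>\<^bsub>D\<^esub> (\<iota>\<^bsub>D\<^esub> (FObj G a) \<odot>\<^bsub>D\<^esub> FMult G b c)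
            \<bullet>\<^bsub>D\<^esub> \<alpha>\<^bsub>D\<^esub> (FObj G a) (FObj G b) (FObj G c)) \<and>
     (\<forall>a\<in>Obj C.
        FArr G (\<ell>\<^bsub>C\<^esub> a) \<bullet>\<^bsub>D\<^esub> FMult G \<one>\<^bsub>C\<^esub> a \<bullet>\<^bsub>D\<^esub> (FUnit G \<odot>\<^bsub>D\<^esub> \<iota>\<^bsub>D\<^esub> (FObj G a)) = \<ell>\<^bsub>D\<^esub> (FObj G a)) \<and>
     (\<forall>a\<in>Obj C.
        FArr G (\<rho>\<^bsub>C\<^esub> a) \<bullet>\<^bsub>D\<^esub> FMult G a \<one>\<^bsub>C\<^esub> \<bullet>\<^bsub>D\<^esub> (\<iota>\<^bsub>D\<^esub> (FObj G a) \<odot>\<^bsub>D\<^esub> FUnit G) = \<rho>\<^bsub>D\<^esub> (FObj G a))"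

text \<open>The canonical isomorphism \<open>\<delta>\<^sub>x : G (x\<^sup>*) \<rightarrow> (G x)\<^sup>*\<close>.\<close>

definition dual_comparison ::
  "('c, 'f, 'y) pivcat_scheme \<Rightarrow> ('o, 'm, 'z) pivcat_scheme \<Rightarrow> ('c, 'f, 'o, 'm, 'w) tfunctor_scheme
    \<Rightarrow> 'c \<Rightarrow> 'm"
where
  "dual_comparison C D G x =
     transpose D (FObj G (Dual C x)) (FObj G x)
       (inv_arr D \<one>\<^bsub>D\<^esub> (FObj G \<one>\<^bsub>C\<^esub>) (FUnit G) \<bullet>\<^bsub>D\<^esub> FArr G (Ev C x) \<bullet>\<^bsub>D\<^esub> FMult G (Dual C x) x)"

definition is_pivotal_functor ::
  "('c, 'f, 'y) pivcat_scheme \<Rightarrow> ('o, 'm, 'z) pivcat_scheme \<Rightarrow> ('c, 'f, 'o, 'm, 'w) tfunctor_scheme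
    \<Rightarrow> bool"
where
  "is_pivotal_functor C D G \<longleftrightarrow>
     is_tensor_functor C D G \<and>
     (\<forall>x\<in>Obj C.
        FArr G (Piv C x) =
          inv_arr D (FObj G (Dual C (Dual C x))) (Dual D (FObj G (Dual C x)))
            (dual_comparison C D G (Dual C x))
          \<bullet>\<^bsub>D\<^esub> dual_arr D (FObj G (Dual C x)) (Dual D (FObj G x)) (dual_comparison C D G x)
          \<bullet>\<^bsub>D\<^esub> Piv D (FObj G x))"

definition tfunctor_comp ::
  "('p, 'n, 'z) cat_scheme \<Rightarrow> ('o, 'm, 'p, 'n) tfunctor \<Rightarrow> ('c, 'f, 'o, 'm) tfunctor
    \<Rightarrow> ('c, 'f, 'p, 'n) tfunctor"
where
  "tfunctor_comp E G F =
     \<lparr> FObj = (\<lambda>a. FObj G (FObj F a)),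
       FArr = (\<lambda>f. FArr G (FArr F f)),
       FMult = (\<lambda>a b. FArr G (FMult F a b) \<bullet>\<^bsub>E\<^esub> FMult G (FObj F a) (FObj F b)),
       FUnit = FArr G (FUnit F) \<bullet>\<^bsub>E\<^esub> FUnit G \<rparr>"

text \<open>
  \<open>T\<close> is right adjoint to \<open>G\<close> with counit \<open>\<epsilon>\<close>; the bijection sends a morphism
  \<open>g : c \<rightarrow> T x\<close> to its mate \<open>G c \<rightarrow> x\<close>.
\<close>

definition is_right_adjoint ::
  "('c, 'f, 'y) cat_scheme \<Rightarrow> ('o, 'm, 'z) cat_scheme \<Rightarrow> ('c, 'f, 'o, 'm, 'w) cfunctor_scheme
    \<Rightarrow> ('o, 'm, 'c, 'f, 'v) cfunctor_scheme \<Rightarrow> ('o \<Rightarrow> 'm) \<Rightarrow> bool"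
where
  "is_right_adjoint C D G T \<epsilon> \<longleftrightarrow>
     is_functor D C T \<and>
     (\<forall>x\<in>Obj D. \<epsilon> x \<in> Hom D (FObj G (FObj T x)) x) \<and>
     (\<forall>x\<in>Obj D. \<forall>y\<in>Obj D. \<forall>f\<in>Hom D x y. \<epsilon> y \<bullet>\<^bsub>D\<^esub> FArr G (FArr T f) = f \<bullet>\<^bsub>D\<^esub> \<epsilon> x) \<and>
     (\<forall>c\<in>Obj C. \<forall>x\<in>Obj D.
        bij_betw (\<lambda>g. \<epsilon> x \<bullet>\<^bsub>D\<^esub> FArr G g) (Hom C c (FObj T x)) (Hom D (FObj G c) x))"

text \<open>The morphism \<open>c \<rightarrow> T x\<close> whose mate is \<open>h\<close>.\<close>

definition with_mate ::
  "('c, 'f, 'y) cat_scheme \<Rightarrow> ('o, 'm, 'z) cat_scheme \<Rightarrow> ('c, 'f, 'o, 'm, 'w) cfunctor_scheme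
    \<Rightarrow> ('o, 'm, 'c, 'f, 'v) cfunctor_scheme \<Rightarrow> ('o \<Rightarrow> 'm) \<Rightarrow> 'c \<Rightarrow> 'o \<Rightarrow> 'm \<Rightarrow> 'f"
where
  "with_mate C D G T \<epsilon> c x h = (THE g. g \<in> Hom C c (FObj T x) \<and> \<epsilon> x \<bullet>\<^bsub>D\<^esub> FArr G g = h)"


section \<open>The Drinfel'd center\<close>

text \<open>Half-braidings are extensional, so that objects of the center are determined by their data.\<close>

definition is_half_braiding :: "('o, 'm, 'z) moncat_scheme \<Rightarrow> 'o \<Rightarrow> ('o \<Rightarrow> 'm) \<Rightarrow> bool" where
  "is_half_braiding M a e \<longleftrightarrow>
     e \<in> extensional (Obj M) \<and>
     (\<forall>b\<in>Obj M. e b \<in> Iso M (a \<otimes>\<^bsub>M\<^esub> b) (b \<otimes>\<^bsub>M\<^esub> a)) \<and>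
     (\<forall>b\<in>Obj M. \<forall>c\<in>Obj M. \<forall>f\<in>Hom M b c.
        e c \<bullet>\<^bsub>M\<^esub> (\<iota>\<^bsub>M\<^esub> a \<odot>\<^bsub>M\<^esub> f) = (f \<odot>\<^bsub>M\<^esub> \<iota>\<^bsub>M\<^esub> a) \<bullet>\<^bsub>M\<^esub> e b) \<and>
     (\<forall>b\<in>Obj M. \<forall>c\<in>Obj M.
        e (b \<otimes>\<^bsub>M\<^esub> c) =
          \<alpha>\<^sup>-\<^bsub>M\<^esub> b c a \<bullet>\<^bsub>M\<^esub> (\<iota>\<^bsub>M\<^esub> b \<odot>\<^bsub>M\<^esub> e c) \<bullet>\<^bsub>M\<^esub> \<alpha>\<^bsub>M\<^esub> b a c
            \<bullet>\<^bsub>M\<^esub> (e b \<odot>\<^bsub>M\<^esub> \<iota>\<^bsub>M\<^esub> c) \<bullet>\<^bsub>M\<^esub> \<alpha>\<^sup>-\<^bsub>M\<^esub> a b c)"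

definition center_tensor ::
  "('o, 'm, 'z) moncat_scheme \<Rightarrow> 'o \<times> ('o \<Rightarrow> 'm) \<Rightarrow> 'o \<times> ('o \<Rightarrow> 'm) \<Rightarrow> 'o \<times> ('o \<Rightarrow> 'm)" where
  "center_tensor M = (\<lambda>(a, e) (b, e').
     (a \<otimes>\<^bsub>M\<^esub> b,
      \<lambda>c\<in>Obj M.
        \<alpha>\<^bsub>M\<^esub> c a b \<bullet>\<^bsub>M\<^esub> (e c \<odot>\<^bsub>M\<^esub> \<iota>\<^bsub>M\<^esub> b) \<bullet>\<^bsub>M\<^esub> \<alpha>\<^sup>-\<^bsub>M\<^esub> a c b
          \<bullet>\<^bsub>M\<^esub> (\<iota>\<^bsub>M\<^esub> a \<odot>\<^bsub>M\<^esub> e' c) \<bullet>\<^bsub>M\<^esub> \<alpha>\<^bsub>M\<^esub> a b c))"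

text \<open>
  The half-braiding on \<open>a\<^sup>*\<close> is the one for which the evaluation and coevaluation of \<open>a\<close> are
  morphisms of the center:
  \<open>e\<^bsub>a*,b\<^esub> = (ev\<^sub>a \<otimes> id) \<circ> (id \<otimes> e\<^sub>a\<^sub>,\<^sub>b\<^sup>-\<^sup>1 \<otimes> id) \<circ> (id \<otimes> coev\<^sub>a)\<close> up to associators and unitors.
\<close>

definition center_dual ::
  "('o, 'm, 'z) pivcat_scheme \<Rightarrow> 'o \<times> ('o \<Rightarrow> 'm) \<Rightarrow> 'o \<times> ('o \<Rightarrow> 'm)" where
  "center_dual M = (\<lambda>(a, e).
     (Dual M a,
      \<lambda>b\<in>Obj M.
        \<ell>\<^bsub>M\<^esub> (b \<otimes>\<^bsub>M\<^esub> Dual M a)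
        \<bullet>\<^bsub>M\<^esub> (Ev M a \<odot>\<^bsub>M\<^esub> \<iota>\<^bsub>M\<^esub> (b \<otimes>\<^bsub>M\<^esub> Dual M a))
        \<bullet>\<^bsub>M\<^esub> \<alpha>\<^sup>-\<^bsub>M\<^esub> (Dual M a) a (b \<otimes>\<^bsub>M\<^esub> Dual M a)
        \<bullet>\<^bsub>M\<^esub> (\<iota>\<^bsub>M\<^esub> (Dual M a) \<odot>\<^bsub>M\<^esub>
              (\<alpha>\<^bsub>M\<^esub> a b (Dual M a)
               \<bullet>\<^bsub>M\<^esub> (inv_arr M (a \<otimes>\<^bsub>M\<^esub> b) (b \<otimes>\<^bsub>M\<^esub> a) (e b) \<odot>\<^bsub>M\<^esub> \<iota>\<^bsub>M\<^esub> (Dual M a))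
               \<bullet>\<^bsub>M\<^esub> \<alpha>\<^sup>-\<^bsub>M\<^esub> b a (Dual M a)))
        \<bullet>\<^bsub>M\<^esub> \<alpha>\<^bsub>M\<^esub> (Dual M a) b (a \<otimes>\<^bsub>M\<^esub> Dual M a)
        \<bullet>\<^bsub>M\<^esub> (\<iota>\<^bsub>M\<^esub> (Dual M a \<otimes>\<^bsub>M\<^esub> b) \<odot>\<^bsub>M\<^esub> Coev M a)
        \<bullet>\<^bsub>M\<^esub> \<rho>\<^sup>-\<^bsub>M\<^esub> (Dual M a \<otimes>\<^bsub>M\<^esub> b)))"

definition center :: "('o, 'm, 'z) pivcat_scheme \<Rightarrow> ('o \<times> ('o \<Rightarrow> 'm), 'm) pivcat" where
  "center M =
     \<lparr> Obj = {(a, e). a \<in> Obj M \<and> is_half_braiding M a e},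
       Hom = (\<lambda>(a, e) (b, e').
         {f \<in> Hom M a b.
            \<forall>c\<in>Obj M. (\<iota>\<^bsub>M\<^esub> c \<odot>\<^bsub>M\<^esub> f) \<bullet>\<^bsub>M\<^esub> e c = e' c \<bullet>\<^bsub>M\<^esub> (f \<odot>\<^bsub>M\<^esub> \<iota>\<^bsub>M\<^esub> c)}),
       Ident = (\<lambda>A. \<iota>\<^bsub>M\<^esub> (fst A)),
       Comp = Comp M,
       TensorO = center_tensor M,
       TensorA = TensorA M,
       Unit = (\<one>\<^bsub>M\<^esub>, \<lambda>b\<in>Obj M. \<rho>\<^sup>-\<^bsub>M\<^esub> b \<bullet>\<^bsub>M\<^esub> \<ell>\<^bsub>M\<^esub> b),
       Assoc = (\<lambda>A B D. \<alpha>\<^bsub>M\<^esub> (fst A) (fst B) (fst D)),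
       LUnit = (\<lambda>A. \<ell>\<^bsub>M\<^esub> (fst A)),
       RUnit = (\<lambda>A. \<rho>\<^bsub>M\<^esub> (fst A)),
       Dual = center_dual M,
       Ev = (\<lambda>A. Ev M (fst A)),
       Coev = (\<lambda>A. Coev M (fst A)),
       Piv = (\<lambda>A. Piv M (fst A)) \<rparr>"

definition forgetful ::
  "('o, 'm, 'z) moncat_scheme \<Rightarrow> ('o \<times> ('o \<Rightarrow> 'm), 'm, 'o, 'm) tfunctor" where
  "forgetful M =
     \<lparr> FObj = fst,
       FArr = (\<lambda>f. f),
       FMult = (\<lambda>A B. \<iota>\<^bsub>M\<^esub> (fst A \<otimes>\<^bsub>M\<^esub> fst B)),
       FUnit = \<iota>\<^bsub>M\<^esub> \<one>\<^bsub>M\<^esub> \<rparr>"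


section \<open>The categorified trace\<close>

definition underlying ::
  "('o, 'm, 'z) pivcat_scheme \<Rightarrow> ('c, 'f, 'o \<times> ('o \<Rightarrow> 'm), 'm) tfunctor \<Rightarrow> ('c, 'f, 'o, 'm) tfunctor"
where
  "underlying M \<Phi>Z = tfunctor_comp M (forgetful M) \<Phi>Z"

definition trace_mult ::
  "('c, 'f, 'y) pivcat_scheme \<Rightarrow> ('o, 'm, 'z) pivcat_scheme \<Rightarrow> ('c, 'f, 'o, 'm) tfunctor
    \<Rightarrow> ('o, 'm, 'c, 'f) cfunctor \<Rightarrow> ('o \<Rightarrow> 'm) \<Rightarrow> 'o \<Rightarrow> 'o \<Rightarrow> 'f"
where
  "trace_mult C M \<Phi> Tr \<epsilon> x y =
     with_mate C M \<Phi> Tr \<epsilon> (FObj Tr x \<otimes>\<^bsub>C\<^esub> FObj Tr y) (x \<otimes>\<^bsub>M\<^esub> y)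
       ((\<epsilon> x \<odot>\<^bsub>M\<^esub> \<epsilon> y)
        \<bullet>\<^bsub>M\<^esub> inv_arr M (FObj \<Phi> (FObj Tr x) \<otimes>\<^bsub>M\<^esub> FObj \<Phi> (FObj Tr y))
             (FObj \<Phi> (FObj Tr x \<otimes>\<^bsub>C\<^esub> FObj Tr y)) (FMult \<Phi> (FObj Tr x) (FObj Tr y)))"

text \<open>
  The half-braiding \<open>e\<^bsub>\<Phi>(c),y\<^esub>\<close> is the second component of the object \<open>\<Phi>\<^sup>Z(c)\<close> of the center.
\<close>

definition traciator_mate ::
  "('o, 'm, 'z) pivcat_scheme \<Rightarrow> ('c, 'f, 'o \<times> ('o \<Rightarrow> 'm), 'm) tfunctor
    \<Rightarrow> ('o, 'm, 'c, 'f) cfunctor \<Rightarrow> ('o \<Rightarrow> 'm) \<Rightarrow> 'o \<Rightarrow> 'o \<Rightarrow> 'm"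
where
  "traciator_mate M \<Phi>Z Tr \<epsilon> x y =
     (let c = FObj Tr (x \<otimes>\<^bsub>M\<^esub> y);
          p = FObj (underlying M \<Phi>Z) c;
          e = snd (FObj \<Phi>Z c);
          y' = Dual M y
      in \<rho>\<^bsub>M\<^esub> (y \<otimes>\<^bsub>M\<^esub> x)
         \<bullet>\<^bsub>M\<^esub> (\<iota>\<^bsub>M\<^esub> (y \<otimes>\<^bsub>M\<^esub> x) \<odot>\<^bsub>M\<^esub> ev_tilde M y)
         \<bullet>\<^bsub>M\<^esub> \<alpha>\<^bsub>M\<^esub> (y \<otimes>\<^bsub>M\<^esub> x) y y'
         \<bullet>\<^bsub>M\<^esub> (\<alpha>\<^sup>-\<^bsub>M\<^esub> y x y \<odot>\<^bsub>M\<^esub> \<iota>\<^bsub>M\<^esub> y')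
         \<bullet>\<^bsub>M\<^esub> ((\<iota>\<^bsub>M\<^esub> y \<odot>\<^bsub>M\<^esub> \<epsilon> (x \<otimes>\<^bsub>M\<^esub> y)) \<odot>\<^bsub>M\<^esub> \<iota>\<^bsub>M\<^esub> y')
         \<bullet>\<^bsub>M\<^esub> (e y \<odot>\<^bsub>M\<^esub> \<iota>\<^bsub>M\<^esub> y')
         \<bullet>\<^bsub>M\<^esub> \<alpha>\<^sup>-\<^bsub>M\<^esub> p y y'
         \<bullet>\<^bsub>M\<^esub> (\<iota>\<^bsub>M\<^esub> p \<odot>\<^bsub>M\<^esub> Coev M y)
         \<bullet>\<^bsub>M\<^esub> \<rho>\<^sup>-\<^bsub>M\<^esub> p)"

definition traciator ::
  "('c, 'f, 'y) pivcat_scheme \<Rightarrow> ('o, 'm, 'z) pivcat_scheme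
    \<Rightarrow> ('c, 'f, 'o \<times> ('o \<Rightarrow> 'm), 'm) tfunctor
    \<Rightarrow> ('o, 'm, 'c, 'f) cfunctor \<Rightarrow> ('o \<Rightarrow> 'm) \<Rightarrow> 'o \<Rightarrow> 'o \<Rightarrow> 'f"
where
  "traciator C M \<Phi>Z Tr \<epsilon> x y =
     with_mate C M (underlying M \<Phi>Z) Tr \<epsilon> (FObj Tr (x \<otimes>\<^bsub>M\<^esub> y)) (y \<otimes>\<^bsub>M\<^esub> x)
       (traciator_mate M \<Phi>Z Tr \<epsilon> x y)"

definition traciator_neg ::
  "('c, 'f, 'y) pivcat_scheme \<Rightarrow> ('o, 'm, 'z) pivcat_scheme
    \<Rightarrow> ('c, 'f, 'o \<times> ('o \<Rightarrow> 'm), 'm) tfunctor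
    \<Rightarrow> ('o, 'm, 'c, 'f) cfunctor \<Rightarrow> ('o \<Rightarrow> 'm) \<Rightarrow> 'o \<Rightarrow> 'o \<Rightarrow> 'f"
where
  "traciator_neg C M \<Phi>Z Tr \<epsilon> x y =
     inv_arr C (FObj Tr (y \<otimes>\<^bsub>M\<^esub> x)) (FObj Tr (x \<otimes>\<^bsub>M\<^esub> y)) (traciator C M \<Phi>Z Tr \<epsilon> y x)"

end

theory Submission
  imports Defs
begin

text \<open>
  Write \<open>P\<close>, \<open>Q\<close> for objects \<open>\<Phi>(c)\<close> with their half-braidings.  Bending \<open>y\<close> turns
  \<open>g : Q \<rightarrow> y \<otimes> x\<close> into \<open>(ev \<otimes> x) (y\<^sup>* \<otimes> g) e : Q \<otimes> y\<^sup>* \<rightarrow> x\<close> and \<open>f : Q \<rightarrow> x \<otimes> y\<close>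
  into \<open>(x \<otimes> ev~) (f \<otimes> y\<^sup>*) : Q \<otimes> y\<^sup>* \<rightarrow> x\<close>.  Both operations are bijective, and a morphism \<open>g\<close> into
  \<open>Tr(y \<otimes> x)\<close> is \<open>\<tau> f\<close> exactly when the bent mates of \<open>g\<close> and \<open>f\<close> agree; in particular \<open>\<tau>\<close> is
  invertible.  By multiplicativity of the half-braiding on \<open>P \<otimes> Q\<close>, the mate of
  \<open>\<tau> \<mu> (id \<otimes> f)\<close> is then the mate of \<open>\<tau> f\<close> with \<open>P\<close> braided past \<open>y\<close> and evaluated by the counit at
  \<open>w\<close>.  After composing both sides of the claim with \<open>\<tau>\<close>, this formula computes the two
  mates, and they agree because braiding \<open>P\<close> past \<open>y\<close> commutes with tensoring on the right.
\<close>

text \<open>Bent mates characterise the traciator because the crossings in its formula can be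
  removed. When the left bend is applied to that formula, \<open>P\<close> passes first the dual of
  \<open>y\<close> and then \<open>y\<close>, and the pair is evaluated. By naturality of the
  half-braiding along the evaluation this equals evaluating beside an untouched \<open>P\<close>,
  provided that the half-braiding is trivial at the unit (\<open>braid_past_unit\<close>,
  \<open>lcontract_braid_past\<close>). What remains is a zig-zag. The half-braiding of
  \<open>P\<close> at the dual of \<open>y\<close> therefore never has to be computed from the one
  at \<open>y\<close>.

  The second obstacle is that associators and unitors are explicit in both categories. The
  operations \<open>lcontract\<close>, \<open>rcontract\<close>, \<open>linsert\<close>,
  \<open>rinsert\<close> and \<open>braid_past\<close> each absorb the associators that belong to
  one elementary move, so that the pentagon is used in a few lemmas only. Mates are compared after
  composing with \<open>\<Phi>mult\<close>, which is invertible and, being a morphism of the center,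
  exchanges the half-braiding of a value of \<Phi> at a product for the product
  half-braiding.\<close>

section \<open>Typed arrows\<close>

text \<open>
  Morphisms packaged with source and target.  Composition returns \<open>Null\<close> on ill-typed arguments, so
  that associativity holds without side conditions.
\<close>

datatype ('o, 'm) arrow = Null | Arrow (Dom: 'o) (Body: 'm) (Cod: 'o)

definition arr :: "('o, 'm, 'z) cat_scheme \<Rightarrow> ('o, 'm) arrow \<Rightarrow> bool" where
  "arr M f \<longleftrightarrow> f \<noteq> Null \<and> Dom f \<in> Obj M \<and> Cod f \<in> Obj M \<and> Body f \<in> Hom M (Dom f) (Cod f)"

definition acomp ::
  "('o, 'm, 'z) cat_scheme \<Rightarrow> ('o, 'm) arrow \<Rightarrow> ('o, 'm) arrow \<Rightarrow> ('o, 'm) arrow"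
  (infixr "\<cdot>\<index>" 55) where
  "g \<cdot>\<^bsub>M\<^esub> f =
    (if arr M g \<and> arr M f \<and> Dom g = Cod f then Arrow (Dom f) (Body g \<bullet>\<^bsub>M\<^esub> Body f) (Cod g) else Null)"

definition aid :: "('o, 'm, 'z) cat_scheme \<Rightarrow> 'o \<Rightarrow> ('o, 'm) arrow" ("\<II>\<index>") where
  "\<II>\<^bsub>M\<^esub> a = Arrow a (\<iota>\<^bsub>M\<^esub> a) a"

definition atens ::
  "('o, 'm, 'z) moncat_scheme \<Rightarrow> ('o, 'm) arrow \<Rightarrow> ('o, 'm) arrow \<Rightarrow> ('o, 'm) arrow"
  (infixr "\<star>\<index>" 65) where
  "f \<star>\<^bsub>M\<^esub> g =
    (if arr M f \<and> arr M g
     then Arrow (Dom f \<otimes>\<^bsub>M\<^esub> Dom g) (Body f \<odot>\<^bsub>M\<^esub> Body g) (Cod f \<otimes>\<^bsub>M\<^esub> Cod g) else Null)"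

definition aassoc :: "('o, 'm, 'z) moncat_scheme \<Rightarrow> 'o \<Rightarrow> 'o \<Rightarrow> 'o \<Rightarrow> ('o, 'm) arrow" ("\<AA>\<index>") where
  "\<AA>\<^bsub>M\<^esub> a b c = Arrow ((a \<otimes>\<^bsub>M\<^esub> b) \<otimes>\<^bsub>M\<^esub> c) (\<alpha>\<^bsub>M\<^esub> a b c) (a \<otimes>\<^bsub>M\<^esub> b \<otimes>\<^bsub>M\<^esub> c)"

definition aassoc_inv :: "('o, 'm, 'z) moncat_scheme \<Rightarrow> 'o \<Rightarrow> 'o \<Rightarrow> 'o \<Rightarrow> ('o, 'm) arrow"
  ("\<AA>\<^sup>-\<index>") where
  "\<AA>\<^sup>-\<^bsub>M\<^esub> a b c = Arrow (a \<otimes>\<^bsub>M\<^esub> b \<otimes>\<^bsub>M\<^esub> c) (\<alpha>\<^sup>-\<^bsub>M\<^esub> a b c) ((a \<otimes>\<^bsub>M\<^esub> b) \<otimes>\<^bsub>M\<^esub> c)"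

definition alunit :: "('o, 'm, 'z) moncat_scheme \<Rightarrow> 'o \<Rightarrow> ('o, 'm) arrow" ("\<LL>\<index>") where
  "\<LL>\<^bsub>M\<^esub> a = Arrow (\<one>\<^bsub>M\<^esub> \<otimes>\<^bsub>M\<^esub> a) (\<ell>\<^bsub>M\<^esub> a) a"

definition alunit_inv :: "('o, 'm, 'z) moncat_scheme \<Rightarrow> 'o \<Rightarrow> ('o, 'm) arrow" ("\<LL>\<^sup>-\<index>") where
  "\<LL>\<^sup>-\<^bsub>M\<^esub> a = Arrow a (\<ell>\<^sup>-\<^bsub>M\<^esub> a) (\<one>\<^bsub>M\<^esub> \<otimes>\<^bsub>M\<^esub> a)"

definition arunit :: "('o, 'm, 'z) moncat_scheme \<Rightarrow> 'o \<Rightarrow> ('o, 'm) arrow" ("\<RR>\<index>") where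
  "\<RR>\<^bsub>M\<^esub> a = Arrow (a \<otimes>\<^bsub>M\<^esub> \<one>\<^bsub>M\<^esub>) (\<rho>\<^bsub>M\<^esub> a) a"

definition arunit_inv :: "('o, 'm, 'z) moncat_scheme \<Rightarrow> 'o \<Rightarrow> ('o, 'm) arrow" ("\<RR>\<^sup>-\<index>") where
  "\<RR>\<^sup>-\<^bsub>M\<^esub> a = Arrow a (\<rho>\<^sup>-\<^bsub>M\<^esub> a) (a \<otimes>\<^bsub>M\<^esub> \<one>\<^bsub>M\<^esub>)"

lemma arr_Null [simp]: "\<not> arr M Null"
  by (simp add: arr_def)

lemma arr_Arrow: "arr M (Arrow a f b) \<longleftrightarrow> a \<in> Obj M \<and> b \<in> Obj M \<and> f \<in> Hom M a b"
  by (simp add: arr_def)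

lemma arr_Dom [simp]: "arr M f \<Longrightarrow> Dom f \<in> Obj M"
  and arr_Cod [simp]: "arr M f \<Longrightarrow> Cod f \<in> Obj M"
  and arr_Body: "arr M f \<Longrightarrow> Body f \<in> Hom M (Dom f) (Cod f)"
  by (simp_all add: arr_def)

lemma arrow_eqI:
  "\<lbrakk>arr M f; arr M g; Dom f = Dom g; Cod f = Cod g; Body f = Body g\<rbrakk> \<Longrightarrow> f = g"
  unfolding arr_def by (rule arrow.expand) auto

lemma Dom_comp [simp]: "\<lbrakk>arr M g; arr M f; Dom g = Cod f\<rbrakk> \<Longrightarrow> Dom (g \<cdot>\<^bsub>M\<^esub> f) = Dom f"
  and Cod_comp [simp]: "\<lbrakk>arr M g; arr M f; Dom g = Cod f\<rbrakk> \<Longrightarrow> Cod (g \<cdot>\<^bsub>M\<^esub> f) = Cod g"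
  and Body_comp [simp]: "\<lbrakk>arr M g; arr M f; Dom g = Cod f\<rbrakk> \<Longrightarrow> Body (g \<cdot>\<^bsub>M\<^esub> f) = Body g \<bullet>\<^bsub>M\<^esub> Body f"
  by (simp_all add: acomp_def)

lemma Dom_id [simp]: "Dom (\<II>\<^bsub>M\<^esub> a) = a" and Cod_id [simp]: "Cod (\<II>\<^bsub>M\<^esub> a) = a"
  and Body_id [simp]: "Body (\<II>\<^bsub>M\<^esub> a) = \<iota>\<^bsub>M\<^esub> a"
  by (simp_all add: aid_def)

lemma Dom_tensor [simp]: "\<lbrakk>arr M f; arr M g\<rbrakk> \<Longrightarrow> Dom (f \<star>\<^bsub>M\<^esub> g) = Dom f \<otimes>\<^bsub>M\<^esub> Dom g"
  and Cod_tensor [simp]: "\<lbrakk>arr M f; arr M g\<rbrakk> \<Longrightarrow> Cod (f \<star>\<^bsub>M\<^esub> g) = Cod f \<otimes>\<^bsub>M\<^esub> Cod g"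
  and Body_tensor [simp]: "\<lbrakk>arr M f; arr M g\<rbrakk> \<Longrightarrow> Body (f \<star>\<^bsub>M\<^esub> g) = Body f \<odot>\<^bsub>M\<^esub> Body g"
  by (simp_all add: atens_def)

lemma constraint_arrow_simps [simp]:
  "Dom (\<AA>\<^bsub>M\<^esub> a b c) = (a \<otimes>\<^bsub>M\<^esub> b) \<otimes>\<^bsub>M\<^esub> c" "Cod (\<AA>\<^bsub>M\<^esub> a b c) = a \<otimes>\<^bsub>M\<^esub> b \<otimes>\<^bsub>M\<^esub> c"
  "Body (\<AA>\<^bsub>M\<^esub> a b c) = \<alpha>\<^bsub>M\<^esub> a b c"
  "Dom (\<AA>\<^sup>-\<^bsub>M\<^esub> a b c) = a \<otimes>\<^bsub>M\<^esub> b \<otimes>\<^bsub>M\<^esub> c" "Cod (\<AA>\<^sup>-\<^bsub>M\<^esub> a b c) = (a \<otimes>\<^bsub>M\<^esub> b) \<otimes>\<^bsub>M\<^esub> c"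
  "Body (\<AA>\<^sup>-\<^bsub>M\<^esub> a b c) = \<alpha>\<^sup>-\<^bsub>M\<^esub> a b c"
  "Dom (\<LL>\<^bsub>M\<^esub> a) = \<one>\<^bsub>M\<^esub> \<otimes>\<^bsub>M\<^esub> a" "Cod (\<LL>\<^bsub>M\<^esub> a) = a" "Body (\<LL>\<^bsub>M\<^esub> a) = \<ell>\<^bsub>M\<^esub> a"
  "Dom (\<LL>\<^sup>-\<^bsub>M\<^esub> a) = a" "Cod (\<LL>\<^sup>-\<^bsub>M\<^esub> a) = \<one>\<^bsub>M\<^esub> \<otimes>\<^bsub>M\<^esub> a" "Body (\<LL>\<^sup>-\<^bsub>M\<^esub> a) = \<ell>\<^sup>-\<^bsub>M\<^esub> a"
  "Dom (\<RR>\<^bsub>M\<^esub> a) = a \<otimes>\<^bsub>M\<^esub> \<one>\<^bsub>M\<^esub>" "Cod (\<RR>\<^bsub>M\<^esub> a) = a" "Body (\<RR>\<^bsub>M\<^esub> a) = \<rho>\<^bsub>M\<^esub> a"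
  "Dom (\<RR>\<^sup>-\<^bsub>M\<^esub> a) = a" "Cod (\<RR>\<^sup>-\<^bsub>M\<^esub> a) = a \<otimes>\<^bsub>M\<^esub> \<one>\<^bsub>M\<^esub>" "Body (\<RR>\<^sup>-\<^bsub>M\<^esub> a) = \<rho>\<^sup>-\<^bsub>M\<^esub> a"
  by (simp_all add: aassoc_def aassoc_inv_def alunit_def alunit_inv_def arunit_def arunit_inv_def)

context category
begin

lemma arr_id [simp]: "arr M (\<II> a) \<longleftrightarrow> a \<in> Obj M"
  by (auto simp: aid_def arr_Arrow id_in_hom)

lemma arr_comp_iff [simp]: "arr M (g \<cdot> f) \<longleftrightarrow> arr M g \<and> arr M f \<and> Dom g = Cod f"
proof (cases "arr M g \<and> arr M f \<and> Dom g = Cod f")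
  case True
  then show ?thesis
    using comp_in_hom[of "Dom f" "Cod f" "Cod g" "Body g" "Body f"] arr_Body[of M f] arr_Body[of M g]
    by (simp add: acomp_def arr_Arrow)
next
  case False
  then show ?thesis
    by (auto simp: acomp_def)
qed

lemma acomp_Null: "\<not> arr M (g \<cdot> f) \<Longrightarrow> g \<cdot> f = Null"
  by (metis acomp_def arr_comp_iff)

lemma acomp_id_right [simp]: "\<lbrakk>arr M f; Dom f = a\<rbrakk> \<Longrightarrow> f \<cdot> \<II> a = f"
  using comp_id_right[of "Dom f" "Cod f" "Body f"] arr_Body[of M f] by (intro arrow_eqI[of M]) auto

lemma acomp_id_left [simp]: "\<lbrakk>arr M f; Cod f = b\<rbrakk> \<Longrightarrow> \<II> b \<cdot> f = f"
  using comp_id_left[of "Dom f" "Cod f" "Body f"] arr_Body[of M f] by (intro arrow_eqI[of M]) auto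

lemma acomp_assoc: "(h \<cdot> g) \<cdot> f = h \<cdot> (g \<cdot> f)"
proof (cases "arr M h \<and> arr M g \<and> arr M f \<and> Dom h = Cod g \<and> Dom g = Cod f")
  case True
  then show ?thesis
    using comp_assoc[of "Dom f" "Dom g" "Dom h" "Cod h" "Body h" "Body g" "Body f"]
      arr_Body[of M f] arr_Body[of M g] arr_Body[of M h]
    by (intro arrow_eqI[of M]) simp_all
next
  case False
  have "\<not> arr M ((h \<cdot> g) \<cdot> f)" "\<not> arr M (h \<cdot> (g \<cdot> f))"
    using False by auto
  then show ?thesis
    by (metis acomp_Null)
qed

text \<open>Composites are kept nested to the right, where the two factors of a known equation are
  usually followed by a tail \<open>h\<close>. This gives the equation in the form that rewrites
  inside such a chain.\<close>

lemma acomp_extend: "g \<cdot> f = k \<Longrightarrow> g \<cdot> (f \<cdot> h) = k \<cdot> h"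
  by (simp flip: acomp_assoc)

text \<open>\<open>inv_arr\<close> is a definite description, so it denotes an inverse only because
  two-sided inverses are unique.\<close>

lemma inv_arr_is_inverse:
  assumes "f \<in> Iso M a b" "a \<in> Obj M" "b \<in> Obj M"
  shows "is_inverse M a b f (inv_arr M a b f)"
proof -
  obtain g where g: "is_inverse M a b f g"
    using assms by (auto simp: Iso_def)
  have f: "f \<in> Hom M a b"
    using assms by (simp add: Iso_def)
  have "h = g" if "is_inverse M a b f h" for h
  proof -
    have "h = h \<bullet> (f \<bullet> g)"
      using that g assms by (simp add: is_inverse_def comp_id_right)
    also have "\<dots> = (h \<bullet> f) \<bullet> g"
      using that g f assms comp_assoc[of b a b a h f g] by (simp add: is_inverse_def)
    also have "\<dots> = g"
      using that g assms by (simp add: is_inverse_def comp_id_left)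
    finally show ?thesis .
  qed
  with g show ?thesis
    unfolding inv_arr_def by (metis theI)
qed

lemma Iso_arrow:
  assumes "f \<in> Iso M a b" "a \<in> Obj M" "b \<in> Obj M"
  shows "arr M (Arrow a f b)" "arr M (Arrow b (inv_arr M a b f) a)"
    "Arrow a f b \<cdot> Arrow b (inv_arr M a b f) a = \<II> b"
    "Arrow b (inv_arr M a b f) a \<cdot> Arrow a f b = \<II> a"
  using inv_arr_is_inverse[OF assms] assms
  by (auto simp: is_inverse_def arr_Arrow Iso_def acomp_def aid_def)

text \<open>A one-sided inverse suffices: a right inverse \<open>k\<close> makes \<open>h\<close>
  cancellable on the right. Morphisms are compared below after composing with an associator, a
  braiding or \<open>\<Phi>mult\<close> on that side.\<close>

lemma cancel_right_inverse:
  assumes "f \<cdot> h = g \<cdot> h" and "h \<cdot> k = \<II> c" and "arr M f" "arr M g" "Dom f = c" "Dom g = c"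
  shows "f = g"
proof -
  have "f = (f \<cdot> h) \<cdot> k"
    using assms(2-) by (simp add: acomp_assoc)
  also have "\<dots> = (g \<cdot> h) \<cdot> k"
    by (simp only: assms(1))
  also have "\<dots> = g"
    using assms(2-) by (simp add: acomp_assoc)
  finally show ?thesis .
qed

lemma cancel_left_inverse:
  assumes "h \<cdot> f = h \<cdot> g" and "k \<cdot> h = \<II> c" and "arr M f" "arr M g" "Cod f = c" "Cod g = c"
  shows "f = g"
proof -
  have "f = k \<cdot> h \<cdot> f"
    using assms(2-) by (simp flip: acomp_assoc)
  also have "\<dots> = k \<cdot> h \<cdot> g"
    by (simp only: assms(1))
  also have "\<dots> = g"
    using assms(2-) by (simp flip: acomp_assoc)
  finally show ?thesis .
qed

end

context monoidal_category
begin

declare unit_in_obj [simp] tensor_in_obj [simp]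

lemma arr_tensor_iff [simp]: "arr M (f \<star> g) \<longleftrightarrow> arr M f \<and> arr M g"
  by (auto simp: atens_def arr_Arrow arr_Body intro: tensor_in_hom)

lemma atens_id [simp]: "\<lbrakk>a \<in> Obj M; b \<in> Obj M\<rbrakk> \<Longrightarrow> \<II> a \<star> \<II> b = \<II> (a \<otimes> b)"
  by (rule arrow_eqI[of M]) (auto simp: tensor_id)

text \<open>Matching endpoints are the only assumption, since an ill-typed factor turns both sides
  into \<open>Null\<close>. Interchange can thus rewrite any composite once sources and targets are
  compared.\<close>

lemma ainterchange:
  assumes "Dom g = Cod f" "Dom g' = Cod f'"
  shows "(g \<star> g') \<cdot> (f \<star> f') = (g \<cdot> f) \<star> (g' \<cdot> f')"
proof (cases "arr M g \<and> arr M g' \<and> arr M f \<and> arr M f'")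
  case True
  show ?thesis
  proof (rule arrow_eqI[of M])
    have "Body g \<in> Hom M (Cod f) (Cod g)" "Body g' \<in> Hom M (Cod f') (Cod g')"
      using True assms by (metis arr_Body)+
    then show "Body ((g \<star> g') \<cdot> f \<star> f') = Body ((g \<cdot> f) \<star> (g' \<cdot> f'))"
      using True assms interchange[of "Dom f" "Cod f" "Cod g" "Dom f'" "Cod f'" "Cod g'" "Body g" "Body f"]
      by (simp add: arr_Body)
  qed (use True assms in auto)
next
  case False
  then have "\<not> arr M ((g \<star> g') \<cdot> (f \<star> f'))" "\<not> arr M ((g \<cdot> f) \<star> (g' \<cdot> f'))"
    by auto
  then show ?thesis
    by (metis acomp_def atens_def arr_comp_iff arr_tensor_iff)
qed

lemma lwhisker_comp: "Dom g = Cod f \<Longrightarrow> a \<in> Obj M \<Longrightarrow> \<II> a \<star> (g \<cdot> f) = (\<II> a \<star> g) \<cdot> (\<II> a \<star> f)"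
  by (simp add: ainterchange)

lemma rwhisker_comp: "Dom g = Cod f \<Longrightarrow> a \<in> Obj M \<Longrightarrow> (g \<cdot> f) \<star> \<II> a = (g \<star> \<II> a) \<cdot> (f \<star> \<II> a)"
  by (simp add: ainterchange)

lemma assoc_arrow:
  assumes "a \<in> Obj M" "b \<in> Obj M" "c \<in> Obj M"
  shows arr_assoc [simp]: "arr M (\<AA> a b c)" and arr_assoc_inv [simp]: "arr M (\<AA>\<^sup>- a b c)"
    and assoc_inv_right [simp]: "\<AA> a b c \<cdot> \<AA>\<^sup>- a b c = \<II> (a \<otimes> b \<otimes> c)"
    and assoc_inv_left [simp]: "\<AA>\<^sup>- a b c \<cdot> \<AA> a b c = \<II> ((a \<otimes> b) \<otimes> c)"
  using Iso_arrow[OF assoc_iso[OF assms]] assms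
  by (simp_all add: aassoc_def aassoc_inv_def AssocInv_def)

lemma lunit_arrow:
  assumes "a \<in> Obj M"
  shows arr_lunit [simp]: "arr M (\<LL> a)" and arr_lunit_inv [simp]: "arr M (\<LL>\<^sup>- a)"
    and lunit_inv_right [simp]: "\<LL> a \<cdot> \<LL>\<^sup>- a = \<II> a"
    and lunit_inv_left [simp]: "\<LL>\<^sup>- a \<cdot> \<LL> a = \<II> (\<one> \<otimes> a)"
  using Iso_arrow[OF lunit_iso[OF assms]] assms
  by (simp_all add: alunit_def alunit_inv_def LUnitInv_def)

lemma runit_arrow:
  assumes "a \<in> Obj M"
  shows arr_runit [simp]: "arr M (\<RR> a)" and arr_runit_inv [simp]: "arr M (\<RR>\<^sup>- a)"
    and runit_inv_right [simp]: "\<RR> a \<cdot> \<RR>\<^sup>- a = \<II> a"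
    and runit_inv_left [simp]: "\<RR>\<^sup>- a \<cdot> \<RR> a = \<II> (a \<otimes> \<one>)"
  using Iso_arrow[OF runit_iso[OF assms]] assms
  by (simp_all add: arunit_def arunit_inv_def RUnitInv_def)

lemma assoc_nat:
  assumes "arr M f" "arr M g" "arr M h" "Cod f = a" "Cod g = b" "Cod h = c"
  shows "\<AA> a b c \<cdot> ((f \<star> g) \<star> h) = (f \<star> g \<star> h) \<cdot> \<AA> (Dom f) (Dom g) (Dom h)"
  using assms by (intro arrow_eqI[of M]) (auto intro!: assoc_natural simp: arr_Body)

lemma assoc_inv_nat:
  assumes "arr M f" "arr M g" "arr M h" "Cod f = a" "Cod g = b" "Cod h = c"
  shows "\<AA>\<^sup>- a b c \<cdot> (f \<star> g \<star> h) = ((f \<star> g) \<star> h) \<cdot> \<AA>\<^sup>- (Dom f) (Dom g) (Dom h)"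
proof (rule cancel_left_inverse[where k = "\<AA>\<^sup>- a b c" and h = "\<AA> a b c"])
  show "\<AA> a b c \<cdot> \<AA>\<^sup>- a b c \<cdot> (f \<star> g \<star> h)
    = \<AA> a b c \<cdot> ((f \<star> g) \<star> h) \<cdot> \<AA>\<^sup>- (Dom f) (Dom g) (Dom h)"
    using assms arr_Cod[OF assms(1)] arr_Cod[OF assms(2)] arr_Cod[OF assms(3)]
    by (simp add: acomp_extend[OF assoc_nat] acomp_extend[OF assoc_inv_right] acomp_assoc)
qed (use assms in auto)

lemma lunit_nat: "\<lbrakk>arr M f; Cod f = b\<rbrakk> \<Longrightarrow> \<LL> b \<cdot> (\<II> \<one> \<star> f) = f \<cdot> \<LL> (Dom f)"
  by (intro arrow_eqI[of M]) (auto intro!: lunit_natural simp: arr_Body)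

lemma runit_nat: "\<lbrakk>arr M f; Cod f = b\<rbrakk> \<Longrightarrow> \<RR> b \<cdot> (f \<star> \<II> \<one>) = f \<cdot> \<RR> (Dom f)"
  by (intro arrow_eqI[of M]) (auto intro!: runit_natural simp: arr_Body)

lemma lunit_inv_nat:
  assumes "arr M f" "Dom f = a"
  shows "\<LL>\<^sup>- (Cod f) \<cdot> f = (\<II> \<one> \<star> f) \<cdot> \<LL>\<^sup>- a"
proof (rule cancel_left_inverse[where k = "\<LL>\<^sup>- (Cod f)" and h = "\<LL> (Cod f)"])
  show "\<LL> (Cod f) \<cdot> \<LL>\<^sup>- (Cod f) \<cdot> f = \<LL> (Cod f) \<cdot> (\<II> \<one> \<star> f) \<cdot> \<LL>\<^sup>- a"
    using assms arr_Dom[OF assms(1)] by (simp add: acomp_extend[OF lunit_nat] acomp_extend[OF lunit_inv_right] acomp_assoc)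
qed (use assms in auto)

lemma runit_inv_nat:
  assumes "arr M f" "Dom f = a"
  shows "\<RR>\<^sup>- (Cod f) \<cdot> f = (f \<star> \<II> \<one>) \<cdot> \<RR>\<^sup>- a"
proof (rule cancel_left_inverse[where k = "\<RR>\<^sup>- (Cod f)" and h = "\<RR> (Cod f)"])
  show "\<RR> (Cod f) \<cdot> \<RR>\<^sup>- (Cod f) \<cdot> f = \<RR> (Cod f) \<cdot> (f \<star> \<II> \<one>) \<cdot> \<RR>\<^sup>- a"
    using assms arr_Dom[OF assms(1)] by (simp add: acomp_extend[OF runit_nat] acomp_extend[OF runit_inv_right] acomp_assoc)
qed (use assms in auto)

lemma apentagon:
  assumes "a \<in> Obj M" "b \<in> Obj M" "c \<in> Obj M" "d \<in> Obj M"
  shows "(\<II> a \<star> \<AA> b c d) \<cdot> \<AA> a (b \<otimes> c) d \<cdot> (\<AA> a b c \<star> \<II> d) = \<AA> a b (c \<otimes> d) \<cdot> \<AA> (a \<otimes> b) c d"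
  using assms by (intro arrow_eqI[of M]) (simp_all add: pentagon)

lemma atriangle:
  assumes "a \<in> Obj M" "b \<in> Obj M"
  shows "(\<II> a \<star> \<LL> b) \<cdot> \<AA> a \<one> b = \<RR> a \<star> \<II> b"
  using assms by (intro arrow_eqI[of M]) (simp_all add: triangle)

end

section \<open>Coherence\<close>

context monoidal_category
begin

lemmas interchange_simps = ainterchange acomp_extend[OF ainterchange] acomp_assoc

text \<open>\<open>atens_id\<close> merges \<open>\<II> a \<star> \<II> b\<close> into
  \<open>\<II> (a \<otimes> b)\<close>, and then the general naturality law no longer matches. This
  and the next lemma are naturality in merged form.\<close>

lemma assoc_nat_right:
  assumes "a \<in> Obj M" "b \<in> Obj M" "arr M h" "Cod h = c"
  shows "\<AA> a b c \<cdot> (\<II> (a \<otimes> b) \<star> h) = (\<II> a \<star> \<II> b \<star> h) \<cdot> \<AA> a b (Dom h)"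
  using assoc_nat[of "\<II> a" "\<II> b" h a b c] assms by simp

lemma assoc_inv_nat_left:
  assumes "arr M f" "b \<in> Obj M" "c \<in> Obj M" "Cod f = a"
  shows "\<AA>\<^sup>- a b c \<cdot> (f \<star> \<II> (b \<otimes> c)) = ((f \<star> \<II> b) \<star> \<II> c) \<cdot> \<AA>\<^sup>- (Dom f) b c"
  using assoc_inv_nat[of f "\<II> b" "\<II> c" a b c] assms by simp

text \<open>The pentagon with two edges inverted, in the arrangement that arises when a pair is
  inserted on the left and the next pair is contracted.\<close>

lemma pentagon_inv_left:
  assumes "a \<in> Obj M" "b \<in> Obj M" "c \<in> Obj M" "d \<in> Obj M"
  shows "(\<II> a \<star> \<AA>\<^sup>- b c d) \<cdot> \<AA> a b (c \<otimes> d)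
    = \<AA> a (b \<otimes> c) d \<cdot> (\<AA> a b c \<star> \<II> d) \<cdot> \<AA>\<^sup>- (a \<otimes> b) c d"
proof -
  have "(\<II> a \<star> \<AA>\<^sup>- b c d) \<cdot> \<AA> a b (c \<otimes> d)
      = (\<II> a \<star> \<AA>\<^sup>- b c d) \<cdot> (\<AA> a b (c \<otimes> d) \<cdot> \<AA> (a \<otimes> b) c d) \<cdot> \<AA>\<^sup>- (a \<otimes> b) c d"
    using assms by (simp add: acomp_assoc)
  also have "\<dots> = \<AA> a (b \<otimes> c) d \<cdot> (\<AA> a b c \<star> \<II> d) \<cdot> \<AA>\<^sup>- (a \<otimes> b) c d"
    unfolding apentagon[OF assms, symmetric]
    using assms by (simp add: acomp_assoc acomp_extend[OF ainterchange])
  finally show ?thesis .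
qed

lemma pentagon_inv_right:
  assumes "a \<in> Obj M" "b \<in> Obj M" "c \<in> Obj M" "d \<in> Obj M"
  shows "(\<AA> a b c \<star> \<II> d) \<cdot> \<AA>\<^sup>- (a \<otimes> b) c d
    = \<AA>\<^sup>- a (b \<otimes> c) d \<cdot> (\<II> a \<star> \<AA>\<^sup>- b c d) \<cdot> \<AA> a b (c \<otimes> d)"
  unfolding pentagon_inv_left[OF assms] using assms
  by (simp add: acomp_extend[OF assoc_inv_left])

text \<open>Tensoring with the unit is faithful, because naturality of the left unitor recovers
  \<open>f\<close> from \<open>\<II> \<one> \<star> f\<close>. Unit laws beyond the axioms are
  proved after such a tensoring, where the triangle becomes available.\<close>

lemma unit_whisker_cancel:
  assumes "\<II> \<one> \<star> f = \<II> \<one> \<star> g" "arr M f" "arr M g" "Dom f = Dom g" "Cod f = Cod g"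
  shows "f = g"
proof (rule cancel_right_inverse[OF _ lunit_inv_right])
  show "f \<cdot> \<LL> (Dom f) = g \<cdot> \<LL> (Dom f)"
    using assms by (metis lunit_nat)
qed (use assms in auto)

lemma whisker_unit_cancel:
  assumes "f \<star> \<II> \<one> = g \<star> \<II> \<one>" "arr M f" "arr M g" "Dom f = Dom g" "Cod f = Cod g"
  shows "f = g"
proof (rule cancel_right_inverse[OF _ runit_inv_right])
  show "f \<cdot> \<RR> (Dom f) = g \<cdot> \<RR> (Dom f)"
    using assms by (metis runit_nat)
qed (use assms in auto)

lemma assoc_whisker_inv [simp]:
  assumes "a \<in> Obj M" "b \<in> Obj M" "c \<in> Obj M" "d \<in> Obj M"
  shows "(\<AA> a b c \<star> \<II> d) \<cdot> (\<AA>\<^sup>- a b c \<star> \<II> d) = \<II> ((a \<otimes> b \<otimes> c) \<otimes> d)"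
    and "(\<AA>\<^sup>- a b c \<star> \<II> d) \<cdot> (\<AA> a b c \<star> \<II> d) = \<II> (((a \<otimes> b) \<otimes> c) \<otimes> d)"
    and "(\<II> d \<star> \<AA> a b c) \<cdot> (\<II> d \<star> \<AA>\<^sup>- a b c) = \<II> (d \<otimes> a \<otimes> b \<otimes> c)"
    and "(\<II> d \<star> \<AA>\<^sup>- a b c) \<cdot> (\<II> d \<star> \<AA> a b c) = \<II> (d \<otimes> (a \<otimes> b) \<otimes> c)"
  using assms by (simp_all add: ainterchange)

text \<open>The triangle axiom has the unit in the middle. The version with the unit in front comes
  from the pentagon for \<open>\<one>, \<one>, a, b\<close>, in which two triangles
  collapse.\<close>

lemma lunit_tensor:
  assumes [simp]: "a \<in> Obj M" "b \<in> Obj M"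
  shows "\<LL> (a \<otimes> b) \<cdot> \<AA> \<one> a b = \<LL> a \<star> \<II> b"
proof (rule unit_whisker_cancel)
  \<comment> \<open>The pentagon edges that precede
    \<open>\<II> \<one> \<star> \<AA> \<one> a b\<close>. They are invertible, so the two sides may
    be compared after composing with them.\<close>
  define k where "k = \<AA> \<one> (\<one> \<otimes> a) b \<cdot> (\<AA> \<one> \<one> a \<star> \<II> b)"
  define k' where "k' = (\<AA>\<^sup>- \<one> \<one> a \<star> \<II> b) \<cdot> \<AA>\<^sup>- \<one> (\<one> \<otimes> a) b"
  have k: "k \<cdot> k' = \<II> (\<one> \<otimes> (\<one> \<otimes> a) \<otimes> b)"
    by (simp add: k_def k'_def acomp_assoc acomp_extend[OF assoc_whisker_inv(1)])
  have "(\<II> \<one> \<star> (\<LL> (a \<otimes> b) \<cdot> \<AA> \<one> a b)) \<cdot> k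
      = (\<II> \<one> \<star> \<LL> (a \<otimes> b)) \<cdot> (\<II> \<one> \<star> \<AA> \<one> a b) \<cdot> \<AA> \<one> (\<one> \<otimes> a) b \<cdot> (\<AA> \<one> \<one> a \<star> \<II> b)"
    by (simp add: k_def lwhisker_comp acomp_assoc)
  also have "\<dots> = (\<RR> \<one> \<star> \<II> (a \<otimes> b)) \<cdot> \<AA> (\<one> \<otimes> \<one>) a b"
    by (simp add: apentagon acomp_extend[OF atriangle])
  also have "\<dots> = \<AA> \<one> a b \<cdot> ((\<RR> \<one> \<star> \<II> a) \<star> \<II> b)"
    by (simp add: assoc_nat)
  also have "\<dots> = \<AA> \<one> a b \<cdot> ((\<II> \<one> \<star> \<LL> a) \<star> \<II> b) \<cdot> (\<AA> \<one> \<one> a \<star> \<II> b)"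
    by (simp add: ainterchange atriangle)
  also have "\<dots> = (\<II> \<one> \<star> \<LL> a \<star> \<II> b) \<cdot> k"
    by (simp add: k_def acomp_extend[OF assoc_nat] acomp_assoc)
  finally show "\<II> \<one> \<star> (\<LL> (a \<otimes> b) \<cdot> \<AA> \<one> a b) = \<II> \<one> \<star> (\<LL> a \<star> \<II> b)"
    by (rule cancel_right_inverse[OF _ k]) (simp_all add: k_def)
qed simp_all

text \<open>The mirror image: the pentagon for \<open>a, b, \<one>, \<one>\<close>, after tensoring
  with the unit on the right.\<close>

lemma runit_tensor:
  assumes [simp]: "a \<in> Obj M" "b \<in> Obj M"
  shows "(\<II> a \<star> \<RR> b) \<cdot> \<AA> a b \<one> = \<RR> (a \<otimes> b)"
proof (rule whisker_unit_cancel, rule cancel_left_inverse[OF _ assoc_inv_left])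
  show "\<AA> a b \<one> \<cdot> (((\<II> a \<star> \<RR> b) \<cdot> \<AA> a b \<one>) \<star> \<II> \<one>) = \<AA> a b \<one> \<cdot> (\<RR> (a \<otimes> b) \<star> \<II> \<one>)"
  proof -
    have "\<AA> a b \<one> \<cdot> (((\<II> a \<star> \<RR> b) \<cdot> \<AA> a b \<one>) \<star> \<II> \<one>)
        = \<AA> a b \<one> \<cdot> ((\<II> a \<star> \<RR> b) \<star> \<II> \<one>) \<cdot> (\<AA> a b \<one> \<star> \<II> \<one>)"
      by (simp add: rwhisker_comp)
    also have "\<dots> = (\<II> a \<star> \<RR> b \<star> \<II> \<one>) \<cdot> \<AA> a (b \<otimes> \<one>) \<one> \<cdot> (\<AA> a b \<one> \<star> \<II> \<one>)"
      by (simp add: acomp_extend[OF assoc_nat] acomp_assoc)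
    also have "\<dots> = (\<II> a \<star> \<II> b \<star> \<LL> \<one>) \<cdot> (\<II> a \<star> \<AA> b \<one> \<one>) \<cdot> \<AA> a (b \<otimes> \<one>) \<one> \<cdot> (\<AA> a b \<one> \<star> \<II> \<one>)"
      by (simp add: atriangle[symmetric] lwhisker_comp acomp_assoc)
    also have "\<dots> = \<AA> a b \<one> \<cdot> (\<II> (a \<otimes> b) \<star> \<LL> \<one>) \<cdot> \<AA> (a \<otimes> b) \<one> \<one>"
      by (simp add: apentagon acomp_extend[OF assoc_nat_right] acomp_assoc)
    also have "\<dots> = \<AA> a b \<one> \<cdot> (\<RR> (a \<otimes> b) \<star> \<II> \<one>)"
      by (simp add: atriangle)
    finally show ?thesis .
  qed
qed simp_all

lemma lunit_inv_tensor:
  assumes [simp]: "a \<in> Obj M" "b \<in> Obj M"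
  shows "\<AA>\<^sup>- \<one> a b \<cdot> \<LL>\<^sup>- (a \<otimes> b) = \<LL>\<^sup>- a \<star> \<II> b"
proof (rule cancel_left_inverse)
  have "(\<LL> a \<star> \<II> b) \<cdot> \<AA>\<^sup>- \<one> a b \<cdot> \<LL>\<^sup>- (a \<otimes> b) = \<II> (a \<otimes> b)"
    by (simp add: lunit_tensor[symmetric] acomp_assoc acomp_extend[OF assoc_inv_right])
  also have "\<dots> = (\<LL> a \<star> \<II> b) \<cdot> (\<LL>\<^sup>- a \<star> \<II> b)"
    by (simp add: ainterchange)
  finally show "(\<LL> a \<star> \<II> b) \<cdot> \<AA>\<^sup>- \<one> a b \<cdot> \<LL>\<^sup>- (a \<otimes> b) = (\<LL> a \<star> \<II> b) \<cdot> (\<LL>\<^sup>- a \<star> \<II> b)" .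
  show "(\<LL>\<^sup>- a \<star> \<II> b) \<cdot> (\<LL> a \<star> \<II> b) = \<II> ((\<one> \<otimes> a) \<otimes> b)"
    by (simp add: ainterchange)
qed simp_all

lemma runit_inv_tensor:
  assumes [simp]: "a \<in> Obj M" "b \<in> Obj M"
  shows "\<AA> a b \<one> \<cdot> \<RR>\<^sup>- (a \<otimes> b) = \<II> a \<star> \<RR>\<^sup>- b"
proof (rule cancel_left_inverse)
  have "(\<II> a \<star> \<RR> b) \<cdot> \<AA> a b \<one> \<cdot> \<RR>\<^sup>- (a \<otimes> b) = \<II> (a \<otimes> b)"
    by (simp add: acomp_extend[OF runit_tensor])
  also have "\<dots> = (\<II> a \<star> \<RR> b) \<cdot> (\<II> a \<star> \<RR>\<^sup>- b)"
    by (simp add: ainterchange)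
  finally show "(\<II> a \<star> \<RR> b) \<cdot> \<AA> a b \<one> \<cdot> \<RR>\<^sup>- (a \<otimes> b) = (\<II> a \<star> \<RR> b) \<cdot> (\<II> a \<star> \<RR>\<^sup>- b)" .
  show "(\<II> a \<star> \<RR>\<^sup>- b) \<cdot> (\<II> a \<star> \<RR> b) = \<II> (a \<otimes> b \<otimes> \<one>)"
    by (simp add: ainterchange)
qed simp_all

lemma triangle_inv:
  assumes [simp]: "a \<in> Obj M" "b \<in> Obj M"
  shows "(\<RR> a \<star> \<II> b) \<cdot> \<AA>\<^sup>- a \<one> b = \<II> a \<star> \<LL> b"
  by (simp add: atriangle[symmetric] acomp_assoc)

lemma triangle_unit_inv:
  assumes [simp]: "a \<in> Obj M" "b \<in> Obj M"
  shows "\<AA> a \<one> b \<cdot> (\<RR>\<^sup>- a \<star> \<II> b) = \<II> a \<star> \<LL>\<^sup>- b"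
proof (rule cancel_left_inverse)
  have "(\<II> a \<star> \<LL> b) \<cdot> \<AA> a \<one> b \<cdot> (\<RR>\<^sup>- a \<star> \<II> b) = \<II> (a \<otimes> b)"
    by (simp add: acomp_extend[OF atriangle] ainterchange)
  also have "\<dots> = (\<II> a \<star> \<LL> b) \<cdot> (\<II> a \<star> \<LL>\<^sup>- b)"
    by (simp add: ainterchange)
  finally show "(\<II> a \<star> \<LL> b) \<cdot> \<AA> a \<one> b \<cdot> (\<RR>\<^sup>- a \<star> \<II> b) = (\<II> a \<star> \<LL> b) \<cdot> (\<II> a \<star> \<LL>\<^sup>- b)" .
  show "(\<II> a \<star> \<LL>\<^sup>- b) \<cdot> (\<II> a \<star> \<LL> b) = \<II> (a \<otimes> \<one> \<otimes> b)"
    by (simp add: ainterchange)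
qed simp_all

end

section \<open>Contracting and inserting adjacent objects\<close>

text \<open>The left-hand operations are bracketed to the right and the right-hand ones to the left.
  The object \<open>d\<close> that is kept is then always innermost, and a morphism on it acts by
  whiskering twice, without associators.\<close>

definition lcontract ::
  "('o, 'm, 'z) moncat_scheme \<Rightarrow> ('o, 'm) arrow \<Rightarrow> 'o \<Rightarrow> 'o \<Rightarrow> 'o \<Rightarrow> ('o, 'm) arrow" where
  "lcontract M h a b d = \<LL>\<^bsub>M\<^esub> d \<cdot>\<^bsub>M\<^esub> (h \<star>\<^bsub>M\<^esub> \<II>\<^bsub>M\<^esub> d) \<cdot>\<^bsub>M\<^esub> \<AA>\<^sup>-\<^bsub>M\<^esub> a b d"

definition rcontract ::
  "('o, 'm, 'z) moncat_scheme \<Rightarrow> ('o, 'm) arrow \<Rightarrow> 'o \<Rightarrow> 'o \<Rightarrow> 'o \<Rightarrow> ('o, 'm) arrow" where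
  "rcontract M h d a b = \<RR>\<^bsub>M\<^esub> d \<cdot>\<^bsub>M\<^esub> (\<II>\<^bsub>M\<^esub> d \<star>\<^bsub>M\<^esub> h) \<cdot>\<^bsub>M\<^esub> \<AA>\<^bsub>M\<^esub> d a b"

definition linsert ::
  "('o, 'm, 'z) moncat_scheme \<Rightarrow> ('o, 'm) arrow \<Rightarrow> 'o \<Rightarrow> 'o \<Rightarrow> 'o \<Rightarrow> ('o, 'm) arrow" where
  "linsert M k a b d = \<AA>\<^bsub>M\<^esub> a b d \<cdot>\<^bsub>M\<^esub> (k \<star>\<^bsub>M\<^esub> \<II>\<^bsub>M\<^esub> d) \<cdot>\<^bsub>M\<^esub> \<LL>\<^sup>-\<^bsub>M\<^esub> d"

definition rinsert ::
  "('o, 'm, 'z) moncat_scheme \<Rightarrow> ('o, 'm) arrow \<Rightarrow> 'o \<Rightarrow> 'o \<Rightarrow> 'o \<Rightarrow> ('o, 'm) arrow" where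
  "rinsert M k d a b = \<AA>\<^sup>-\<^bsub>M\<^esub> d a b \<cdot>\<^bsub>M\<^esub> (\<II>\<^bsub>M\<^esub> d \<star>\<^bsub>M\<^esub> k) \<cdot>\<^bsub>M\<^esub> \<RR>\<^sup>-\<^bsub>M\<^esub> d"

context monoidal_category
begin

lemma arr_lcontract:
  assumes "arr M h" "Dom h = a \<otimes> b" "Cod h = \<one>" "a \<in> Obj M" "b \<in> Obj M" "d \<in> Obj M"
  shows "arr M (lcontract M h a b d)" "Dom (lcontract M h a b d) = a \<otimes> b \<otimes> d"
    "Cod (lcontract M h a b d) = d"
  using assms by (simp_all add: lcontract_def)

lemma arr_rcontract:
  assumes "arr M h" "Dom h = a \<otimes> b" "Cod h = \<one>" "a \<in> Obj M" "b \<in> Obj M" "d \<in> Obj M"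
  shows "arr M (rcontract M h d a b)" "Dom (rcontract M h d a b) = (d \<otimes> a) \<otimes> b"
    "Cod (rcontract M h d a b) = d"
  using assms by (simp_all add: rcontract_def)

lemma arr_linsert:
  assumes "arr M k" "Cod k = a \<otimes> b" "Dom k = \<one>" "a \<in> Obj M" "b \<in> Obj M" "d \<in> Obj M"
  shows "arr M (linsert M k a b d)" "Cod (linsert M k a b d) = a \<otimes> b \<otimes> d"
    "Dom (linsert M k a b d) = d"
  using assms by (simp_all add: linsert_def)

lemma arr_rinsert:
  assumes "arr M k" "Cod k = a \<otimes> b" "Dom k = \<one>" "a \<in> Obj M" "b \<in> Obj M" "d \<in> Obj M"
  shows "arr M (rinsert M k d a b)" "Cod (rinsert M k d a b) = (d \<otimes> a) \<otimes> b"
    "Dom (rinsert M k d a b) = d"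
  using assms by (simp_all add: rinsert_def)

lemma lcontract_nat:
  assumes "arr M h" "Dom h = a \<otimes> b" "Cod h = \<one>" "a \<in> Obj M" "b \<in> Obj M" "arr M f" "Cod f = d"
  shows "lcontract M h a b d \<cdot> (\<II> a \<star> \<II> b \<star> f) = f \<cdot> lcontract M h a b (Dom f)"
proof -
  have d: "d \<in> Obj M"
    using assms by auto
  have "lcontract M h a b d \<cdot> (\<II> a \<star> \<II> b \<star> f)
      = \<LL> d \<cdot> (h \<star> \<II> d) \<cdot> (\<II> (a \<otimes> b) \<star> f) \<cdot> \<AA>\<^sup>- a b (Dom f)"
    using assms d by (simp add: lcontract_def acomp_assoc assoc_inv_nat)
  also have "\<dots> = \<LL> d \<cdot> (\<II> \<one> \<star> f) \<cdot> (h \<star> \<II> (Dom f)) \<cdot> \<AA>\<^sup>- a b (Dom f)"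
    using assms d by (simp add: interchange_simps)
  also have "\<dots> = f \<cdot> lcontract M h a b (Dom f)"
    using assms d by (simp add: lcontract_def acomp_extend[OF lunit_nat] acomp_assoc)
  finally show ?thesis .
qed

lemma linsert_nat:
  assumes "arr M k" "Cod k = a \<otimes> b" "Dom k = \<one>" "a \<in> Obj M" "b \<in> Obj M" "arr M f" "Cod f = d"
  shows "linsert M k a b d \<cdot> f = (\<II> a \<star> \<II> b \<star> f) \<cdot> linsert M k a b (Dom f)"
proof -
  have d: "d \<in> Obj M"
    using assms by auto
  have "linsert M k a b d \<cdot> f = \<AA> a b d \<cdot> (k \<star> \<II> d) \<cdot> (\<II> \<one> \<star> f) \<cdot> \<LL>\<^sup>- (Dom f)"
    using assms d lunit_inv_nat[of f "Dom f"] by (simp add: linsert_def acomp_assoc)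
  also have "\<dots> = \<AA> a b d \<cdot> (\<II> (a \<otimes> b) \<star> f) \<cdot> (k \<star> \<II> (Dom f)) \<cdot> \<LL>\<^sup>- (Dom f)"
    using assms d by (simp add: interchange_simps)
  also have "\<dots> = (\<II> a \<star> \<II> b \<star> f) \<cdot> linsert M k a b (Dom f)"
    using assms d by (simp add: linsert_def acomp_extend[OF assoc_nat_right] acomp_assoc)
  finally show ?thesis .
qed

lemma rcontract_nat:
  assumes "arr M h" "Dom h = a \<otimes> b" "Cod h = \<one>" "a \<in> Obj M" "b \<in> Obj M" "arr M f" "Cod f = d"
  shows "rcontract M h d a b \<cdot> ((f \<star> \<II> a) \<star> \<II> b) = f \<cdot> rcontract M h (Dom f) a b"
proof -
  have d: "d \<in> Obj M"
    using assms by auto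
  have "rcontract M h d a b \<cdot> ((f \<star> \<II> a) \<star> \<II> b)
      = \<RR> d \<cdot> (\<II> d \<star> h) \<cdot> (f \<star> \<II> (a \<otimes> b)) \<cdot> \<AA> (Dom f) a b"
    using assms d by (simp add: rcontract_def acomp_assoc assoc_nat)
  also have "\<dots> = \<RR> d \<cdot> (f \<star> \<II> \<one>) \<cdot> (\<II> (Dom f) \<star> h) \<cdot> \<AA> (Dom f) a b"
    using assms d by (simp add: interchange_simps)
  also have "\<dots> = f \<cdot> rcontract M h (Dom f) a b"
    using assms d by (simp add: rcontract_def acomp_extend[OF runit_nat] acomp_assoc)
  finally show ?thesis .
qed

lemma rinsert_nat:
  assumes "arr M k" "Cod k = a \<otimes> b" "Dom k = \<one>" "a \<in> Obj M" "b \<in> Obj M" "arr M f" "Cod f = d"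
  shows "rinsert M k d a b \<cdot> f = ((f \<star> \<II> a) \<star> \<II> b) \<cdot> rinsert M k (Dom f) a b"
proof -
  have d: "d \<in> Obj M"
    using assms by auto
  have "rinsert M k d a b \<cdot> f = \<AA>\<^sup>- d a b \<cdot> (\<II> d \<star> k) \<cdot> (f \<star> \<II> \<one>) \<cdot> \<RR>\<^sup>- (Dom f)"
    using assms d runit_inv_nat[of f "Dom f"] by (simp add: rinsert_def acomp_assoc)
  also have "\<dots> = \<AA>\<^sup>- d a b \<cdot> (f \<star> \<II> (a \<otimes> b)) \<cdot> (\<II> (Dom f) \<star> k) \<cdot> \<RR>\<^sup>- (Dom f)"
    using assms d by (simp add: interchange_simps)
  also have "\<dots> = ((f \<star> \<II> a) \<star> \<II> b) \<cdot> rinsert M k (Dom f) a b"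
    using assms d by (simp add: rinsert_def acomp_extend[OF assoc_inv_nat_left] acomp_assoc)
  finally show ?thesis .
qed

text \<open>A contraction at the right end does not see an object \<open>a\<close> tensored on the
  left; up to associators this is the pentagon followed by \<open>runit_tensor\<close>. It carries
  the evaluation of \<open>y\<close> past \<open>y\<close> in the formula of the traciator and past
  \<open>w\<close> in the product formula.\<close>

lemma rcontract_tensor:
  assumes h: "arr M h" "Dom h = c \<otimes> d" "Cod h = \<one>"
    and [simp]: "a \<in> Obj M" "b \<in> Obj M" "c \<in> Obj M" "d \<in> Obj M"
  shows "rcontract M h (a \<otimes> b) c d \<cdot> (\<AA>\<^sup>- a b c \<star> \<II> d) = (\<II> a \<star> rcontract M h b c d) \<cdot> \<AA> a (b \<otimes> c) d"
proof (rule cancel_right_inverse[OF _ assoc_whisker_inv(1)])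
  note [simp] = h
  have "((\<II> a \<star> rcontract M h b c d) \<cdot> \<AA> a (b \<otimes> c) d) \<cdot> (\<AA> a b c \<star> \<II> d)
      = (\<II> a \<star> \<RR> b) \<cdot> (\<II> a \<star> \<II> b \<star> h) \<cdot> \<AA> a b (c \<otimes> d) \<cdot> \<AA> (a \<otimes> b) c d"
    by (simp add: rcontract_def lwhisker_comp acomp_assoc apentagon)
  also have "\<dots> = (\<II> a \<star> \<RR> b) \<cdot> \<AA> a b \<one> \<cdot> (\<II> (a \<otimes> b) \<star> h) \<cdot> \<AA> (a \<otimes> b) c d"
    by (simp add: acomp_extend[OF assoc_nat_right] acomp_assoc)
  also have "\<dots> = rcontract M h (a \<otimes> b) c d"
    by (simp add: acomp_extend[OF runit_tensor] rcontract_def)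
  finally show "(rcontract M h (a \<otimes> b) c d \<cdot> (\<AA>\<^sup>- a b c \<star> \<II> d)) \<cdot> (\<AA> a b c \<star> \<II> d)
      = ((\<II> a \<star> rcontract M h b c d) \<cdot> \<AA> a (b \<otimes> c) d) \<cdot> (\<AA> a b c \<star> \<II> d)"
    by (simp add: acomp_assoc arr_rcontract)
qed (use h in \<open>simp_all add: arr_rcontract\<close>)

text \<open>Moving the associators outwards with \<open>pentagon_inv_left\<close> leaves the zig-zag
  of \<open>a\<close> tensored with \<open>\<II> d\<close>. Pairing and copairing are arbitrary in
  this and the next two lemmas, so that they serve the given duality as well as the one built from
  the pivotal structure.\<close>

lemma lcontract_linsert:
  assumes h: "arr M h" "Dom h = b \<otimes> a" "Cod h = \<one>"
    and k: "arr M k" "Dom k = \<one>" "Cod k = a \<otimes> b"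
    and zigzag: "\<RR> a \<cdot> (\<II> a \<star> h) \<cdot> \<AA> a b a \<cdot> (k \<star> \<II> a) \<cdot> \<LL>\<^sup>- a = \<II> a"
    and [simp]: "a \<in> Obj M" "b \<in> Obj M" "d \<in> Obj M"
  shows "(\<II> a \<star> lcontract M h b a d) \<cdot> linsert M k a b (a \<otimes> d) = \<II> (a \<otimes> d)"
proof -
  note [simp] = h k
  have "(\<II> a \<star> lcontract M h b a d) \<cdot> linsert M k a b (a \<otimes> d)
      = (\<II> a \<star> \<LL> d) \<cdot> (\<II> a \<star> h \<star> \<II> d) \<cdot> (\<II> a \<star> \<AA>\<^sup>- b a d) \<cdot> \<AA> a b (a \<otimes> d)
          \<cdot> (k \<star> \<II> (a \<otimes> d)) \<cdot> \<LL>\<^sup>- (a \<otimes> d)"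
    by (simp add: lcontract_def linsert_def lwhisker_comp acomp_assoc)
  also have "\<dots> = (\<II> a \<star> \<LL> d) \<cdot> (\<II> a \<star> h \<star> \<II> d) \<cdot> \<AA> a (b \<otimes> a) d \<cdot> (\<AA> a b a \<star> \<II> d)
          \<cdot> \<AA>\<^sup>- (a \<otimes> b) a d \<cdot> (k \<star> \<II> (a \<otimes> d)) \<cdot> \<LL>\<^sup>- (a \<otimes> d)"
    by (simp add: acomp_extend[OF pentagon_inv_left] acomp_assoc)
  also have "\<dots> = (\<II> a \<star> \<LL> d) \<cdot> (\<II> a \<star> h \<star> \<II> d) \<cdot> \<AA> a (b \<otimes> a) d \<cdot> (\<AA> a b a \<star> \<II> d)
          \<cdot> ((k \<star> \<II> a) \<star> \<II> d) \<cdot> (\<LL>\<^sup>- a \<star> \<II> d)"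
    by (simp add: acomp_extend[OF assoc_inv_nat_left] acomp_assoc lunit_inv_tensor)
  also have "\<dots> = (\<II> a \<star> \<LL> d) \<cdot> \<AA> a \<one> d \<cdot> ((\<II> a \<star> h) \<star> \<II> d) \<cdot> (\<AA> a b a \<star> \<II> d)
          \<cdot> ((k \<star> \<II> a) \<star> \<II> d) \<cdot> (\<LL>\<^sup>- a \<star> \<II> d)"
    by (simp add: acomp_extend[OF assoc_nat] acomp_assoc)
  also have "\<dots> = (\<RR> a \<cdot> (\<II> a \<star> h) \<cdot> \<AA> a b a \<cdot> (k \<star> \<II> a) \<cdot> \<LL>\<^sup>- a) \<star> \<II> d"
    by (simp add: acomp_extend[OF atriangle] rwhisker_comp)
  finally show ?thesis
    by (simp add: zigzag)
qed

lemma rcontract_rinsert: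
  assumes h: "arr M h" "Dom h = b \<otimes> a" "Cod h = \<one>"
    and k: "arr M k" "Dom k = \<one>" "Cod k = a \<otimes> b"
    and zigzag: "\<LL> b \<cdot> (h \<star> \<II> b) \<cdot> \<AA>\<^sup>- b a b \<cdot> (\<II> b \<star> k) \<cdot> \<RR>\<^sup>- b = \<II> b"
    and [simp]: "a \<in> Obj M" "b \<in> Obj M" "d \<in> Obj M"
  shows "(rcontract M h d b a \<star> \<II> b) \<cdot> rinsert M k (d \<otimes> b) a b = \<II> (d \<otimes> b)"
proof -
  note [simp] = h k
  have "(rcontract M h d b a \<star> \<II> b) \<cdot> rinsert M k (d \<otimes> b) a b
      = (\<RR> d \<star> \<II> b) \<cdot> ((\<II> d \<star> h) \<star> \<II> b) \<cdot> (\<AA> d b a \<star> \<II> b) \<cdot> \<AA>\<^sup>- (d \<otimes> b) a b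
          \<cdot> (\<II> (d \<otimes> b) \<star> k) \<cdot> \<RR>\<^sup>- (d \<otimes> b)"
    by (simp add: rcontract_def rinsert_def rwhisker_comp acomp_assoc)
  also have "\<dots> = (\<RR> d \<star> \<II> b) \<cdot> ((\<II> d \<star> h) \<star> \<II> b) \<cdot> \<AA>\<^sup>- d (b \<otimes> a) b \<cdot> (\<II> d \<star> \<AA>\<^sup>- b a b)
          \<cdot> \<AA> d b (a \<otimes> b) \<cdot> (\<II> (d \<otimes> b) \<star> k) \<cdot> \<RR>\<^sup>- (d \<otimes> b)"
    by (simp add: acomp_extend[OF pentagon_inv_right] acomp_assoc)
  also have "\<dots> = (\<RR> d \<star> \<II> b) \<cdot> ((\<II> d \<star> h) \<star> \<II> b) \<cdot> \<AA>\<^sup>- d (b \<otimes> a) b \<cdot> (\<II> d \<star> \<AA>\<^sup>- b a b)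
          \<cdot> (\<II> d \<star> \<II> b \<star> k) \<cdot> (\<II> d \<star> \<RR>\<^sup>- b)"
    by (simp add: acomp_extend[OF assoc_nat_right] acomp_assoc runit_inv_tensor)
  also have "\<dots> = (\<RR> d \<star> \<II> b) \<cdot> \<AA>\<^sup>- d \<one> b \<cdot> (\<II> d \<star> h \<star> \<II> b) \<cdot> (\<II> d \<star> \<AA>\<^sup>- b a b)
          \<cdot> (\<II> d \<star> \<II> b \<star> k) \<cdot> (\<II> d \<star> \<RR>\<^sup>- b)"
    by (simp add: acomp_extend[OF assoc_inv_nat] acomp_assoc)
  also have "\<dots> = \<II> d \<star> (\<LL> b \<cdot> (h \<star> \<II> b) \<cdot> \<AA>\<^sup>- b a b \<cdot> (\<II> b \<star> k) \<cdot> \<RR>\<^sup>- b)"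
    by (simp add: acomp_extend[OF triangle_inv] lwhisker_comp)
  finally show ?thesis
    by (simp add: zigzag)
qed

text \<open>\<open>rcontract_rinsert\<close> will make right bending injective; the zig-zag at the
  other object of the pair, used here, will make it surjective.\<close>

lemma rinsert_rcontract:
  assumes h: "arr M h" "Dom h = b \<otimes> a" "Cod h = \<one>"
    and k: "arr M k" "Dom k = \<one>" "Cod k = a \<otimes> b"
    and zigzag: "\<RR> a \<cdot> (\<II> a \<star> h) \<cdot> \<AA> a b a \<cdot> (k \<star> \<II> a) \<cdot> \<LL>\<^sup>- a = \<II> a"
    and [simp]: "a \<in> Obj M" "b \<in> Obj M" "d \<in> Obj M"
  shows "rcontract M h (d \<otimes> a) b a \<cdot> (rinsert M k d a b \<star> \<II> a) = \<II> (d \<otimes> a)"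
proof -
  note [simp] = h k
  have "rcontract M h (d \<otimes> a) b a \<cdot> (rinsert M k d a b \<star> \<II> a)
      = rcontract M h (d \<otimes> a) b a \<cdot> (\<AA>\<^sup>- d a b \<star> \<II> a) \<cdot> ((\<II> d \<star> k) \<star> \<II> a) \<cdot> (\<RR>\<^sup>- d \<star> \<II> a)"
    by (simp add: rinsert_def rwhisker_comp)
  also have "\<dots> = (\<II> d \<star> rcontract M h a b a) \<cdot> \<AA> d (a \<otimes> b) a \<cdot> ((\<II> d \<star> k) \<star> \<II> a) \<cdot> (\<RR>\<^sup>- d \<star> \<II> a)"
    by (simp add: acomp_extend[OF rcontract_tensor] acomp_assoc)
  also have "\<dots> = (\<II> d \<star> rcontract M h a b a) \<cdot> (\<II> d \<star> k \<star> \<II> a) \<cdot> (\<II> d \<star> \<LL>\<^sup>- a)"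
    by (simp add: acomp_extend[OF assoc_nat] acomp_assoc triangle_unit_inv)
  also have "\<dots> = \<II> d \<star> (\<RR> a \<cdot> (\<II> a \<star> h) \<cdot> \<AA> a b a \<cdot> (k \<star> \<II> a) \<cdot> \<LL>\<^sup>- a)"
    by (simp add: rcontract_def lwhisker_comp acomp_assoc)
  finally show ?thesis
    by (simp add: zigzag)
qed

end

section \<open>Half-braidings\<close>

definition half_braided :: "('o, 'm, 'z) moncat_scheme \<Rightarrow> 'o \<times> ('o \<Rightarrow> 'm) \<Rightarrow> bool" where
  "half_braided M X \<longleftrightarrow> fst X \<in> Obj M \<and> is_half_braiding M (fst X) (snd X)"

definition braid ::
  "('o, 'm, 'z) moncat_scheme \<Rightarrow> 'o \<times> ('o \<Rightarrow> 'm) \<Rightarrow> 'o \<Rightarrow> ('o, 'm) arrow" where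
  "braid M X b = Arrow (fst X \<otimes>\<^bsub>M\<^esub> b) (snd X b) (b \<otimes>\<^bsub>M\<^esub> fst X)"

definition braid_inv ::
  "('o, 'm, 'z) moncat_scheme \<Rightarrow> 'o \<times> ('o \<Rightarrow> 'm) \<Rightarrow> 'o \<Rightarrow> ('o, 'm) arrow" where
  "braid_inv M X b =
    Arrow (b \<otimes>\<^bsub>M\<^esub> fst X) (inv_arr M (fst X \<otimes>\<^bsub>M\<^esub> b) (b \<otimes>\<^bsub>M\<^esub> fst X) (snd X b)) (fst X \<otimes>\<^bsub>M\<^esub> b)"

text \<open>A pass beyond \<open>b\<close> with a bystander \<open>d\<close> to its right. With the
  associators absorbed, passes beyond neighbouring objects compose directly, and the hexagon keeps a
  single associator on each side (\<open>braid_past_tensor\<close>).\<close>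

definition braid_past ::
  "('o, 'm, 'z) moncat_scheme \<Rightarrow> 'o \<times> ('o \<Rightarrow> 'm) \<Rightarrow> 'o \<Rightarrow> 'o \<Rightarrow> ('o, 'm) arrow" where
  "braid_past M X b d =
    \<AA>\<^bsub>M\<^esub> b (fst X) d \<cdot>\<^bsub>M\<^esub> (braid M X b \<star>\<^bsub>M\<^esub> \<II>\<^bsub>M\<^esub> d) \<cdot>\<^bsub>M\<^esub> \<AA>\<^sup>-\<^bsub>M\<^esub> (fst X) b d"

lemma braid_simps [simp]:
  "Dom (braid M X b) = fst X \<otimes>\<^bsub>M\<^esub> b" "Cod (braid M X b) = b \<otimes>\<^bsub>M\<^esub> fst X"
  "Body (braid M X b) = snd X b"
  "Dom (braid_inv M X b) = b \<otimes>\<^bsub>M\<^esub> fst X" "Cod (braid_inv M X b) = fst X \<otimes>\<^bsub>M\<^esub> b"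
  by (simp_all add: braid_def braid_inv_def)

lemma half_braided_obj [simp]: "half_braided M X \<Longrightarrow> fst X \<in> Obj M"
  by (simp add: half_braided_def)

context monoidal_category
begin

lemma braid_iso:
  assumes "half_braided M X" "b \<in> Obj M"
  shows arr_braid [simp]: "arr M (braid M X b)" and arr_braid_inv [simp]: "arr M (braid_inv M X b)"
    and braid_inv_right [simp]: "braid M X b \<cdot> braid_inv M X b = \<II> (b \<otimes> fst X)"
    and braid_inv_left [simp]: "braid_inv M X b \<cdot> braid M X b = \<II> (fst X \<otimes> b)"
  using Iso_arrow[of "snd X b" "fst X \<otimes> b" "b \<otimes> fst X"] assms
  by (simp_all add: braid_def braid_inv_def half_braided_def is_half_braiding_def)

lemma arr_braid_past:
  assumes "half_braided M X" "b \<in> Obj M" "d \<in> Obj M"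
  shows "arr M (braid_past M X b d)" "Dom (braid_past M X b d) = fst X \<otimes> b \<otimes> d"
    "Cod (braid_past M X b d) = b \<otimes> fst X \<otimes> d"
  using assms by (simp_all add: braid_past_def)

lemma braid_nat:
  assumes X: "half_braided M X" and f: "arr M f" "Cod f = c"
  shows "braid M X c \<cdot> (\<II> (fst X) \<star> f) = (f \<star> \<II> (fst X)) \<cdot> braid M X (Dom f)"
proof (rule arrow_eqI[of M])
  have "snd X c \<bullet> (\<iota> (fst X) \<odot> Body f) = (Body f \<odot> \<iota> (fst X)) \<bullet> snd X (Dom f)"
    using assms arr_Dom[OF f(1)] arr_Cod[OF f(1)] arr_Body[OF f(1)]
    by (simp add: half_braided_def is_half_braiding_def)
  then show "Body (braid M X c \<cdot> (\<II> (fst X) \<star> f)) = Body ((f \<star> \<II> (fst X)) \<cdot> braid M X (Dom f))"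
    using assms arr_Dom[OF f(1)] arr_Cod[OF f(1)] by simp
qed (use assms arr_Dom[OF f(1)] arr_Cod[OF f(1)] in auto)

lemma braid_tensor:
  assumes X: "half_braided M X" and "b \<in> Obj M" "c \<in> Obj M"
  shows "braid M X (b \<otimes> c) = \<AA>\<^sup>- b c (fst X) \<cdot> (\<II> b \<star> braid M X c) \<cdot> \<AA> b (fst X) c
      \<cdot> (braid M X b \<star> \<II> c) \<cdot> \<AA>\<^sup>- (fst X) b c"
proof (rule arrow_eqI[of M])
  have "snd X (b \<otimes> c) = \<alpha>\<^sup>- b c (fst X) \<bullet> (\<iota> b \<odot> snd X c) \<bullet> \<alpha> b (fst X) c
      \<bullet> (snd X b \<odot> \<iota> c) \<bullet> \<alpha>\<^sup>- (fst X) b c"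
    using assms by (simp add: half_braided_def is_half_braiding_def)
  then show "Body (braid M X (b \<otimes> c)) = Body (\<AA>\<^sup>- b c (fst X) \<cdot> (\<II> b \<star> braid M X c) \<cdot> \<AA> b (fst X) c
      \<cdot> (braid M X b \<star> \<II> c) \<cdot> \<AA>\<^sup>- (fst X) b c)"
    using assms by simp
qed (use assms in simp_all)

lemma pentagon_inv:
  assumes "a \<in> Obj M" "b \<in> Obj M" "c \<in> Obj M" "d \<in> Obj M"
  shows "(\<AA>\<^sup>- a b c \<star> \<II> d) \<cdot> \<AA>\<^sup>- a (b \<otimes> c) d \<cdot> (\<II> a \<star> \<AA>\<^sup>- b c d)
    = \<AA>\<^sup>- (a \<otimes> b) c d \<cdot> \<AA>\<^sup>- a b (c \<otimes> d)"
proof -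
  have "(\<AA>\<^sup>- a b c \<star> \<II> d) \<cdot> \<AA>\<^sup>- a (b \<otimes> c) d \<cdot> (\<II> a \<star> \<AA>\<^sup>- b c d)
      = (\<AA>\<^sup>- a b c \<star> \<II> d) \<cdot> (\<AA>\<^sup>- a (b \<otimes> c) d \<cdot> (\<II> a \<star> \<AA>\<^sup>- b c d) \<cdot> \<AA> a b (c \<otimes> d))
          \<cdot> \<AA>\<^sup>- a b (c \<otimes> d)"
    using assms by (simp add: acomp_assoc)
  also have "\<dots> = \<AA>\<^sup>- (a \<otimes> b) c d \<cdot> \<AA>\<^sup>- a b (c \<otimes> d)"
    unfolding pentagon_inv_right[OF assms, symmetric]
    using assms by (simp add: acomp_assoc acomp_extend[OF assoc_whisker_inv(2)])
  finally show ?thesis .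
qed

lemma pentagon_inv_mid:
  assumes "a \<in> Obj M" "b \<in> Obj M" "c \<in> Obj M" "d \<in> Obj M"
  shows "\<AA> (a \<otimes> b) c d \<cdot> (\<AA>\<^sup>- a b c \<star> \<II> d) \<cdot> \<AA>\<^sup>- a (b \<otimes> c) d
    = \<AA>\<^sup>- a b (c \<otimes> d) \<cdot> (\<II> a \<star> \<AA> b c d)"
proof -
  have "\<AA>\<^sup>- a b (c \<otimes> d) \<cdot> (\<II> a \<star> \<AA> b c d)
      = \<AA>\<^sup>- a b (c \<otimes> d) \<cdot> ((\<II> a \<star> \<AA> b c d) \<cdot> \<AA> a (b \<otimes> c) d \<cdot> (\<AA> a b c \<star> \<II> d))
          \<cdot> (\<AA>\<^sup>- a b c \<star> \<II> d) \<cdot> \<AA>\<^sup>- a (b \<otimes> c) d"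
    using assms by (simp add: acomp_assoc acomp_extend[OF assoc_whisker_inv(1)])
  also have "\<dots> = \<AA> (a \<otimes> b) c d \<cdot> (\<AA>\<^sup>- a b c \<star> \<II> d) \<cdot> \<AA>\<^sup>- a (b \<otimes> c) d"
    unfolding apentagon[OF assms]
    using assms by (simp add: acomp_assoc acomp_extend[OF assoc_inv_left])
  finally show ?thesis by simp
qed

lemma braid_past_nat_right:
  assumes "half_braided M X" "b \<in> Obj M" "arr M f" "Cod f = d"
  shows "braid_past M X b d \<cdot> (\<II> (fst X) \<star> \<II> b \<star> f)
    = (\<II> b \<star> \<II> (fst X) \<star> f) \<cdot> braid_past M X b (Dom f)"
proof -
  have d: "d \<in> Obj M"
    using assms by auto
  have "braid_past M X b d \<cdot> (\<II> (fst X) \<star> \<II> b \<star> f)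
      = \<AA> b (fst X) d \<cdot> (braid M X b \<star> \<II> d) \<cdot> (\<II> (fst X \<otimes> b) \<star> f) \<cdot> \<AA>\<^sup>- (fst X) b (Dom f)"
    using assms d by (simp add: braid_past_def acomp_assoc assoc_inv_nat)
  also have "\<dots> = \<AA> b (fst X) d \<cdot> (\<II> (b \<otimes> fst X) \<star> f) \<cdot> (braid M X b \<star> \<II> (Dom f))
      \<cdot> \<AA>\<^sup>- (fst X) b (Dom f)"
    using assms d by (simp add: interchange_simps)
  also have "\<dots> = (\<II> b \<star> \<II> (fst X) \<star> f) \<cdot> braid_past M X b (Dom f)"
    using assms d by (simp add: braid_past_def acomp_extend[OF assoc_nat_right] acomp_assoc)
  finally show ?thesis .
qed

lemma braid_past_nat_left:
  assumes "half_braided M X" "d \<in> Obj M" "arr M f" "Cod f = b"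
  shows "braid_past M X b d \<cdot> (\<II> (fst X) \<star> f \<star> \<II> d)
    = (f \<star> \<II> (fst X \<otimes> d)) \<cdot> braid_past M X (Dom f) d"
proof -
  have b: "b \<in> Obj M"
    using assms by auto
  have "braid_past M X b d \<cdot> (\<II> (fst X) \<star> f \<star> \<II> d)
      = \<AA> b (fst X) d \<cdot> ((braid M X b \<cdot> (\<II> (fst X) \<star> f)) \<star> \<II> d) \<cdot> \<AA>\<^sup>- (fst X) (Dom f) d"
    using assms b by (simp add: braid_past_def acomp_assoc assoc_inv_nat rwhisker_comp)
  also have "\<dots> = \<AA> b (fst X) d \<cdot> ((f \<star> \<II> (fst X)) \<star> \<II> d) \<cdot> (braid M X (Dom f) \<star> \<II> d)
      \<cdot> \<AA>\<^sup>- (fst X) (Dom f) d"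
    using assms b by (simp add: braid_nat acomp_assoc rwhisker_comp)
  also have "\<dots> = (f \<star> \<II> (fst X \<otimes> d)) \<cdot> braid_past M X (Dom f) d"
    using assms b by (simp add: braid_past_def acomp_extend[OF assoc_nat] acomp_assoc)
  finally show ?thesis .
qed

text \<open>The hexagon tensored with the bystander \<open>d\<close>. Three arrangements of the
  pentagon collect its associators into the two single passes.\<close>

lemma braid_past_tensor:
  assumes X [simp]: "half_braided M X" and [simp]: "b \<in> Obj M" "c \<in> Obj M" "d \<in> Obj M"
  shows "\<AA>\<^sup>- b c (fst X \<otimes> d) \<cdot> (\<II> b \<star> braid_past M X c d) \<cdot> braid_past M X b (c \<otimes> d)
    = braid_past M X (b \<otimes> c) d \<cdot> (\<II> (fst X) \<star> \<AA>\<^sup>- b c d)"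
proof -
  let ?p = "fst X"
  have "braid_past M X (b \<otimes> c) d \<cdot> (\<II> ?p \<star> \<AA>\<^sup>- b c d)
      = \<AA> (b \<otimes> c) ?p d \<cdot> (\<AA>\<^sup>- b c ?p \<star> \<II> d) \<cdot> ((\<II> b \<star> braid M X c) \<star> \<II> d) \<cdot> (\<AA> b ?p c \<star> \<II> d)
          \<cdot> ((braid M X b \<star> \<II> c) \<star> \<II> d) \<cdot> \<AA>\<^sup>- (?p \<otimes> b) c d \<cdot> \<AA>\<^sup>- ?p b (c \<otimes> d)"
    by (simp add: braid_past_def braid_tensor rwhisker_comp acomp_assoc pentagon_inv)
  also have "\<dots> = \<AA> (b \<otimes> c) ?p d \<cdot> (\<AA>\<^sup>- b c ?p \<star> \<II> d) \<cdot> ((\<II> b \<star> braid M X c) \<star> \<II> d)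
          \<cdot> (\<AA> b ?p c \<star> \<II> d) \<cdot> \<AA>\<^sup>- (b \<otimes> ?p) c d \<cdot> (braid M X b \<star> \<II> (c \<otimes> d)) \<cdot> \<AA>\<^sup>- ?p b (c \<otimes> d)"
    by (simp add: acomp_extend[OF assoc_inv_nat_left] acomp_assoc)
  also have "\<dots> = \<AA> (b \<otimes> c) ?p d \<cdot> (\<AA>\<^sup>- b c ?p \<star> \<II> d) \<cdot> ((\<II> b \<star> braid M X c) \<star> \<II> d)
          \<cdot> \<AA>\<^sup>- b (?p \<otimes> c) d \<cdot> (\<II> b \<star> \<AA>\<^sup>- ?p c d) \<cdot> braid_past M X b (c \<otimes> d)"
    by (simp add: acomp_extend[OF pentagon_inv_right] acomp_assoc braid_past_def)
  also have "\<dots> = (\<AA> (b \<otimes> c) ?p d \<cdot> (\<AA>\<^sup>- b c ?p \<star> \<II> d) \<cdot> \<AA>\<^sup>- b (c \<otimes> ?p) d)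
          \<cdot> (\<II> b \<star> braid M X c \<star> \<II> d) \<cdot> (\<II> b \<star> \<AA>\<^sup>- ?p c d) \<cdot> braid_past M X b (c \<otimes> d)"
    by (simp add: acomp_extend[OF assoc_inv_nat] acomp_assoc)
  also have "\<dots> = \<AA>\<^sup>- b c (?p \<otimes> d) \<cdot> (\<II> b \<star> braid_past M X c d) \<cdot> braid_past M X b (c \<otimes> d)"
    by (simp add: pentagon_inv_mid acomp_assoc lwhisker_comp braid_past_def)
  finally show ?thesis by simp
qed

text \<open>
  Unitality is not an axiom of half-braidings: it follows by cancelling \<open>e\<^bsub>\<one>\<^esub>\<close> from the hexagon for
  \<open>\<one> \<otimes> \<one>\<close>, using naturality along \<open>\<rho>\<^bsub>\<one>\<^esub>\<close>.
\<close>

lemma braid_past_unit: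
  assumes X [simp]: "half_braided M X" and [simp]: "d \<in> Obj M"
  shows "\<LL> (fst X \<otimes> d) \<cdot> braid_past M X \<one> d = \<II> (fst X) \<star> \<LL> d"
proof -
  let ?p = "fst X" and ?b = "braid_past M X \<one>"
  note [simp] = arr_braid_past
  have "(\<II> \<one> \<star> \<LL> (?p \<otimes> d)) \<cdot> (\<II> \<one> \<star> ?b d) \<cdot> ?b (\<one> \<otimes> d)
      = (\<RR> \<one> \<star> \<II> (?p \<otimes> d)) \<cdot> \<AA>\<^sup>- \<one> \<one> (?p \<otimes> d) \<cdot> (\<II> \<one> \<star> ?b d) \<cdot> ?b (\<one> \<otimes> d)"
    by (simp add: acomp_extend[OF triangle_inv])
  also have "\<dots> = ?b d \<cdot> (\<II> ?p \<star> (\<RR> \<one> \<star> \<II> d)) \<cdot> (\<II> ?p \<star> \<AA>\<^sup>- \<one> \<one> d)"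
    by (simp add: braid_past_tensor acomp_extend[OF braid_past_nat_left] acomp_assoc)
  also have "\<dots> = ?b d \<cdot> (\<II> ?p \<star> \<II> \<one> \<star> \<LL> d)"
    by (simp add: ainterchange triangle_inv)
  also have "\<dots> = (\<II> \<one> \<star> \<II> ?p \<star> \<LL> d) \<cdot> ?b (\<one> \<otimes> d)"
    by (simp add: braid_past_nat_right)
  finally have *: "(\<II> \<one> \<star> (\<LL> (?p \<otimes> d) \<cdot> ?b d)) \<cdot> ?b (\<one> \<otimes> d)
      = (\<II> \<one> \<star> \<II> ?p \<star> \<LL> d) \<cdot> ?b (\<one> \<otimes> d)"
    by (simp add: lwhisker_comp acomp_assoc)
  have inv: "?b (\<one> \<otimes> d) \<cdot> \<AA> ?p \<one> (\<one> \<otimes> d) \<cdot> (braid_inv M X \<one> \<star> \<II> (\<one> \<otimes> d)) \<cdot> \<AA>\<^sup>- \<one> ?p (\<one> \<otimes> d)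
      = \<II> (\<one> \<otimes> ?p \<otimes> \<one> \<otimes> d)"
    by (simp add: braid_past_def acomp_assoc acomp_extend[OF assoc_inv_left] acomp_extend[OF ainterchange])
  have "\<II> \<one> \<star> (\<LL> (?p \<otimes> d) \<cdot> ?b d) = \<II> \<one> \<star> \<II> ?p \<star> \<LL> d"
    by (rule cancel_right_inverse[OF * inv]) simp_all
  then show ?thesis
    by (rule unit_whisker_cancel) simp_all
qed

text \<open>Naturality along \<open>h\<close> replaces the pass beyond \<open>a \<otimes> b\<close>
  by a pass beyond the unit, which \<open>braid_past_unit\<close> makes trivial. A contracted pair
  can therefore be pulled through \<open>fst X\<close> without any formula relating its braidings at
  \<open>a\<close> and at \<open>b\<close>.\<close>

lemma lcontract_braid_past:
  assumes X [simp]: "half_braided M X" and h [simp]: "arr M h" "Dom h = a \<otimes> b" "Cod h = \<one>"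
    and [simp]: "a \<in> Obj M" "b \<in> Obj M" "d \<in> Obj M"
  shows "lcontract M h a b (fst X \<otimes> d) \<cdot> (\<II> a \<star> braid_past M X b d) \<cdot> braid_past M X a (b \<otimes> d)
    = \<II> (fst X) \<star> lcontract M h a b d"
proof -
  let ?p = "fst X"
  note [simp] = arr_braid_past
  have "lcontract M h a b (?p \<otimes> d) \<cdot> (\<II> a \<star> braid_past M X b d) \<cdot> braid_past M X a (b \<otimes> d)
      = \<LL> (?p \<otimes> d) \<cdot> (h \<star> \<II> (?p \<otimes> d)) \<cdot> braid_past M X (a \<otimes> b) d \<cdot> (\<II> ?p \<star> \<AA>\<^sup>- a b d)"
    by (simp add: lcontract_def acomp_assoc braid_past_tensor)
  also have "\<dots> = \<LL> (?p \<otimes> d) \<cdot> (braid_past M X \<one> d \<cdot> (\<II> ?p \<star> h \<star> \<II> d)) \<cdot> (\<II> ?p \<star> \<AA>\<^sup>- a b d)"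
    by (simp add: braid_past_nat_left acomp_assoc)
  also have "\<dots> = \<II> ?p \<star> lcontract M h a b d"
    by (simp add: acomp_assoc acomp_extend[OF braid_past_unit] lcontract_def lwhisker_comp)
  finally show ?thesis .
qed

end

section \<open>Bending in a pivotal category\<close>

definition aev :: "('o, 'm, 'z) pivcat_scheme \<Rightarrow> 'o \<Rightarrow> ('o, 'm) arrow" where
  "aev M a = Arrow (Dual M a \<otimes>\<^bsub>M\<^esub> a) (Ev M a) \<one>\<^bsub>M\<^esub>"

definition acoev :: "('o, 'm, 'z) pivcat_scheme \<Rightarrow> 'o \<Rightarrow> ('o, 'm) arrow" where
  "acoev M a = Arrow \<one>\<^bsub>M\<^esub> (Coev M a) (a \<otimes>\<^bsub>M\<^esub> Dual M a)"

definition apiv :: "('o, 'm, 'z) pivcat_scheme \<Rightarrow> 'o \<Rightarrow> ('o, 'm) arrow" where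
  "apiv M a = Arrow a (Piv M a) (Dual M (Dual M a))"

definition apiv_inv :: "('o, 'm, 'z) pivcat_scheme \<Rightarrow> 'o \<Rightarrow> ('o, 'm) arrow" where
  "apiv_inv M a = Arrow (Dual M (Dual M a)) (inv_arr M a (Dual M (Dual M a)) (Piv M a)) a"

definition aev_tilde :: "('o, 'm, 'z) pivcat_scheme \<Rightarrow> 'o \<Rightarrow> ('o, 'm) arrow" where
  "aev_tilde M a = aev M (Dual M a) \<cdot>\<^bsub>M\<^esub> (apiv M a \<star>\<^bsub>M\<^esub> \<II>\<^bsub>M\<^esub> (Dual M a))"

text \<open>The partner of \<open>aev_tilde\<close>: together they exhibit \<open>a\<close> as a
  dual of \<open>Dual M a\<close>.\<close>

definition acoev_tilde :: "('o, 'm, 'z) pivcat_scheme \<Rightarrow> 'o \<Rightarrow> ('o, 'm) arrow" where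
  "acoev_tilde M a = (\<II>\<^bsub>M\<^esub> (Dual M a) \<star>\<^bsub>M\<^esub> apiv_inv M a) \<cdot>\<^bsub>M\<^esub> acoev M (Dual M a)"

lemma duality_arrow_simps [simp]:
  "Dom (aev M a) = Dual M a \<otimes>\<^bsub>M\<^esub> a" "Cod (aev M a) = \<one>\<^bsub>M\<^esub>" "Body (aev M a) = Ev M a"
  "Dom (acoev M a) = \<one>\<^bsub>M\<^esub>" "Cod (acoev M a) = a \<otimes>\<^bsub>M\<^esub> Dual M a" "Body (acoev M a) = Coev M a"
  "Dom (apiv M a) = a" "Cod (apiv M a) = Dual M (Dual M a)" "Body (apiv M a) = Piv M a"
  "Dom (apiv_inv M a) = Dual M (Dual M a)" "Cod (apiv_inv M a) = a"
  by (simp_all add: aev_def acoev_def apiv_def apiv_inv_def)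

definition left_bend ::
  "('o, 'm, 'z) pivcat_scheme \<Rightarrow> 'o \<times> ('o \<Rightarrow> 'm) \<Rightarrow> 'o \<Rightarrow> 'o \<Rightarrow> ('o, 'm) arrow \<Rightarrow> ('o, 'm) arrow" where
  "left_bend M X y x g =
    lcontract M (aev M y) (Dual M y) y x \<cdot>\<^bsub>M\<^esub> (\<II>\<^bsub>M\<^esub> (Dual M y) \<star>\<^bsub>M\<^esub> g) \<cdot>\<^bsub>M\<^esub> braid M X (Dual M y)"

definition right_bend ::
  "('o, 'm, 'z) pivcat_scheme \<Rightarrow> 'o \<Rightarrow> 'o \<Rightarrow> ('o, 'm) arrow \<Rightarrow> ('o, 'm) arrow" where
  "right_bend M x y f =
    rcontract M (aev_tilde M y) x y (Dual M y) \<cdot>\<^bsub>M\<^esub> (f \<star>\<^bsub>M\<^esub> \<II>\<^bsub>M\<^esub> (Dual M y))"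

text \<open>The composite of \<open>traciator_mate\<close> with an arbitrary
  \<open>f : fst X \<rightarrow> x \<otimes> y\<close> in place of the counit. This separates the
  calculation in the pivotal category from the functor and the adjunction.\<close>

definition swing ::
  "('o, 'm, 'z) pivcat_scheme \<Rightarrow> 'o \<times> ('o \<Rightarrow> 'm) \<Rightarrow> 'o \<Rightarrow> 'o \<Rightarrow> ('o, 'm) arrow \<Rightarrow> ('o, 'm) arrow" where
  "swing M X x y f =
    \<RR>\<^bsub>M\<^esub> (y \<otimes>\<^bsub>M\<^esub> x)
    \<cdot>\<^bsub>M\<^esub> (\<II>\<^bsub>M\<^esub> (y \<otimes>\<^bsub>M\<^esub> x) \<star>\<^bsub>M\<^esub> aev_tilde M y)
    \<cdot>\<^bsub>M\<^esub> \<AA>\<^bsub>M\<^esub> (y \<otimes>\<^bsub>M\<^esub> x) y (Dual M y)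
    \<cdot>\<^bsub>M\<^esub> (\<AA>\<^sup>-\<^bsub>M\<^esub> y x y \<star>\<^bsub>M\<^esub> \<II>\<^bsub>M\<^esub> (Dual M y))
    \<cdot>\<^bsub>M\<^esub> ((\<II>\<^bsub>M\<^esub> y \<star>\<^bsub>M\<^esub> f) \<star>\<^bsub>M\<^esub> \<II>\<^bsub>M\<^esub> (Dual M y))
    \<cdot>\<^bsub>M\<^esub> (braid M X y \<star>\<^bsub>M\<^esub> \<II>\<^bsub>M\<^esub> (Dual M y))
    \<cdot>\<^bsub>M\<^esub> \<AA>\<^sup>-\<^bsub>M\<^esub> (fst X) y (Dual M y)
    \<cdot>\<^bsub>M\<^esub> (\<II>\<^bsub>M\<^esub> (fst X) \<star>\<^bsub>M\<^esub> acoev M y)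
    \<cdot>\<^bsub>M\<^esub> \<RR>\<^sup>-\<^bsub>M\<^esub> (fst X)"

context pivotal_category
begin

declare dual_in_obj [simp]

lemma arr_duality [simp]:
  assumes "a \<in> Obj M"
  shows "arr M (aev M a)" "arr M (acoev M a)"
  using assms by (simp_all add: aev_def acoev_def arr_Arrow ev_in_hom coev_in_hom)

lemma piv_arrow:
  assumes "a \<in> Obj M"
  shows arr_piv [simp]: "arr M (apiv M a)" and arr_piv_inv [simp]: "arr M (apiv_inv M a)"
    and apiv_inv_right [simp]: "apiv M a \<cdot> apiv_inv M a = \<II> (Dual M (Dual M a))"
    and apiv_inv_left [simp]: "apiv_inv M a \<cdot> apiv M a = \<II> a"
  using Iso_arrow[OF piv_iso[OF assms]] assms
  by (simp_all add: apiv_def apiv_inv_def)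

lemma tilde_arrow [simp]:
  assumes "a \<in> Obj M"
  shows "arr M (aev_tilde M a)" "Dom (aev_tilde M a) = a \<otimes> Dual M a" "Cod (aev_tilde M a) = \<one>"
    "Body (aev_tilde M a) = ev_tilde M a"
    "arr M (acoev_tilde M a)" "Dom (acoev_tilde M a) = \<one>" "Cod (acoev_tilde M a) = Dual M a \<otimes> a"
  using assms by (simp_all add: aev_tilde_def acoev_tilde_def ev_tilde_def)

section \<open>Zig-zag equations of the two dualities\<close>

lemma azigzag:
  assumes "a \<in> Obj M"
  shows "\<RR> a \<cdot> (\<II> a \<star> aev M a) \<cdot> \<AA> a (Dual M a) a \<cdot> (acoev M a \<star> \<II> a) \<cdot> \<LL>\<^sup>- a = \<II> a"
  using assms by (intro arrow_eqI[of M]) (simp_all add: zigzag)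

lemma azigzag_dual:
  assumes "a \<in> Obj M"
  shows "\<LL> (Dual M a) \<cdot> (aev M a \<star> \<II> (Dual M a)) \<cdot> \<AA>\<^sup>- (Dual M a) a (Dual M a)
    \<cdot> (\<II> (Dual M a) \<star> acoev M a) \<cdot> \<RR>\<^sup>- (Dual M a) = \<II> (Dual M a)"
  using assms by (intro arrow_eqI[of M]) (simp_all add: zigzag_dual)

text \<open>The pivotal isomorphism and its inverse meet on the middle factor \<open>a\<close> and
  cancel, which leaves the zig-zag of \<open>Dual M a\<close>.\<close>

lemma zigzag_tilde_dual:
  assumes [simp]: "a \<in> Obj M"
  shows "\<RR> (Dual M a) \<cdot> (\<II> (Dual M a) \<star> aev_tilde M a) \<cdot> \<AA> (Dual M a) a (Dual M a)
    \<cdot> (acoev_tilde M a \<star> \<II> (Dual M a)) \<cdot> \<LL>\<^sup>- (Dual M a) = \<II> (Dual M a)"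
proof -
  let ?b = "Dual M a"
  have "(\<II> ?b \<star> aev_tilde M a) \<cdot> \<AA> ?b a ?b \<cdot> (acoev_tilde M a \<star> \<II> ?b)
      = (\<II> ?b \<star> aev M ?b) \<cdot> (\<II> ?b \<star> apiv M a \<star> \<II> ?b) \<cdot> \<AA> ?b a ?b
          \<cdot> ((\<II> ?b \<star> apiv_inv M a) \<star> \<II> ?b) \<cdot> (acoev M ?b \<star> \<II> ?b)"
    by (simp add: aev_tilde_def acoev_tilde_def lwhisker_comp rwhisker_comp acomp_assoc)
  also have "\<dots> = (\<II> ?b \<star> aev M ?b) \<cdot> (\<II> ?b \<star> apiv M a \<star> \<II> ?b) \<cdot> (\<II> ?b \<star> apiv_inv M a \<star> \<II> ?b)
          \<cdot> \<AA> ?b (Dual M ?b) ?b \<cdot> (acoev M ?b \<star> \<II> ?b)"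
    by (simp add: acomp_extend[OF assoc_nat] acomp_assoc)
  also have "\<dots> = (\<II> ?b \<star> aev M ?b) \<cdot> \<AA> ?b (Dual M ?b) ?b \<cdot> (acoev M ?b \<star> \<II> ?b)"
    by (simp add: acomp_extend[OF ainterchange] ainterchange)
  finally have eq: "(\<II> ?b \<star> aev_tilde M a) \<cdot> \<AA> ?b a ?b \<cdot> (acoev_tilde M a \<star> \<II> ?b)
      = (\<II> ?b \<star> aev M ?b) \<cdot> \<AA> ?b (Dual M ?b) ?b \<cdot> (acoev M ?b \<star> \<II> ?b)" .
  have "\<RR> ?b \<cdot> ((\<II> ?b \<star> aev_tilde M a) \<cdot> \<AA> ?b a ?b \<cdot> (acoev_tilde M a \<star> \<II> ?b)) \<cdot> \<LL>\<^sup>- ?b = \<II> ?b"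
    unfolding eq using azigzag[of ?b] by (simp add: acomp_assoc)
  then show ?thesis
    by (simp add: acomp_assoc)
qed

text \<open>Here the pivotal isomorphism and its inverse act on different copies of
  \<open>a\<close>, at the two ends, and do not meet. Composing with \<open>apiv M a\<close> on the
  left converts the outer copies to double duals; the second zig-zag of \<open>Dual M a\<close> then
  applies, and \<open>apiv M a\<close> is cancelled.\<close>

lemma zigzag_tilde:
  assumes [simp]: "a \<in> Obj M"
  shows "\<LL> a \<cdot> (aev_tilde M a \<star> \<II> a) \<cdot> \<AA>\<^sup>- a (Dual M a) a
    \<cdot> (\<II> a \<star> acoev_tilde M a) \<cdot> \<RR>\<^sup>- a = \<II> a"
proof (rule cancel_left_inverse[OF _ apiv_inv_left])
  let ?b = "Dual M a" and ?c = "Dual M (Dual M a)"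
  have "apiv M a \<cdot> \<LL> a \<cdot> (aev_tilde M a \<star> \<II> a) \<cdot> \<AA>\<^sup>- a ?b a \<cdot> (\<II> a \<star> acoev_tilde M a) \<cdot> \<RR>\<^sup>- a
      = \<LL> ?c \<cdot> (\<II> \<one> \<star> apiv M a) \<cdot> (aev_tilde M a \<star> \<II> a) \<cdot> \<AA>\<^sup>- a ?b a \<cdot> (\<II> a \<star> acoev_tilde M a) \<cdot> \<RR>\<^sup>- a"
    by (simp add: acomp_extend[OF lunit_nat] acomp_assoc)
  also have "\<dots> = \<LL> ?c \<cdot> (aev M ?b \<star> \<II> ?c) \<cdot> ((apiv M a \<star> \<II> ?b) \<star> apiv M a) \<cdot> \<AA>\<^sup>- a ?b a
      \<cdot> (\<II> a \<star> acoev_tilde M a) \<cdot> \<RR>\<^sup>- a"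
    by (simp add: aev_tilde_def interchange_simps)
  also have "\<dots> = \<LL> ?c \<cdot> (aev M ?b \<star> \<II> ?c) \<cdot> \<AA>\<^sup>- ?c ?b ?c \<cdot> (apiv M a \<star> \<II> ?b \<star> apiv M a)
      \<cdot> (\<II> a \<star> acoev_tilde M a) \<cdot> \<RR>\<^sup>- a"
    by (simp add: acomp_extend[OF assoc_inv_nat] acomp_assoc)
  also have "\<dots> = \<LL> ?c \<cdot> (aev M ?b \<star> \<II> ?c) \<cdot> \<AA>\<^sup>- ?c ?b ?c \<cdot> (\<II> ?c \<star> acoev M ?b)
      \<cdot> (apiv M a \<star> \<II> \<one>) \<cdot> \<RR>\<^sup>- a"
    by (simp add: acoev_tilde_def interchange_simps acomp_extend[OF apiv_inv_right])
  also have "\<dots> = (\<LL> ?c \<cdot> (aev M ?b \<star> \<II> ?c) \<cdot> \<AA>\<^sup>- ?c ?b ?c \<cdot> (\<II> ?c \<star> acoev M ?b) \<cdot> \<RR>\<^sup>- ?c) \<cdot> apiv M a"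
    using runit_inv_nat[of "apiv M a" a] by (simp add: acomp_assoc)
  also have "\<dots> = apiv M a \<cdot> \<II> a"
    by (simp add: azigzag_dual)
  finally show "apiv M a \<cdot> \<LL> a \<cdot> (aev_tilde M a \<star> \<II> a) \<cdot> \<AA>\<^sup>- a ?b a \<cdot> (\<II> a \<star> acoev_tilde M a) \<cdot> \<RR>\<^sup>- a
      = apiv M a \<cdot> \<II> a" .
qed simp_all

section \<open>Bijectivity of the two bendings\<close>

lemma arr_left_bend:
  assumes "half_braided M X" "arr M g" "Dom g = fst X" "Cod g = y \<otimes> x" "x \<in> Obj M" "y \<in> Obj M"
  shows "arr M (left_bend M X y x g)" "Dom (left_bend M X y x g) = fst X \<otimes> Dual M y"
    "Cod (left_bend M X y x g) = x"
  using assms by (simp_all add: left_bend_def arr_lcontract)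

lemma arr_right_bend:
  assumes "arr M f" "Cod f = x \<otimes> y" "x \<in> Obj M" "y \<in> Obj M"
  shows "arr M (right_bend M x y f)" "Dom (right_bend M x y f) = Dom f \<otimes> Dual M y"
    "Cod (right_bend M x y f) = x"
  using assms by (simp_all add: right_bend_def arr_rcontract)

lemma left_bend_inject:
  assumes X [simp]: "half_braided M X" and [simp]: "x \<in> Obj M" "y \<in> Obj M"
    and g [simp]: "arr M g" "Dom g = fst X" "Cod g = y \<otimes> x"
    and g' [simp]: "arr M g'" "Dom g' = fst X" "Cod g' = y \<otimes> x"
    and eq: "left_bend M X y x g = left_bend M X y x g'"
  shows "g = g'"
proof -
  let ?l = "lcontract M (aev M y) (Dual M y) y" and ?k = "linsert M (acoev M y) y (Dual M y)"
  note [simp] = arr_lcontract arr_linsert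
  \<comment> \<open>The inverse bending: an inserted pair slides past \<open>h\<close> and meets the
    contraction in a zig-zag.\<close>
  have unbend: "h = (\<II> y \<star> (?l x \<cdot> (\<II> (Dual M y) \<star> h))) \<cdot> ?k (fst X)"
    if [simp]: "arr M h" "Dom h = fst X" "Cod h = y \<otimes> x" for h
  proof -
    have "(\<II> y \<star> (?l x \<cdot> (\<II> (Dual M y) \<star> h))) \<cdot> ?k (fst X)
        = (\<II> y \<star> ?l x) \<cdot> (\<II> y \<star> \<II> (Dual M y) \<star> h) \<cdot> ?k (fst X)"
      by (simp add: lwhisker_comp acomp_assoc)
    also have "\<dots> = ((\<II> y \<star> ?l x) \<cdot> ?k (y \<otimes> x)) \<cdot> h"
      using linsert_nat[of "acoev M y" y "Dual M y" h "y \<otimes> x"] by (simp add: acomp_assoc)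
    also have "\<dots> = h"
      by (simp add: lcontract_linsert azigzag)
    finally show ?thesis by simp
  qed
  \<comment> \<open>The half-braiding at the dual of \<open>y\<close> is invertible, so it can be
    stripped from both bends before unbending.\<close>
  have "?l x \<cdot> (\<II> (Dual M y) \<star> g) = ?l x \<cdot> (\<II> (Dual M y) \<star> g')"
    by (rule cancel_right_inverse[OF _ braid_inv_right[of X "Dual M y"]])
      (use eq in \<open>simp_all add: left_bend_def acomp_assoc\<close>)
  then show ?thesis
    using unbend[OF g] unbend[OF g'] by simp
qed

lemma right_bend_inject:
  assumes [simp]: "x \<in> Obj M" "y \<in> Obj M"
    and f [simp]: "arr M f" "Cod f = x \<otimes> y"
    and f' [simp]: "arr M f'" "Cod f' = x \<otimes> y" and Dom: "Dom f = Dom f'"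
    and eq: "right_bend M x y f = right_bend M x y f'"
  shows "f = f'"
proof -
  let ?r = "rcontract M (aev_tilde M y) x y (Dual M y)"
  let ?k = "\<lambda>d. rinsert M (acoev_tilde M y) d (Dual M y) y"
  note [simp] = arr_rcontract arr_rinsert
  have unbend: "h = (right_bend M x y h \<star> \<II> y) \<cdot> ?k (Dom h)"
    if [simp]: "arr M h" "Cod h = x \<otimes> y" for h
  proof -
    have [simp]: "Dom h \<in> Obj M"
      by simp
    have "(right_bend M x y h \<star> \<II> y) \<cdot> ?k (Dom h)
        = (?r \<star> \<II> y) \<cdot> ((h \<star> \<II> (Dual M y)) \<star> \<II> y) \<cdot> ?k (Dom h)"
      by (simp add: right_bend_def rwhisker_comp acomp_assoc)
    also have "\<dots> = ((?r \<star> \<II> y) \<cdot> ?k (x \<otimes> y)) \<cdot> h"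
      using rinsert_nat[of "acoev_tilde M y" "Dual M y" y h "x \<otimes> y"] by (simp add: acomp_assoc)
    also have "\<dots> = h"
      by (simp add: rcontract_rinsert zigzag_tilde)
    finally show ?thesis by simp
  qed
  show ?thesis
    using unbend[OF f] unbend[OF f'] eq Dom by simp
qed

text \<open>This is what produces a right inverse of the traciator; injectivity of the bendings
  gives only uniqueness statements.\<close>

lemma right_bend_surject:
  assumes [simp]: "x \<in> Obj M" "y \<in> Obj M" "p \<in> Obj M"
    and k [simp]: "arr M k" "Dom k = p \<otimes> Dual M y" "Cod k = x"
  shows "\<exists>f. arr M f \<and> Dom f = p \<and> Cod f = x \<otimes> y \<and> right_bend M x y f = k"
proof (intro exI conjI)
  \<comment> \<open>The preimage restores \<open>y\<close> with the copairing and lets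
    \<open>k\<close> consume the source together with the inserted dual.\<close>
  let ?f = "(k \<star> \<II> y) \<cdot> rinsert M (acoev_tilde M y) p (Dual M y) y"
  let ?r = "\<lambda>d. rcontract M (aev_tilde M y) d y (Dual M y)"
  note [simp] = arr_rcontract arr_rinsert
  show "arr M ?f" "Dom ?f = p" "Cod ?f = x \<otimes> y"
    by simp_all
  have "right_bend M x y ?f
      = (?r x \<cdot> ((k \<star> \<II> y) \<star> \<II> (Dual M y))) \<cdot> (rinsert M (acoev_tilde M y) p (Dual M y) y \<star> \<II> (Dual M y))"
    by (simp add: right_bend_def rwhisker_comp acomp_assoc)
  also have "\<dots> = k \<cdot> ?r (p \<otimes> Dual M y) \<cdot> (rinsert M (acoev_tilde M y) p (Dual M y) y \<star> \<II> (Dual M y))"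
    by (simp add: rcontract_nat acomp_assoc)
  also have "\<dots> = k"
    by (simp add: rinsert_rcontract zigzag_tilde_dual)
  finally show "right_bend M x y ?f = k" .
qed

section \<open>Bending the formula of the traciator\<close>

lemma arr_swing:
  assumes "half_braided M X" "arr M f" "Dom f = fst X" "Cod f = x \<otimes> y" "x \<in> Obj M" "y \<in> Obj M"
  shows "arr M (swing M X x y f)" "Dom (swing M X x y f) = fst X" "Cod (swing M X x y f) = y \<otimes> x"
  using assms by (simp_all add: swing_def)

text \<open>The evaluation added by the left bend and the coevaluation inside \<open>swing\<close>
  form a zig-zag, except that \<open>fst X\<close> crosses the dual of \<open>y\<close> and
  \<open>y\<close> between them. \<open>lcontract_braid_past\<close> removes the two crossings, the
  zig-zag straightens, and the part of \<open>swing\<close> containing \<open>f\<close> and the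
  other evaluation is left: the right bend of \<open>f\<close>.\<close>

lemma left_bend_swing:
  assumes X [simp]: "half_braided M X" and [simp]: "x \<in> Obj M" "y \<in> Obj M"
    and f [simp]: "arr M f" "Dom f = fst X" "Cod f = x \<otimes> y"
  shows "left_bend M X y x (swing M X x y f) = right_bend M x y f"
proof -
  let ?p = "fst X" and ?y = "Dual M y" and ?k = "right_bend M x y f"
  let ?l = "lcontract M (aev M y) (Dual M y) y"
  note [simp] = arr_lcontract arr_rcontract arr_right_bend arr_braid_past
  \<comment> \<open>\<open>f\<close> and the evaluation \<open>aev_tilde M y\<close> are gathered
    into \<open>?k\<close>, which then acts as one morphism beside \<open>y\<close>.\<close>
  have "swing M X x y f
      = (rcontract M (aev_tilde M y) (y \<otimes> x) y ?y \<cdot> (\<AA>\<^sup>- y x y \<star> \<II> ?y)) \<cdot> ((\<II> y \<star> f) \<star> \<II> ?y)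
          \<cdot> (braid M X y \<star> \<II> ?y) \<cdot> \<AA>\<^sup>- ?p y ?y \<cdot> (\<II> ?p \<star> acoev M y) \<cdot> \<RR>\<^sup>- ?p"
    by (simp add: swing_def rcontract_def acomp_assoc)
  also have "\<dots> = (\<II> y \<star> rcontract M (aev_tilde M y) x y ?y) \<cdot> \<AA> y (x \<otimes> y) ?y \<cdot> ((\<II> y \<star> f) \<star> \<II> ?y)
          \<cdot> (braid M X y \<star> \<II> ?y) \<cdot> \<AA>\<^sup>- ?p y ?y \<cdot> (\<II> ?p \<star> acoev M y) \<cdot> \<RR>\<^sup>- ?p"
    by (simp add: rcontract_tensor acomp_assoc)
  also have "\<dots> = (\<II> y \<star> ?k) \<cdot> braid_past M X y ?y \<cdot> (\<II> ?p \<star> acoev M y) \<cdot> \<RR>\<^sup>- ?p"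
    by (simp add: acomp_extend[OF assoc_nat] braid_past_def right_bend_def lwhisker_comp acomp_assoc)
  finally have rot: "swing M X x y f
      = (\<II> y \<star> ?k) \<cdot> braid_past M X y ?y \<cdot> (\<II> ?p \<star> acoev M y) \<cdot> \<RR>\<^sup>- ?p" .
  \<comment> \<open>The braiding at \<open>?y\<close> has no bystander, while the coevaluation grows
    out of a unit. Naturality of the right unitor provides that unit as the bystander.\<close>
  have runit: "(\<II> ?y \<star> \<RR>\<^sup>- ?p) \<cdot> braid M X ?y = braid_past M X ?y \<one> \<cdot> (\<II> ?p \<star> \<RR>\<^sup>- ?y)"
  proof -
    have "(\<II> ?y \<star> \<RR>\<^sup>- ?p) \<cdot> braid M X ?y = \<AA> ?y ?p \<one> \<cdot> (braid M X ?y \<star> \<II> \<one>) \<cdot> \<RR>\<^sup>- (?p \<otimes> ?y)"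
      using runit_inv_nat[of "braid M X ?y" "?p \<otimes> ?y"]
      by (simp add: runit_inv_tensor[symmetric] acomp_assoc)
    also have "\<dots> = braid_past M X ?y \<one> \<cdot> (\<II> ?p \<star> \<RR>\<^sup>- ?y)"
      by (simp add: braid_past_def acomp_assoc runit_inv_tensor[symmetric] acomp_extend[OF assoc_inv_left])
    finally show ?thesis .
  qed
  have "left_bend M X y x (swing M X x y f)
      = (?l x \<cdot> (\<II> ?y \<star> \<II> y \<star> ?k)) \<cdot> (\<II> ?y \<star> braid_past M X y ?y) \<cdot> (\<II> ?y \<star> \<II> ?p \<star> acoev M y)
          \<cdot> (\<II> ?y \<star> \<RR>\<^sup>- ?p) \<cdot> braid M X ?y"
    by (simp add: left_bend_def rot lwhisker_comp acomp_assoc)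
  also have "\<dots> = ?k \<cdot> ?l (?p \<otimes> ?y) \<cdot> (\<II> ?y \<star> braid_past M X y ?y) \<cdot> (\<II> ?y \<star> \<II> ?p \<star> acoev M y)
          \<cdot> braid_past M X ?y \<one> \<cdot> (\<II> ?p \<star> \<RR>\<^sup>- ?y)"
    by (simp add: lcontract_nat runit acomp_assoc)
  \<comment> \<open>Letting the coevaluation act before the pass beyond \<open>?y\<close> makes the
    passes beyond \<open>?y\<close> and \<open>y\<close> adjacent, as
    \<open>lcontract_braid_past\<close> requires.\<close>
  also have "\<dots> = ?k \<cdot> (?l (?p \<otimes> ?y) \<cdot> (\<II> ?y \<star> braid_past M X y ?y) \<cdot> braid_past M X ?y (y \<otimes> ?y))
          \<cdot> (\<II> ?p \<star> \<II> ?y \<star> acoev M y) \<cdot> (\<II> ?p \<star> \<RR>\<^sup>- ?y)"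
    using acomp_extend[OF braid_past_nat_right[of X ?y "acoev M y" "y \<otimes> ?y", symmetric]]
    by (simp add: acomp_assoc)
  also have "\<dots> = ?k \<cdot> (\<II> ?p \<star> ?l ?y) \<cdot> (\<II> ?p \<star> \<II> ?y \<star> acoev M y) \<cdot> (\<II> ?p \<star> \<RR>\<^sup>- ?y)"
    by (simp add: lcontract_braid_past)
  also have "\<dots> = ?k \<cdot> (\<II> ?p \<star> (?l ?y \<cdot> (\<II> ?y \<star> acoev M y) \<cdot> \<RR>\<^sup>- ?y))"
    by (simp add: lwhisker_comp acomp_assoc)
  also have "\<dots> = ?k"
    by (simp add: lcontract_def acomp_assoc azigzag_dual)
  finally show ?thesis .
qed

section \<open>Compatibility of bending with composition and with the tensor product of the
  center\<close>

lemma left_bend_nat: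
  assumes [simp]: "half_braided M X" "x \<in> Obj M" "y \<in> Obj M" "arr M g" "Dom g = fst X" "Cod g = y \<otimes> x"
    "arr M h" "Dom h = x" "Cod h = x'"
  shows "left_bend M X y x' ((\<II> y \<star> h) \<cdot> g) = h \<cdot> left_bend M X y x g"
proof -
  have [simp]: "x' \<in> Obj M"
    using arr_Cod[of M h] by simp
  show ?thesis
    by (simp add: left_bend_def arr_lcontract lwhisker_comp acomp_assoc acomp_extend[OF lcontract_nat])
qed

lemma right_bend_nat:
  assumes [simp]: "x \<in> Obj M" "y \<in> Obj M" "arr M f" "Cod f = x \<otimes> y" "arr M h" "Dom h = x" "Cod h = x'"
  shows "right_bend M x' y ((h \<star> \<II> y) \<cdot> f) = h \<cdot> right_bend M x y f"
proof -
  have [simp]: "x' \<in> Obj M"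
    using arr_Cod[of M h] by simp
  show ?thesis
    by (simp add: right_bend_def arr_rcontract rwhisker_comp acomp_assoc acomp_extend[OF rcontract_nat])
qed

lemma right_bend_comp:
  assumes "x \<in> Obj M" "y \<in> Obj M" "arr M f" "Cod f = x \<otimes> y" "arr M h" "Cod h = Dom f"
  shows "right_bend M x y (f \<cdot> h) = right_bend M x y f \<cdot> (h \<star> \<II> (Dual M y))"
  using assms by (simp add: right_bend_def arr_rcontract rwhisker_comp acomp_assoc)

text \<open>\<open>nat\<close> says that \<open>h\<close> respects the half-braidings at the dual of
  \<open>y\<close>, the only object at which the left bend braids. \<open>X\<close> enters through a
  single well-typed braiding, so it may be a \<open>center_tensor\<close>.\<close>

lemma left_bend_comp:
  assumes "x \<in> Obj M" "y \<in> Obj M" "arr M (braid M X (Dual M y))" "half_braided M Y"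
    "arr M g" "Dom g = fst Y" "Cod g = y \<otimes> x" "arr M h" "Cod h = fst Y" "Dom h = fst X"
    and nat: "(\<II> (Dual M y) \<star> h) \<cdot> braid M X (Dual M y) = braid M Y (Dual M y) \<cdot> (h \<star> \<II> (Dual M y))"
  shows "left_bend M X y x (g \<cdot> h) = left_bend M Y y x g \<cdot> (h \<star> \<II> (Dual M y))"
  using assms by (simp add: left_bend_def arr_lcontract lwhisker_comp acomp_assoc)

lemma braid_center_tensor:
  assumes "half_braided M X" "half_braided M Y" "c \<in> Obj M"
  shows "braid M (center_tensor M X Y) c
    = braid_past M X c (fst Y) \<cdot> (\<II> (fst X) \<star> braid M Y c) \<cdot> \<AA> (fst X) (fst Y) c"
proof -
  let ?R = "\<AA> c (fst X) (fst Y) \<cdot> (braid M X c \<star> \<II> (fst Y))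
      \<cdot> \<AA>\<^sup>- (fst X) c (fst Y) \<cdot> (\<II> (fst X) \<star> braid M Y c) \<cdot> \<AA> (fst X) (fst Y) c"
  have R: "arr M ?R"
    using assms by simp
  have "braid M (center_tensor M X Y) c = ?R"
  \<comment> \<open>The fields are compared directly: that the left side is well-typed is deduced
    from this very equation in \<open>arr_braid_center_tensor\<close>.\<close>
  proof (rule arrow.expand)
    have "?R \<noteq> Null"
      using R by (metis arr_Null)
    then show "(braid M (center_tensor M X Y) c = Null) = (?R = Null)"
      by (simp add: braid_def)
    show "Dom (braid M (center_tensor M X Y) c) = Dom ?R \<and>
      Body (braid M (center_tensor M X Y) c) = Body ?R \<and>
      Cod (braid M (center_tensor M X Y) c) = Cod ?R"
      using assms by (simp add: center_tensor_def split_beta)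
  qed
  then show ?thesis
    by (simp add: braid_past_def acomp_assoc)
qed

text \<open>The product formula before any functor or adjunction enters. In the product
  half-braiding \<open>X\<close> passes the dual of \<open>y\<close>, and in the bent morphism it
  passes \<open>y\<close>; the evaluation removes both passes. Only \<open>Y\<close> is still
  braided, and there \<open>eq\<close> applies.\<close>

lemma left_bend_tensor:
  assumes X [simp]: "half_braided M X" and Y [simp]: "half_braided M Y"
    and [simp]: "w \<in> Obj M" "x \<in> Obj M" "y \<in> Obj M"
    and a [simp]: "arr M a" "Dom a = fst X" "Cod a = w"
    and f [simp]: "arr M f" "Dom f = fst Y" "Cod f = x \<otimes> y"
    and g [simp]: "arr M g" "Dom g = fst Y" "Cod g = y \<otimes> x"
    and eq: "left_bend M Y y x g = right_bend M x y f"
  shows "left_bend M (center_tensor M X Y) y (w \<otimes> x)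
      ((\<II> y \<star> a \<star> \<II> x) \<cdot> braid_past M X y x \<cdot> (\<II> (fst X) \<star> g))
    = right_bend M (w \<otimes> x) y (\<AA>\<^sup>- w x y \<cdot> (a \<star> f))"
proof -
  let ?p = "fst X" and ?q = "fst Y" and ?y = "Dual M y"
  let ?l = "lcontract M (aev M y) (Dual M y) y"
  note [simp] = arr_lcontract arr_rcontract arr_right_bend arr_left_bend arr_braid_past
  have "left_bend M (center_tensor M X Y) y (w \<otimes> x)
        ((\<II> y \<star> a \<star> \<II> x) \<cdot> braid_past M X y x \<cdot> (\<II> ?p \<star> g))
      = (?l (w \<otimes> x) \<cdot> (\<II> ?y \<star> \<II> y \<star> a \<star> \<II> x)) \<cdot> (\<II> ?y \<star> braid_past M X y x) \<cdot> (\<II> ?y \<star> \<II> ?p \<star> g)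
          \<cdot> braid_past M X ?y ?q \<cdot> (\<II> ?p \<star> braid M Y ?y) \<cdot> \<AA> ?p ?q ?y"
    by (simp add: left_bend_def braid_center_tensor lwhisker_comp acomp_assoc)
  also have "\<dots> = (a \<star> \<II> x) \<cdot> ?l (?p \<otimes> x) \<cdot> (\<II> ?y \<star> braid_past M X y x) \<cdot> (\<II> ?y \<star> \<II> ?p \<star> g)
          \<cdot> braid_past M X ?y ?q \<cdot> (\<II> ?p \<star> braid M Y ?y) \<cdot> \<AA> ?p ?q ?y"
    using lcontract_nat[of "aev M y" ?y y "a \<star> \<II> x"] by (simp add: acomp_assoc)
  \<comment> \<open>Sliding \<open>g\<close> past the pass beyond \<open>?y\<close> brings the two
    passes of \<open>?p\<close> together.\<close>
  also have "\<dots> = (a \<star> \<II> x) \<cdot> (?l (?p \<otimes> x) \<cdot> (\<II> ?y \<star> braid_past M X y x) \<cdot> braid_past M X ?y (y \<otimes> x))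
          \<cdot> (\<II> ?p \<star> \<II> ?y \<star> g) \<cdot> (\<II> ?p \<star> braid M Y ?y) \<cdot> \<AA> ?p ?q ?y"
    using acomp_extend[OF braid_past_nat_right[of X ?y g "y \<otimes> x", symmetric]]
    by (simp add: acomp_assoc)
  also have "\<dots> = (a \<star> \<II> x) \<cdot> (\<II> ?p \<star> left_bend M Y y x g) \<cdot> \<AA> ?p ?q ?y"
    by (simp add: lcontract_braid_past left_bend_def lwhisker_comp acomp_assoc)
  also have "\<dots> = (\<II> w \<star> rcontract M (aev_tilde M y) x y ?y) \<cdot> (a \<star> f \<star> \<II> ?y) \<cdot> \<AA> ?p ?q ?y"
    by (simp add: eq interchange_simps right_bend_def)
  also have "\<dots> = (\<II> w \<star> rcontract M (aev_tilde M y) x y ?y) \<cdot> \<AA> w (x \<otimes> y) ?y \<cdot> ((a \<star> f) \<star> \<II> ?y)"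
    by (simp add: assoc_nat)
  also have "\<dots> = right_bend M (w \<otimes> x) y (\<AA>\<^sup>- w x y \<cdot> (a \<star> f))"
    by (simp add: right_bend_def rwhisker_comp acomp_assoc acomp_extend[OF rcontract_tensor])
  finally show ?thesis .
qed

text \<open>Tensoring with \<open>z\<close> only enlarges the bystander from \<open>x\<close> to
  \<open>x \<otimes> z\<close>; two arrangements of the pentagon account for the associators around
  the single crossing.\<close>

lemma assoc_braid_past:
  assumes [simp]: "half_braided M X" "x \<in> Obj M" "y \<in> Obj M" "z \<in> Obj M"
  shows "\<AA> y (fst X \<otimes> x) z \<cdot> (braid_past M X y x \<star> \<II> z)
    = (\<II> y \<star> \<AA>\<^sup>- (fst X) x z) \<cdot> braid_past M X y (x \<otimes> z) \<cdot> (\<II> (fst X) \<star> \<AA> y x z) \<cdot> \<AA> (fst X) (y \<otimes> x) z"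
proof -
  let ?p = "fst X"
  have "(\<II> y \<star> \<AA>\<^sup>- ?p x z) \<cdot> braid_past M X y (x \<otimes> z) \<cdot> (\<II> ?p \<star> \<AA> y x z) \<cdot> \<AA> ?p (y \<otimes> x) z
      = \<AA> y (?p \<otimes> x) z \<cdot> (\<AA> y ?p x \<star> \<II> z) \<cdot> (\<AA>\<^sup>- (y \<otimes> ?p) x z \<cdot> (braid M X y \<star> \<II> (x \<otimes> z)))
          \<cdot> (\<AA>\<^sup>- ?p y (x \<otimes> z) \<cdot> (\<II> ?p \<star> \<AA> y x z)) \<cdot> \<AA> ?p (y \<otimes> x) z"
    by (simp add: braid_past_def acomp_assoc acomp_extend[OF pentagon_inv_left])
  also have "\<dots> = \<AA> y (?p \<otimes> x) z \<cdot> (\<AA> y ?p x \<star> \<II> z) \<cdot> ((braid M X y \<star> \<II> x) \<star> \<II> z)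
          \<cdot> \<AA>\<^sup>- (?p \<otimes> y) x z \<cdot> \<AA> (?p \<otimes> y) x z \<cdot> (\<AA>\<^sup>- ?p y x \<star> \<II> z) \<cdot> \<AA>\<^sup>- ?p (y \<otimes> x) z \<cdot> \<AA> ?p (y \<otimes> x) z"
    by (simp only: pentagon_inv_mid[OF half_braided_obj[OF assms(1)] assms(3,2,4), symmetric])
      (simp add: assoc_inv_nat_left acomp_assoc)
  also have "\<dots> = \<AA> y (?p \<otimes> x) z \<cdot> (braid_past M X y x \<star> \<II> z)"
    by (simp add: acomp_extend[OF assoc_inv_left] braid_past_def rwhisker_comp)
  finally show ?thesis by simp
qed

end

section \<open>The functor, the adjunction and mates\<close>

lemma center_obj_iff: "X \<in> Obj (center M) \<longleftrightarrow> half_braided M X"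
  by (cases X) (simp add: center_def half_braided_def)

lemma center_hom_iff:
  "f \<in> Hom (center M) X Y \<longleftrightarrow> f \<in> Hom M (fst X) (fst Y) \<and>
    (\<forall>c\<in>Obj M. (\<iota>\<^bsub>M\<^esub> c \<odot>\<^bsub>M\<^esub> f) \<bullet>\<^bsub>M\<^esub> snd X c = snd Y c \<bullet>\<^bsub>M\<^esub> (f \<odot>\<^bsub>M\<^esub> \<iota>\<^bsub>M\<^esub> c))"
  by (cases X; cases Y) (simp add: center_def)

lemma center_simps:
  "Comp (center M) = Comp M" "Ident (center M) X = \<iota>\<^bsub>M\<^esub> (fst X)"
  "TensorO (center M) = center_tensor M" "TensorA (center M) = TensorA M"
  "Assoc (center M) X Y Z = \<alpha>\<^bsub>M\<^esub> (fst X) (fst Y) (fst Z)"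
  by (simp_all add: center_def)

lemma fst_center_tensor [simp]: "fst (center_tensor M X Y) = fst X \<otimes>\<^bsub>M\<^esub> fst Y"
  by (cases X; cases Y) (simp add: center_tensor_def)

lemma (in pivotal_category) center_IsoD:
  "f \<in> Iso (center M) X Y \<Longrightarrow> f \<in> Iso M (fst X) (fst Y) \<and> f \<in> Hom (center M) X Y"
  by (auto simp: Iso_def is_inverse_def center_hom_iff center_simps)

lemma (in pivotal_category) arr_braid_center_tensor:
  assumes "half_braided M X" "half_braided M Y" "c \<in> Obj M"
  shows "arr M (braid M (center_tensor M X Y) c)"
  using assms by (simp add: braid_center_tensor arr_braid_past)

lemma (in pivotal_category) center_hom_braid:
  assumes f: "f \<in> Hom (center M) X Y" and "fst X \<in> Obj M" "half_braided M Y" "c \<in> Obj M"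
    and X: "arr M (braid M X c)"
  shows "(\<II> c \<star> Arrow (fst X) f (fst Y)) \<cdot> braid M X c = braid M Y c \<cdot> (Arrow (fst X) f (fst Y) \<star> \<II> c)"
proof (rule arrow_eqI[of M])
  have a: "arr M (Arrow (fst X) f (fst Y))"
    using assms by (simp add: arr_Arrow center_hom_iff)
  show "arr M ((\<II> c \<star> Arrow (fst X) f (fst Y)) \<cdot> braid M X c)"
    "arr M (braid M Y c \<cdot> (Arrow (fst X) f (fst Y) \<star> \<II> c))"
    "Dom ((\<II> c \<star> Arrow (fst X) f (fst Y)) \<cdot> braid M X c) = Dom (braid M Y c \<cdot> (Arrow (fst X) f (fst Y) \<star> \<II> c))"
    "Cod ((\<II> c \<star> Arrow (fst X) f (fst Y)) \<cdot> braid M X c) = Cod (braid M Y c \<cdot> (Arrow (fst X) f (fst Y) \<star> \<II> c))"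
    "Body ((\<II> c \<star> Arrow (fst X) f (fst Y)) \<cdot> braid M X c) = Body (braid M Y c \<cdot> (Arrow (fst X) f (fst Y) \<star> \<II> c))"
    using a assms by (simp_all add: center_hom_iff)
qed

section \<open>The functor, the counit and mates on typed arrows\<close>

locale categorified_trace = C: pivotal_category C + M: pivotal_category M
  for C :: "('c, 'f) pivcat" and M :: "('o, 'm) pivcat" +
  fixes \<Phi>Z :: "('c, 'f, 'o \<times> ('o \<Rightarrow> 'm), 'm) tfunctor"
    and Tr :: "('o, 'm, 'c, 'f) cfunctor"
    and \<epsilon> :: "'o \<Rightarrow> 'm"
  assumes tensor_functor: "is_tensor_functor C (center M) \<Phi>Z"
    and adjoint: "is_right_adjoint C M (underlying M \<Phi>Z) Tr \<epsilon>"
begin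

abbreviation "Z \<equiv> FObj \<Phi>Z"
abbreviation "P c \<equiv> fst (FObj \<Phi>Z c)"
abbreviation "T \<equiv> FObj Tr"

definition \<Phi> :: "('c, 'f) arrow \<Rightarrow> ('o, 'm) arrow" where
  "\<Phi> f = Arrow (P (Dom f)) (FArr \<Phi>Z (Body f)) (P (Cod f))"

definition \<Phi>mult :: "'c \<Rightarrow> 'c \<Rightarrow> ('o, 'm) arrow" where
  "\<Phi>mult a b = Arrow (P a \<otimes>\<^bsub>M\<^esub> P b) (FMult \<Phi>Z a b) (P (a \<otimes>\<^bsub>C\<^esub> b))"

definition \<Phi>mult_inv :: "'c \<Rightarrow> 'c \<Rightarrow> ('o, 'm) arrow" where
  "\<Phi>mult_inv a b =
    Arrow (P (a \<otimes>\<^bsub>C\<^esub> b)) (inv_arr M (P a \<otimes>\<^bsub>M\<^esub> P b) (P (a \<otimes>\<^bsub>C\<^esub> b)) (FMult \<Phi>Z a b)) (P a \<otimes>\<^bsub>M\<^esub> P b)"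

definition T1 :: "('o, 'm) arrow \<Rightarrow> ('c, 'f) arrow" where
  "T1 f = Arrow (T (Dom f)) (FArr Tr (Body f)) (T (Cod f))"

definition counit :: "'o \<Rightarrow> ('o, 'm) arrow" where
  "counit x = Arrow (P (T x)) (\<epsilon> x) x"

definition mate :: "'o \<Rightarrow> ('c, 'f) arrow \<Rightarrow> ('o, 'm) arrow" where
  "mate x g = counit x \<cdot>\<^bsub>M\<^esub> \<Phi> g"

definition unmate :: "'c \<Rightarrow> 'o \<Rightarrow> ('o, 'm) arrow \<Rightarrow> ('c, 'f) arrow" where
  "unmate c x h = Arrow c (with_mate C M (underlying M \<Phi>Z) Tr \<epsilon> c x (Body h)) (T x)"

definition \<mu> :: "'o \<Rightarrow> 'o \<Rightarrow> ('c, 'f) arrow" where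
  "\<mu> x y = Arrow (T x \<otimes>\<^bsub>C\<^esub> T y) (trace_mult C M (underlying M \<Phi>Z) Tr \<epsilon> x y) (T (x \<otimes>\<^bsub>M\<^esub> y))"

definition \<tau> :: "'o \<Rightarrow> 'o \<Rightarrow> ('c, 'f) arrow" where
  "\<tau> x y = Arrow (T (x \<otimes>\<^bsub>M\<^esub> y)) (traciator C M \<Phi>Z Tr \<epsilon> x y) (T (y \<otimes>\<^bsub>M\<^esub> x))"

definition \<tau>neg :: "'o \<Rightarrow> 'o \<Rightarrow> ('c, 'f) arrow" where
  "\<tau>neg x y = Arrow (T (x \<otimes>\<^bsub>M\<^esub> y)) (traciator_neg C M \<Phi>Z Tr \<epsilon> x y) (T (y \<otimes>\<^bsub>M\<^esub> x))"

lemma dom_cod_simps [simp]: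
  "Dom (\<Phi> f) = P (Dom f)" "Cod (\<Phi> f) = P (Cod f)"
  "Dom (\<Phi>mult a b) = P a \<otimes>\<^bsub>M\<^esub> P b" "Cod (\<Phi>mult a b) = P (a \<otimes>\<^bsub>C\<^esub> b)"
  "Dom (\<Phi>mult_inv a b) = P (a \<otimes>\<^bsub>C\<^esub> b)" "Cod (\<Phi>mult_inv a b) = P a \<otimes>\<^bsub>M\<^esub> P b"
  "Dom (T1 h) = T (Dom h)" "Cod (T1 h) = T (Cod h)" "Body (T1 h) = FArr Tr (Body h)"
  "Dom (counit x) = P (T x)" "Cod (counit x) = x" "Body (counit x) = \<epsilon> x"
  "Dom (unmate c x h) = c" "Cod (unmate c x h) = T x"
  "Dom (\<mu> x y) = T x \<otimes>\<^bsub>C\<^esub> T y" "Cod (\<mu> x y) = T (x \<otimes>\<^bsub>M\<^esub> y)"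
  "Body (\<mu> x y) = trace_mult C M (underlying M \<Phi>Z) Tr \<epsilon> x y"
  "Dom (\<tau> x y) = T (x \<otimes>\<^bsub>M\<^esub> y)" "Cod (\<tau> x y) = T (y \<otimes>\<^bsub>M\<^esub> x)"
  "Body (\<tau> x y) = traciator C M \<Phi>Z Tr \<epsilon> x y"
  "Dom (\<tau>neg x y) = T (x \<otimes>\<^bsub>M\<^esub> y)" "Cod (\<tau>neg x y) = T (y \<otimes>\<^bsub>M\<^esub> x)"
  "Body (\<tau>neg x y) = traciator_neg C M \<Phi>Z Tr \<epsilon> x y"
  by (simp_all add: \<Phi>_def \<Phi>mult_def \<Phi>mult_inv_def T1_def counit_def unmate_def \<mu>_def \<tau>_def \<tau>neg_def)

lemma is_functor_\<Phi>Z: "is_functor C (center M) \<Phi>Z"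
  using tensor_functor by (simp add: is_tensor_functor_def)

lemma half_braided_Z [simp]: "c \<in> Obj C \<Longrightarrow> half_braided M (Z c)"
  using is_functor_\<Phi>Z by (simp add: is_functor_def center_obj_iff)

lemma T_obj [simp]: "x \<in> Obj M \<Longrightarrow> T x \<in> Obj C"
  using adjoint by (simp add: is_right_adjoint_def is_functor_def)

lemma FArr_center_hom: "arr C f \<Longrightarrow> FArr \<Phi>Z (Body f) \<in> Hom (center M) (Z (Dom f)) (Z (Cod f))"
  using is_functor_\<Phi>Z arr_Body[of C f] by (simp add: is_functor_def)

lemma arr_\<Phi> [simp]: "arr C f \<Longrightarrow> arr M (\<Phi> f)"
  using FArr_center_hom[of f] by (simp add: \<Phi>_def arr_Arrow center_hom_iff)

lemma \<Phi>_id [simp]: "c \<in> Obj C \<Longrightarrow> \<Phi> (\<II>\<^bsub>C\<^esub> c) = \<II>\<^bsub>M\<^esub> (P c)"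
  using is_functor_\<Phi>Z by (simp add: is_functor_def \<Phi>_def center_simps aid_def)

lemma \<Phi>_comp:
  assumes "arr C g" "arr C f" "Dom g = Cod f"
  shows "\<Phi> (g \<cdot>\<^bsub>C\<^esub> f) = \<Phi> g \<cdot>\<^bsub>M\<^esub> \<Phi> f"
proof (rule arrow_eqI[of M])
  have g: "Body g \<in> Hom C (Cod f) (Cod g)"
    using arr_Body[OF assms(1)] assms(3) by simp
  have "FArr \<Phi>Z (Body g \<bullet>\<^bsub>C\<^esub> Body f) = FArr \<Phi>Z (Body g) \<bullet>\<^bsub>M\<^esub> FArr \<Phi>Z (Body f)"
    using is_functor_\<Phi>Z g arr_Body[OF assms(2)] arr_Dom[OF assms(2)] arr_Cod[OF assms(1)]
      arr_Cod[OF assms(2)] by (auto simp: is_functor_def center_simps)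
  then show "Body (\<Phi> (g \<cdot>\<^bsub>C\<^esub> f)) = Body (\<Phi> g \<cdot>\<^bsub>M\<^esub> \<Phi> f)"
    using assms by (simp add: \<Phi>_def[of "g \<cdot>\<^bsub>C\<^esub> f"]) (simp add: \<Phi>_def)
qed (use assms in simp_all)

lemma braid_\<Phi>:
  assumes "arr C f" "c \<in> Obj M" "Dom f = a" "Cod f = b"
  shows "(\<II>\<^bsub>M\<^esub> c \<star>\<^bsub>M\<^esub> \<Phi> f) \<cdot>\<^bsub>M\<^esub> braid M (Z a) c = braid M (Z b) c \<cdot>\<^bsub>M\<^esub> (\<Phi> f \<star>\<^bsub>M\<^esub> \<II>\<^bsub>M\<^esub> c)"
  using M.center_hom_braid[OF FArr_center_hom[OF assms(1)]] assms arr_Dom[OF assms(1)] arr_Cod[OF assms(1)]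
  by (auto simp: \<Phi>_def)

lemma FMult_iso:
  assumes "a \<in> Obj C" "b \<in> Obj C"
  shows "FMult \<Phi>Z a b \<in> Iso M (P a \<otimes>\<^bsub>M\<^esub> P b) (P (a \<otimes>\<^bsub>C\<^esub> b))"
    and "FMult \<Phi>Z a b \<in> Hom (center M) (center_tensor M (Z a) (Z b)) (Z (a \<otimes>\<^bsub>C\<^esub> b))"
proof -
  have "FMult \<Phi>Z a b \<in> Iso (center M) (center_tensor M (Z a) (Z b)) (Z (a \<otimes>\<^bsub>C\<^esub> b))"
    using tensor_functor assms by (simp add: is_tensor_functor_def center_simps)
  then show "FMult \<Phi>Z a b \<in> Iso M (P a \<otimes>\<^bsub>M\<^esub> P b) (P (a \<otimes>\<^bsub>C\<^esub> b))"
    "FMult \<Phi>Z a b \<in> Hom (center M) (center_tensor M (Z a) (Z b)) (Z (a \<otimes>\<^bsub>C\<^esub> b))"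
    using M.center_IsoD by fastforce+
qed

lemma \<Phi>mult_arrow [simp]:
  assumes "a \<in> Obj C" "b \<in> Obj C"
  shows "arr M (\<Phi>mult a b)" "arr M (\<Phi>mult_inv a b)"
    "\<Phi>mult a b \<cdot>\<^bsub>M\<^esub> \<Phi>mult_inv a b = \<II>\<^bsub>M\<^esub> (P (a \<otimes>\<^bsub>C\<^esub> b))"
    "\<Phi>mult_inv a b \<cdot>\<^bsub>M\<^esub> \<Phi>mult a b = \<II>\<^bsub>M\<^esub> (P a \<otimes>\<^bsub>M\<^esub> P b)"
  using M.Iso_arrow[OF FMult_iso(1)[OF assms]] assms by (simp_all add: \<Phi>mult_def \<Phi>mult_inv_def)

text \<open>The structure maps of \<open>\<Phi>Z\<close> are morphisms of the center. Through this
  the half-braiding of the image of a tensor product becomes accessible from those of the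
  factors.\<close>

lemma braid_\<Phi>mult:
  assumes "a \<in> Obj C" "b \<in> Obj C" "c \<in> Obj M"
  shows "(\<II>\<^bsub>M\<^esub> c \<star>\<^bsub>M\<^esub> \<Phi>mult a b) \<cdot>\<^bsub>M\<^esub> braid M (center_tensor M (Z a) (Z b)) c
    = braid M (Z (a \<otimes>\<^bsub>C\<^esub> b)) c \<cdot>\<^bsub>M\<^esub> (\<Phi>mult a b \<star>\<^bsub>M\<^esub> \<II>\<^bsub>M\<^esub> c)"
  using M.center_hom_braid[OF FMult_iso(2)[OF assms(1,2)], of c] assms
  by (simp add: \<Phi>mult_def M.arr_braid_center_tensor)

lemma \<Phi>mult_nat:
  assumes "arr C f" "arr C g" "Cod f = a" "Cod g = b"
  shows "\<Phi>mult a b \<cdot>\<^bsub>M\<^esub> (\<Phi> f \<star>\<^bsub>M\<^esub> \<Phi> g) = \<Phi> (f \<star>\<^bsub>C\<^esub> g) \<cdot>\<^bsub>M\<^esub> \<Phi>mult (Dom f) (Dom g)"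
proof (rule arrow_eqI[of M])
  have f: "Body f \<in> Hom C (Dom f) a" and g: "Body g \<in> Hom C (Dom g) b"
    using arr_Body[OF assms(1)] arr_Body[OF assms(2)] assms by simp_all
  have "FMult \<Phi>Z a b \<bullet>\<^bsub>M\<^esub> (FArr \<Phi>Z (Body f) \<odot>\<^bsub>M\<^esub> FArr \<Phi>Z (Body g))
      = FArr \<Phi>Z (Body f \<odot>\<^bsub>C\<^esub> Body g) \<bullet>\<^bsub>M\<^esub> FMult \<Phi>Z (Dom f) (Dom g)"
    using tensor_functor f g arr_Dom[OF assms(1)] arr_Dom[OF assms(2)] arr_Cod[OF assms(1)]
      arr_Cod[OF assms(2)] assms(3,4) by (auto simp: is_tensor_functor_def center_simps)
  then show "Body (\<Phi>mult a b \<cdot>\<^bsub>M\<^esub> (\<Phi> f \<star>\<^bsub>M\<^esub> \<Phi> g)) = Body (\<Phi> (f \<star>\<^bsub>C\<^esub> g) \<cdot>\<^bsub>M\<^esub> \<Phi>mult (Dom f) (Dom g))"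
    using assms arr_Cod[OF assms(1)] arr_Cod[OF assms(2)]
    by simp (simp add: \<Phi>_def \<Phi>mult_def)
qed (use assms arr_Cod[OF assms(1)] arr_Cod[OF assms(2)] in simp_all)

lemma \<Phi>mult_assoc:
  assumes "a \<in> Obj C" "b \<in> Obj C" "c \<in> Obj C"
  shows "\<Phi> (\<AA>\<^bsub>C\<^esub> a b c) \<cdot>\<^bsub>M\<^esub> \<Phi>mult (a \<otimes>\<^bsub>C\<^esub> b) c \<cdot>\<^bsub>M\<^esub> (\<Phi>mult a b \<star>\<^bsub>M\<^esub> \<II>\<^bsub>M\<^esub> (P c))
    = \<Phi>mult a (b \<otimes>\<^bsub>C\<^esub> c) \<cdot>\<^bsub>M\<^esub> (\<II>\<^bsub>M\<^esub> (P a) \<star>\<^bsub>M\<^esub> \<Phi>mult b c) \<cdot>\<^bsub>M\<^esub> \<AA>\<^bsub>M\<^esub> (P a) (P b) (P c)"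
proof (rule arrow_eqI[of M])
  have "FArr \<Phi>Z (\<alpha>\<^bsub>C\<^esub> a b c) \<bullet>\<^bsub>M\<^esub> FMult \<Phi>Z (a \<otimes>\<^bsub>C\<^esub> b) c \<bullet>\<^bsub>M\<^esub> (FMult \<Phi>Z a b \<odot>\<^bsub>M\<^esub> \<iota>\<^bsub>M\<^esub> (P c))
      = FMult \<Phi>Z a (b \<otimes>\<^bsub>C\<^esub> c) \<bullet>\<^bsub>M\<^esub> (\<iota>\<^bsub>M\<^esub> (P a) \<odot>\<^bsub>M\<^esub> FMult \<Phi>Z b c) \<bullet>\<^bsub>M\<^esub> \<alpha>\<^bsub>M\<^esub> (P a) (P b) (P c)"
    using tensor_functor assms by (simp add: is_tensor_functor_def center_simps)
  then show "Body (\<Phi> (\<AA>\<^bsub>C\<^esub> a b c) \<cdot>\<^bsub>M\<^esub> \<Phi>mult (a \<otimes>\<^bsub>C\<^esub> b) c \<cdot>\<^bsub>M\<^esub> (\<Phi>mult a b \<star>\<^bsub>M\<^esub> \<II>\<^bsub>M\<^esub> (P c)))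
    = Body (\<Phi>mult a (b \<otimes>\<^bsub>C\<^esub> c) \<cdot>\<^bsub>M\<^esub> (\<II>\<^bsub>M\<^esub> (P a) \<star>\<^bsub>M\<^esub> \<Phi>mult b c) \<cdot>\<^bsub>M\<^esub> \<AA>\<^bsub>M\<^esub> (P a) (P b) (P c))"
    using assms by simp (simp add: \<Phi>_def \<Phi>mult_def)
qed (use assms in simp_all)

lemma arr_T1 [simp]: "arr M f \<Longrightarrow> arr C (T1 f)"
  using adjoint arr_Body[of M f]
  by (simp add: T1_def arr_Arrow is_right_adjoint_def is_functor_def)

lemma arr_counit [simp]: "x \<in> Obj M \<Longrightarrow> arr M (counit x)"
  using adjoint
  by (simp add: counit_def arr_Arrow is_right_adjoint_def underlying_def tfunctor_comp_def forgetful_def)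

lemma counit_nat:
  assumes "arr M f" "Cod f = y"
  shows "counit y \<cdot>\<^bsub>M\<^esub> \<Phi> (T1 f) = f \<cdot>\<^bsub>M\<^esub> counit (Dom f)"
proof (rule arrow_eqI[of M])
  have f: "Body f \<in> Hom M (Dom f) y"
    using arr_Body[OF assms(1)] assms(2) by simp
  have "\<epsilon> y \<bullet>\<^bsub>M\<^esub> FArr \<Phi>Z (FArr Tr (Body f)) = Body f \<bullet>\<^bsub>M\<^esub> \<epsilon> (Dom f)"
    using adjoint f arr_Dom[OF assms(1)] arr_Cod[OF assms(1)] assms(2)
    by (auto simp: is_right_adjoint_def underlying_def tfunctor_comp_def forgetful_def)
  then show "Body (counit y \<cdot>\<^bsub>M\<^esub> \<Phi> (T1 f)) = Body (f \<cdot>\<^bsub>M\<^esub> counit (Dom f))"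
    using assms arr_Cod[OF assms(1)] by simp (simp add: \<Phi>_def)
qed (use assms arr_Cod[OF assms(1)] in simp_all)

lemma arr_mate [simp]:
  assumes "arr C g" "Cod g = T x" "x \<in> Obj M"
  shows "arr M (mate x g)" "Dom (mate x g) = P (Dom g)" "Cod (mate x g) = x"
  using assms by (simp_all add: mate_def)

lemma mate_bij:
  assumes "c \<in> Obj C" "x \<in> Obj M"
  shows "bij_betw (\<lambda>g. \<epsilon> x \<bullet>\<^bsub>M\<^esub> FArr \<Phi>Z g) (Hom C c (T x)) (Hom M (P c) x)"
  using adjoint assms
  by (simp add: is_right_adjoint_def underlying_def tfunctor_comp_def forgetful_def)

lemma Body_mate: "\<lbrakk>arr C g; Cod g = T x; x \<in> Obj M\<rbrakk> \<Longrightarrow> Body (mate x g) = \<epsilon> x \<bullet>\<^bsub>M\<^esub> FArr \<Phi>Z (Body g)"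
  by (simp add: mate_def) (simp add: \<Phi>_def)

lemma mate_inject:
  assumes "mate x g = mate x g'" "arr C g" "arr C g'" "Cod g = T x" "Cod g' = T x" "Dom g = Dom g'"
    "x \<in> Obj M"
  shows "g = g'"
proof (rule arrow_eqI[of C])
  have "Body g \<in> Hom C (Dom g) (T x)" "Body g' \<in> Hom C (Dom g) (T x)"
    using assms arr_Body[of C g] arr_Body[of C g'] by simp_all
  moreover have "\<epsilon> x \<bullet>\<^bsub>M\<^esub> FArr \<Phi>Z (Body g) = \<epsilon> x \<bullet>\<^bsub>M\<^esub> FArr \<Phi>Z (Body g')"
    using assms Body_mate[of g x] Body_mate[of g' x] by simp
  ultimately show "Body g = Body g'"
    using inj_onD[OF bij_betw_imp_inj_on[OF mate_bij[OF arr_Dom[OF assms(2)] assms(7)]], of "Body g" "Body g'"]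
    by simp
qed (use assms in simp_all)

text \<open>\<open>with_mate\<close> is a definite description: surjectivity of the adjunction
  bijection gives existence and its injectivity gives uniqueness.\<close>

lemma unmate:
  assumes "arr M h" "Dom h = P c" "Cod h = x" "c \<in> Obj C"
  shows arr_unmate: "arr C (unmate c x h)" and mate_unmate: "mate x (unmate c x h) = h"
proof -
  have x: "x \<in> Obj M"
    using assms by auto
  let ?Q = "\<lambda>g. g \<in> Hom C c (T x) \<and> \<epsilon> x \<bullet>\<^bsub>M\<^esub> FArr \<Phi>Z g = Body h"
  have "Body h \<in> Hom M (P c) x"
    using assms arr_Body[of M h] by simp
  then have "Body h \<in> (\<lambda>g. \<epsilon> x \<bullet>\<^bsub>M\<^esub> FArr \<Phi>Z g) ` Hom C c (T x)"
    using bij_betw_imp_surj_on[OF mate_bij[OF assms(4) x]] by simp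
  then obtain g where "?Q g"
    by (auto simp: image_iff)
  moreover have "g' = g" if "?Q g'" for g'
    using inj_onD[OF bij_betw_imp_inj_on[OF mate_bij[OF assms(4) x]], of g' g] that \<open>?Q g\<close> by simp
  ultimately have "\<exists>!g. ?Q g"
    by blast
  then have "?Q (THE g. ?Q g)"
    by (rule theI')
  moreover have eq: "with_mate C M (underlying M \<Phi>Z) Tr \<epsilon> c x (Body h) = (THE g. ?Q g)"
    by (simp add: with_mate_def underlying_def tfunctor_comp_def forgetful_def)
  ultimately have Q: "?Q (Body (unmate c x h))"
    by (simp add: unmate_def)
  then show *: "arr C (unmate c x h)"
    using assms x by (simp add: unmate_def arr_Arrow)
  show "mate x (unmate c x h) = h"
    by (rule arrow_eqI[of M]) (use * Q assms x Body_mate[OF *] in simp_all)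
qed

end

section \<open>The traciator\<close>

context categorified_trace
begin

section \<open>Mates of composites and of the multiplication\<close>

lemma mate_comp:
  assumes "arr C g" "arr C f" "Dom g = Cod f"
  shows "mate x (g \<cdot>\<^bsub>C\<^esub> f) = mate x g \<cdot>\<^bsub>M\<^esub> \<Phi> f"
  using assms by (simp add: mate_def \<Phi>_comp M.acomp_assoc)

lemma mate_T1:
  assumes "arr M f" "Cod f = x" "arr C g" "Cod g = T (Dom f)"
  shows "mate x (T1 f \<cdot>\<^bsub>C\<^esub> g) = f \<cdot>\<^bsub>M\<^esub> mate (Dom f) g"
  using assms by (simp add: mate_def \<Phi>_comp M.acomp_extend[OF counit_nat] M.acomp_assoc)

lemma mate_id: "x \<in> Obj M \<Longrightarrow> mate x (\<II>\<^bsub>C\<^esub> (T x)) = counit x"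
  by (simp add: mate_def)

lemma \<mu>_unmate:
  assumes [simp]: "x \<in> Obj M" "y \<in> Obj M"
  shows "\<mu> x y = unmate (T x \<otimes>\<^bsub>C\<^esub> T y) (x \<otimes>\<^bsub>M\<^esub> y)
    ((counit x \<star>\<^bsub>M\<^esub> counit y) \<cdot>\<^bsub>M\<^esub> \<Phi>mult_inv (T x) (T y))"
proof -
  \<comment> \<open>The forgetful functor contributes an identity to the tensor structure of the
    composite functor; it has to be absorbed before the definitions agree.\<close>
  have "FMult (underlying M \<Phi>Z) (T x) (T y) = FMult \<Phi>Z (T x) (T y)"
    using M.comp_id_right[of "P (T x) \<otimes>\<^bsub>M\<^esub> P (T y)" "P (T x \<otimes>\<^bsub>C\<^esub> T y)" "FMult \<Phi>Z (T x) (T y)"]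
      FMult_iso(1)[of "T x" "T y"]
    by (simp add: underlying_def tfunctor_comp_def forgetful_def Iso_def)
  moreover have "Body (\<Phi>mult_inv (T x) (T y))
      = inv_arr M (P (T x) \<otimes>\<^bsub>M\<^esub> P (T y)) (P (T x \<otimes>\<^bsub>C\<^esub> T y)) (FMult \<Phi>Z (T x) (T y))"
    by (simp add: \<Phi>mult_inv_def)
  ultimately show ?thesis
    by (simp add: \<mu>_def unmate_def trace_mult_def)
      (simp add: underlying_def tfunctor_comp_def forgetful_def)
qed

lemma arr_\<mu> [simp]:
  assumes "x \<in> Obj M" "y \<in> Obj M"
  shows "arr C (\<mu> x y)"
  using assms by (simp add: \<mu>_unmate arr_unmate)

text \<open>Composing with \<open>\<Phi>mult\<close> removes the inverse from the definition of the
  multiplication, and naturality of \<open>\<Phi>mult\<close> lets \<open>f\<close> and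
  \<open>g\<close> reach the two counits separately.\<close>

lemma mate_\<mu>:
  assumes [simp]: "x \<in> Obj M" "y \<in> Obj M" and f: "arr C f" "Cod f = T x" and g: "arr C g" "Cod g = T y"
  shows "mate (x \<otimes>\<^bsub>M\<^esub> y) (\<mu> x y \<cdot>\<^bsub>C\<^esub> (f \<star>\<^bsub>C\<^esub> g)) \<cdot>\<^bsub>M\<^esub> \<Phi>mult (Dom f) (Dom g) = mate x f \<star>\<^bsub>M\<^esub> mate y g"
proof -
  note [simp] = f g
  have "mate (x \<otimes>\<^bsub>M\<^esub> y) (\<mu> x y \<cdot>\<^bsub>C\<^esub> (f \<star>\<^bsub>C\<^esub> g)) \<cdot>\<^bsub>M\<^esub> \<Phi>mult (Dom f) (Dom g)
      = mate (x \<otimes>\<^bsub>M\<^esub> y) (\<mu> x y) \<cdot>\<^bsub>M\<^esub> \<Phi>mult (T x) (T y) \<cdot>\<^bsub>M\<^esub> (\<Phi> f \<star>\<^bsub>M\<^esub> \<Phi> g)"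
    by (simp add: mate_comp M.acomp_assoc \<Phi>mult_nat)
  also have "mate (x \<otimes>\<^bsub>M\<^esub> y) (\<mu> x y) = (counit x \<star>\<^bsub>M\<^esub> counit y) \<cdot>\<^bsub>M\<^esub> \<Phi>mult_inv (T x) (T y)"
    by (simp add: \<mu>_unmate mate_unmate)
  also have "((counit x \<star>\<^bsub>M\<^esub> counit y) \<cdot>\<^bsub>M\<^esub> \<Phi>mult_inv (T x) (T y)) \<cdot>\<^bsub>M\<^esub> \<Phi>mult (T x) (T y) \<cdot>\<^bsub>M\<^esub> (\<Phi> f \<star>\<^bsub>M\<^esub> \<Phi> g)
      = mate x f \<star>\<^bsub>M\<^esub> mate y g"
    by (simp add: M.acomp_assoc M.acomp_extend[OF \<Phi>mult_arrow(4)] M.ainterchange mate_def)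
  finally show ?thesis .
qed

section \<open>The traciator: characterisation, invertibility, naturality\<close>

lemma \<tau>_unmate:
  assumes [simp]: "x \<in> Obj M" "y \<in> Obj M"
  shows "\<tau> x y = unmate (T (x \<otimes>\<^bsub>M\<^esub> y)) (y \<otimes>\<^bsub>M\<^esub> x) (swing M (Z (T (x \<otimes>\<^bsub>M\<^esub> y))) x y (counit (x \<otimes>\<^bsub>M\<^esub> y)))"
proof -
  have "Body (swing M (Z (T (x \<otimes>\<^bsub>M\<^esub> y))) x y (counit (x \<otimes>\<^bsub>M\<^esub> y))) = traciator_mate M \<Phi>Z Tr \<epsilon> x y"
    by (simp add: swing_def traciator_mate_def Let_def underlying_def tfunctor_comp_def forgetful_def)
  then show ?thesis
    by (simp add: \<tau>_def unmate_def traciator_def)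
qed

lemma arr_\<tau> [simp]:
  assumes "x \<in> Obj M" "y \<in> Obj M"
  shows "arr C (\<tau> x y)"
  using assms by (simp add: \<tau>_unmate arr_unmate M.arr_swing)

lemma mate_\<tau>:
  assumes "x \<in> Obj M" "y \<in> Obj M"
  shows "mate (y \<otimes>\<^bsub>M\<^esub> x) (\<tau> x y) = swing M (Z (T (x \<otimes>\<^bsub>M\<^esub> y))) x y (counit (x \<otimes>\<^bsub>M\<^esub> y))"
  using assms by (simp add: \<tau>_unmate mate_unmate M.arr_swing)

lemma left_bend_mate_comp:
  assumes "x \<in> Obj M" "y \<in> Obj M" "arr C g" "Cod g = T (y \<otimes>\<^bsub>M\<^esub> x)" "arr C h" "Cod h = Dom g" "c = Dom h"
  shows "left_bend M (Z c) y x (mate (y \<otimes>\<^bsub>M\<^esub> x) (g \<cdot>\<^bsub>C\<^esub> h))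
    = left_bend M (Z (Dom g)) y x (mate (y \<otimes>\<^bsub>M\<^esub> x) g) \<cdot>\<^bsub>M\<^esub> (\<Phi> h \<star>\<^bsub>M\<^esub> \<II>\<^bsub>M\<^esub> (Dual M y))"
  using assms by (simp add: mate_comp M.left_bend_comp[where Y = "Z (Dom g)"] braid_\<Phi>)

text \<open>
  The traciator is characterised by moving \<open>y\<close> across with the evaluations: both sides below are
  morphisms \<open>\<Phi>(c) \<otimes> y\<^sup>* \<rightarrow> x\<close>.
\<close>

lemma \<tau>_iff:
  assumes [simp]: "x \<in> Obj M" "y \<in> Obj M"
    and f: "arr C f" "Cod f = T (x \<otimes>\<^bsub>M\<^esub> y)" and g: "arr C g" "Cod g = T (y \<otimes>\<^bsub>M\<^esub> x)"
    and c: "Dom f = c" "Dom g = c"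
  shows "g = \<tau> x y \<cdot>\<^bsub>C\<^esub> f \<longleftrightarrow>
    left_bend M (Z c) y x (mate (y \<otimes>\<^bsub>M\<^esub> x) g) = right_bend M x y (mate (x \<otimes>\<^bsub>M\<^esub> y) f)"
proof -
  note [simp] = f g c
  have c_obj [simp]: "c \<in> Obj C"
    using arr_Dom[OF f(1)] c by simp
  have bend: "left_bend M (Z c) y x (mate (y \<otimes>\<^bsub>M\<^esub> x) (\<tau> x y \<cdot>\<^bsub>C\<^esub> f)) = right_bend M x y (mate (x \<otimes>\<^bsub>M\<^esub> y) f)"
    by (simp add: left_bend_mate_comp mate_\<tau> M.left_bend_swing)
      (simp add: mate_def M.right_bend_comp)
  show ?thesis
  proof
    assume eq: "left_bend M (Z c) y x (mate (y \<otimes>\<^bsub>M\<^esub> x) g) = right_bend M x y (mate (x \<otimes>\<^bsub>M\<^esub> y) f)"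
    have "mate (y \<otimes>\<^bsub>M\<^esub> x) g = mate (y \<otimes>\<^bsub>M\<^esub> x) (\<tau> x y \<cdot>\<^bsub>C\<^esub> f)"
      by (rule M.left_bend_inject[of "Z c" x y]) (simp_all add: eq bend)
    then show "g = \<tau> x y \<cdot>\<^bsub>C\<^esub> f"
      by (rule mate_inject) simp_all
  qed (simp only: bend)
qed

lemma \<tau>_bend:
  assumes "x \<in> Obj M" "y \<in> Obj M" "arr C f" "Cod f = T (x \<otimes>\<^bsub>M\<^esub> y)"
  shows "left_bend M (Z (Dom f)) y x (mate (y \<otimes>\<^bsub>M\<^esub> x) (\<tau> x y \<cdot>\<^bsub>C\<^esub> f)) = right_bend M x y (mate (x \<otimes>\<^bsub>M\<^esub> y) f)"
  using \<tau>_iff[of x y f "\<tau> x y \<cdot>\<^bsub>C\<^esub> f" "Dom f"] assms by simp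

lemma \<tau>_cancel:
  assumes [simp]: "x \<in> Obj M" "y \<in> Obj M"
    and f: "arr C f" "Cod f = T (x \<otimes>\<^bsub>M\<^esub> y)" and f': "arr C f'" "Cod f' = T (x \<otimes>\<^bsub>M\<^esub> y)"
    and "Dom f = Dom f'" and eq: "\<tau> x y \<cdot>\<^bsub>C\<^esub> f = \<tau> x y \<cdot>\<^bsub>C\<^esub> f'"
  shows "f = f'"
proof (rule mate_inject)
  note [simp] = assms
  show "mate (x \<otimes>\<^bsub>M\<^esub> y) f = mate (x \<otimes>\<^bsub>M\<^esub> y) f'"
  proof (rule M.right_bend_inject[of x y])
    show "right_bend M x y (mate (x \<otimes>\<^bsub>M\<^esub> y) f) = right_bend M x y (mate (x \<otimes>\<^bsub>M\<^esub> y) f')"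
      using \<tau>_bend[of x y f] \<tau>_bend[of x y f'] by (simp add: assms(7) eq)
  qed simp_all
qed (use assms in simp_all)

lemma \<tau>_iso:
  assumes [simp]: "x \<in> Obj M" "y \<in> Obj M"
  shows "\<exists>g. arr C g \<and> Dom g = T (y \<otimes>\<^bsub>M\<^esub> x) \<and> Cod g = T (x \<otimes>\<^bsub>M\<^esub> y)
    \<and> \<tau> x y \<cdot>\<^bsub>C\<^esub> g = \<II>\<^bsub>C\<^esub> (T (y \<otimes>\<^bsub>M\<^esub> x)) \<and> g \<cdot>\<^bsub>C\<^esub> \<tau> x y = \<II>\<^bsub>C\<^esub> (T (x \<otimes>\<^bsub>M\<^esub> y))"
proof -
  let ?d = "T (y \<otimes>\<^bsub>M\<^esub> x)"
  \<comment> \<open>The counit is the mate of the identity. By \<open>\<tau>_iff\<close>, a right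
    inverse is a morphism whose mate has the left bend of the counit as its right bend.\<close>
  have "\<exists>f. arr M f \<and> Dom f = P ?d \<and> Cod f = x \<otimes>\<^bsub>M\<^esub> y
      \<and> right_bend M x y f = left_bend M (Z ?d) y x (counit (y \<otimes>\<^bsub>M\<^esub> x))"
    by (rule M.right_bend_surject) (simp_all add: M.arr_left_bend)
  then obtain f where f [simp]: "arr M f" "Dom f = P ?d" "Cod f = x \<otimes>\<^bsub>M\<^esub> y"
    and eq: "right_bend M x y f = left_bend M (Z ?d) y x (counit (y \<otimes>\<^bsub>M\<^esub> x))"
    by blast
  define g where "g = unmate ?d (x \<otimes>\<^bsub>M\<^esub> y) f"
  have g [simp]: "arr C g" "Dom g = ?d" "Cod g = T (x \<otimes>\<^bsub>M\<^esub> y)" "mate (x \<otimes>\<^bsub>M\<^esub> y) g = f"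
    by (simp_all add: g_def arr_unmate mate_unmate)
  have right: "\<II>\<^bsub>C\<^esub> ?d = \<tau> x y \<cdot>\<^bsub>C\<^esub> g"
    by (subst \<tau>_iff[where c = ?d]) (simp_all add: mate_id eq)
  \<comment> \<open>A right inverse of a left-cancellable morphism is two-sided: composing either
    side with \<open>\<tau> x y\<close> gives \<open>\<tau> x y\<close>.\<close>
  have "g \<cdot>\<^bsub>C\<^esub> \<tau> x y = \<II>\<^bsub>C\<^esub> (T (x \<otimes>\<^bsub>M\<^esub> y))"
    by (rule \<tau>_cancel[of x y]) (simp_all add: C.acomp_extend[OF right[symmetric]])
  with right show ?thesis
    by (intro exI[of _ g]) simp
qed

lemma \<tau>neg_arrow:
  assumes "x \<in> Obj M" "y \<in> Obj M"
  shows arr_\<tau>neg [simp]: "arr C (\<tau>neg y x)"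
    and \<tau>_\<tau>neg: "\<tau> x y \<cdot>\<^bsub>C\<^esub> \<tau>neg y x = \<II>\<^bsub>C\<^esub> (T (y \<otimes>\<^bsub>M\<^esub> x))"
    and \<tau>neg_\<tau>: "\<tau>neg y x \<cdot>\<^bsub>C\<^esub> \<tau> x y = \<II>\<^bsub>C\<^esub> (T (x \<otimes>\<^bsub>M\<^esub> y))"
proof -
  let ?t = "traciator C M \<Phi>Z Tr \<epsilon> x y" and ?a = "T (x \<otimes>\<^bsub>M\<^esub> y)" and ?b = "T (y \<otimes>\<^bsub>M\<^esub> x)"
  obtain g where g: "arr C g" "Dom g = ?b" "Cod g = ?a" "\<tau> x y \<cdot>\<^bsub>C\<^esub> g = \<II>\<^bsub>C\<^esub> ?b" "g \<cdot>\<^bsub>C\<^esub> \<tau> x y = \<II>\<^bsub>C\<^esub> ?a"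
    using \<tau>_iso[OF assms] by blast
  have "Body (\<tau> x y \<cdot>\<^bsub>C\<^esub> g) = \<iota>\<^bsub>C\<^esub> ?b" "Body (g \<cdot>\<^bsub>C\<^esub> \<tau> x y) = \<iota>\<^bsub>C\<^esub> ?a"
    by (simp_all only: g(4,5) Body_id)
  then have "is_inverse C ?a ?b ?t (Body g)"
    using g(1-3) arr_Body[OF g(1)] assms by (simp add: is_inverse_def)
  moreover have "?t \<in> Hom C ?a ?b"
    using arr_Body[OF arr_\<tau>[OF assms]] by simp
  ultimately have "?t \<in> Iso C ?a ?b"
    by (auto simp: Iso_def)
  from C.Iso_arrow[OF this] assms
  show "arr C (\<tau>neg y x)" "\<tau> x y \<cdot>\<^bsub>C\<^esub> \<tau>neg y x = \<II>\<^bsub>C\<^esub> ?b" "\<tau>neg y x \<cdot>\<^bsub>C\<^esub> \<tau> x y = \<II>\<^bsub>C\<^esub> ?a"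
    by (simp_all add: \<tau>_def \<tau>neg_def traciator_neg_def)
qed

text \<open>Bending leaves \<open>x\<close> alone on either side, so both bends pick up the same
  factor \<open>f\<close>. This moves associators on the object opposite to \<open>y\<close> across
  the traciator.\<close>

lemma \<tau>_nat_left:
  assumes [simp]: "y \<in> Obj M" and f [simp]: "arr M f" "Dom f = x" "Cod f = x'"
  shows "\<tau> x' y \<cdot>\<^bsub>C\<^esub> T1 (f \<star>\<^bsub>M\<^esub> \<II>\<^bsub>M\<^esub> y) = T1 (\<II>\<^bsub>M\<^esub> y \<star>\<^bsub>M\<^esub> f) \<cdot>\<^bsub>C\<^esub> \<tau> x y"
proof -
  have [simp]: "x \<in> Obj M" "x' \<in> Obj M"
    using arr_Dom[OF f(1)] arr_Cod[OF f(1)] by simp_all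
  have "left_bend M (Z (T (x \<otimes>\<^bsub>M\<^esub> y))) y x' (mate (y \<otimes>\<^bsub>M\<^esub> x') (T1 (\<II>\<^bsub>M\<^esub> y \<star>\<^bsub>M\<^esub> f) \<cdot>\<^bsub>C\<^esub> \<tau> x y))
      = f \<cdot>\<^bsub>M\<^esub> right_bend M x y (counit (x \<otimes>\<^bsub>M\<^esub> y))"
    using M.left_bend_nat[of "Z (T (x \<otimes>\<^bsub>M\<^esub> y))" x y
        "swing M (Z (T (x \<otimes>\<^bsub>M\<^esub> y))) x y (counit (x \<otimes>\<^bsub>M\<^esub> y))" f x']
    by (simp add: mate_T1 mate_\<tau> M.arr_swing M.left_bend_swing)
  also have "\<dots> = right_bend M x' y (mate (x' \<otimes>\<^bsub>M\<^esub> y) (T1 (f \<star>\<^bsub>M\<^esub> \<II>\<^bsub>M\<^esub> y)))"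
    using M.right_bend_nat[of x y "counit (x \<otimes>\<^bsub>M\<^esub> y)" f x']
    by (simp add: mate_def counit_nat)
  finally show ?thesis
    by (subst eq_commute, subst \<tau>_iff[where c = "T (x \<otimes>\<^bsub>M\<^esub> y)"]) simp_all
qed

text \<open>\<open>f\<close> stays general because the formula is applied twice: to the identity of
  \<open>T (x \<otimes> y)\<close> for one side of the relation, and for the other to a morphism
  that contains an inverse traciator.\<close>

lemma mate_\<tau>_\<mu>:
  assumes [simp]: "w \<in> Obj M" "x \<in> Obj M" "y \<in> Obj M"
    and f [simp]: "arr C f" "Cod f = T (x \<otimes>\<^bsub>M\<^esub> y)" "Dom f = d"
  defines "g \<equiv> T1 (\<AA>\<^sup>-\<^bsub>M\<^esub> w x y) \<cdot>\<^bsub>C\<^esub> \<mu> w (x \<otimes>\<^bsub>M\<^esub> y) \<cdot>\<^bsub>C\<^esub> (\<II>\<^bsub>C\<^esub> (T w) \<star>\<^bsub>C\<^esub> f)"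
  shows "mate (y \<otimes>\<^bsub>M\<^esub> w \<otimes>\<^bsub>M\<^esub> x) (\<tau> (w \<otimes>\<^bsub>M\<^esub> x) y \<cdot>\<^bsub>C\<^esub> g) \<cdot>\<^bsub>M\<^esub> \<Phi>mult (T w) d
    = (\<II>\<^bsub>M\<^esub> y \<star>\<^bsub>M\<^esub> counit w \<star>\<^bsub>M\<^esub> \<II>\<^bsub>M\<^esub> x) \<cdot>\<^bsub>M\<^esub> braid_past M (Z (T w)) y x
      \<cdot>\<^bsub>M\<^esub> (\<II>\<^bsub>M\<^esub> (P (T w)) \<star>\<^bsub>M\<^esub> mate (y \<otimes>\<^bsub>M\<^esub> x) (\<tau> x y \<cdot>\<^bsub>C\<^esub> f))" (is "?L \<cdot>\<^bsub>M\<^esub> ?m = ?R")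
proof -
  let ?c = "T w \<otimes>\<^bsub>C\<^esub> d" and ?inv = "\<Phi>mult_inv (T w) d"
  have d [simp]: "d \<in> Obj C"
    using arr_Dom[OF f(1)] by simp
  note [simp] = M.arr_braid_past M.arr_left_bend M.arr_right_bend
  have g [simp]: "arr C g" "Dom g = ?c" "Cod g = T ((w \<otimes>\<^bsub>M\<^esub> x) \<otimes>\<^bsub>M\<^esub> y)"
    by (simp_all add: g_def)
  have mate_g: "mate ((w \<otimes>\<^bsub>M\<^esub> x) \<otimes>\<^bsub>M\<^esub> y) g \<cdot>\<^bsub>M\<^esub> ?m
      = \<AA>\<^sup>-\<^bsub>M\<^esub> w x y \<cdot>\<^bsub>M\<^esub> (counit w \<star>\<^bsub>M\<^esub> mate (x \<otimes>\<^bsub>M\<^esub> y) f)"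
    using mate_\<mu>[of w "x \<otimes>\<^bsub>M\<^esub> y" "\<II>\<^bsub>C\<^esub> (T w)" f]
    by (simp add: g_def mate_T1 M.acomp_assoc mate_id)
  define R where "R = ?R"
  \<comment> \<open>The candidate for the mate, brought to the source \<open>P ?c\<close>.
    Injectivity of left bending will identify it with \<open>?L\<close>.\<close>
  define R' where "R' = R \<cdot>\<^bsub>M\<^esub> ?inv"
  have R [simp]: "arr M R" "Dom R = P (T w) \<otimes>\<^bsub>M\<^esub> P d" "Cod R = y \<otimes>\<^bsub>M\<^esub> w \<otimes>\<^bsub>M\<^esub> x"
    by (simp_all add: R_def)
  have R' [simp]: "arr M R'" "Dom R' = P ?c" "Cod R' = y \<otimes>\<^bsub>M\<^esub> w \<otimes>\<^bsub>M\<^esub> x"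
    by (simp_all add: R'_def)
  have R'm: "R' \<cdot>\<^bsub>M\<^esub> ?m = R"
    by (simp add: R'_def M.acomp_assoc)
  have inv: "(?m \<star>\<^bsub>M\<^esub> \<II>\<^bsub>M\<^esub> (Dual M y)) \<cdot>\<^bsub>M\<^esub> (?inv \<star>\<^bsub>M\<^esub> \<II>\<^bsub>M\<^esub> (Dual M y)) = \<II>\<^bsub>M\<^esub> (P ?c \<otimes>\<^bsub>M\<^esub> Dual M y)"
    by (simp add: M.ainterchange)
  \<comment> \<open>Taking \<open>\<Phi>mult\<close> into the bend replaces the half-braiding of
    \<open>Z ?c\<close> by the product of those of \<open>Z (T w)\<close> and \<open>Z d\<close>,
    for which \<open>left_bend_tensor\<close> is available.\<close>
  have "left_bend M (Z ?c) y (w \<otimes>\<^bsub>M\<^esub> x) R' \<cdot>\<^bsub>M\<^esub> (?m \<star>\<^bsub>M\<^esub> \<II>\<^bsub>M\<^esub> (Dual M y))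
      = left_bend M (center_tensor M (Z (T w)) (Z d)) y (w \<otimes>\<^bsub>M\<^esub> x) (R' \<cdot>\<^bsub>M\<^esub> ?m)"
    by (rule M.left_bend_comp[symmetric]) (simp_all add: M.arr_braid_center_tensor braid_\<Phi>mult)
  also have "\<dots> = right_bend M (w \<otimes>\<^bsub>M\<^esub> x) y (\<AA>\<^sup>-\<^bsub>M\<^esub> w x y \<cdot>\<^bsub>M\<^esub> (counit w \<star>\<^bsub>M\<^esub> mate (x \<otimes>\<^bsub>M\<^esub> y) f))"
    unfolding R'm R_def using \<tau>_bend[of x y f] by (intro M.left_bend_tensor) simp_all
  also have "\<dots> = right_bend M (w \<otimes>\<^bsub>M\<^esub> x) y (mate ((w \<otimes>\<^bsub>M\<^esub> x) \<otimes>\<^bsub>M\<^esub> y) g) \<cdot>\<^bsub>M\<^esub> (?m \<star>\<^bsub>M\<^esub> \<II>\<^bsub>M\<^esub> (Dual M y))"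
    unfolding mate_g[symmetric] by (rule M.right_bend_comp) simp_all
  finally have "left_bend M (Z ?c) y (w \<otimes>\<^bsub>M\<^esub> x) R'
      = right_bend M (w \<otimes>\<^bsub>M\<^esub> x) y (mate ((w \<otimes>\<^bsub>M\<^esub> x) \<otimes>\<^bsub>M\<^esub> y) g)"
    by (rule M.cancel_right_inverse[OF _ inv]) simp_all
  also have "\<dots> = left_bend M (Z ?c) y (w \<otimes>\<^bsub>M\<^esub> x) ?L"
    using \<tau>_bend[of "w \<otimes>\<^bsub>M\<^esub> x" y g] by simp
  finally have "R' = ?L"
    by (rule M.left_bend_inject[rotated -1]) simp_all
  with R'm show ?thesis
    by (simp add: R_def)
qed

end

section \<open>The relation between multiplication and traciator\<close>

context categorified_trace
begin

text \<open>The common source is bracketed to the left, as suits the first side. The second side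
  therefore begins with an associator of \<open>C\<close>, which \<open>\<Phi>mult_assoc\<close>
  converts into one of \<open>M\<close>.\<close>

lemma trace_relation:
  assumes [simp]: "w \<in> Obj M" "x \<in> Obj M" "y \<in> Obj M" "z \<in> Obj M"
  shows "\<tau>neg y ((w \<otimes>\<^bsub>M\<^esub> x) \<otimes>\<^bsub>M\<^esub> z) \<cdot>\<^bsub>C\<^esub> T1 (\<AA>\<^bsub>M\<^esub> y (w \<otimes>\<^bsub>M\<^esub> x) z) \<cdot>\<^bsub>C\<^esub> \<mu> (y \<otimes>\<^bsub>M\<^esub> w \<otimes>\<^bsub>M\<^esub> x) z
      \<cdot>\<^bsub>C\<^esub> (\<tau> (w \<otimes>\<^bsub>M\<^esub> x) y \<star>\<^bsub>C\<^esub> \<II>\<^bsub>C\<^esub> (T z))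
      \<cdot>\<^bsub>C\<^esub> (T1 (\<AA>\<^sup>-\<^bsub>M\<^esub> w x y) \<star>\<^bsub>C\<^esub> \<II>\<^bsub>C\<^esub> (T z)) \<cdot>\<^bsub>C\<^esub> (\<mu> w (x \<otimes>\<^bsub>M\<^esub> y) \<star>\<^bsub>C\<^esub> \<II>\<^bsub>C\<^esub> (T z))
    = T1 (\<AA>\<^sup>-\<^bsub>M\<^esub> w x z \<star>\<^bsub>M\<^esub> \<II>\<^bsub>M\<^esub> y) \<cdot>\<^bsub>C\<^esub> T1 (\<AA>\<^sup>-\<^bsub>M\<^esub> w (x \<otimes>\<^bsub>M\<^esub> z) y)
      \<cdot>\<^bsub>C\<^esub> \<mu> w ((x \<otimes>\<^bsub>M\<^esub> z) \<otimes>\<^bsub>M\<^esub> y) \<cdot>\<^bsub>C\<^esub> (\<II>\<^bsub>C\<^esub> (T w) \<star>\<^bsub>C\<^esub> \<tau>neg y (x \<otimes>\<^bsub>M\<^esub> z))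
      \<cdot>\<^bsub>C\<^esub> (\<II>\<^bsub>C\<^esub> (T w) \<star>\<^bsub>C\<^esub> T1 (\<AA>\<^bsub>M\<^esub> y x z)) \<cdot>\<^bsub>C\<^esub> (\<II>\<^bsub>C\<^esub> (T w) \<star>\<^bsub>C\<^esub> \<mu> (y \<otimes>\<^bsub>M\<^esub> x) z)
      \<cdot>\<^bsub>C\<^esub> (\<II>\<^bsub>C\<^esub> (T w) \<star>\<^bsub>C\<^esub> (\<tau> x y \<star>\<^bsub>C\<^esub> \<II>\<^bsub>C\<^esub> (T z))) \<cdot>\<^bsub>C\<^esub> \<AA>\<^bsub>C\<^esub> (T w) (T (x \<otimes>\<^bsub>M\<^esub> y)) (T z)"
    (is "_ = ?Y")
proof -
  let ?W = "T w" and ?V = "T (x \<otimes>\<^bsub>M\<^esub> y)" and ?Z = "T z"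
  let ?p = "P ?W" and ?q = "P ?V" and ?s = "P ?Z"
  note [simp] = M.arr_braid_past
  define \<psi> where "\<psi> = T1 (\<AA>\<^bsub>M\<^esub> y x z) \<cdot>\<^bsub>C\<^esub> \<mu> (y \<otimes>\<^bsub>M\<^esub> x) z \<cdot>\<^bsub>C\<^esub> (\<tau> x y \<star>\<^bsub>C\<^esub> \<II>\<^bsub>C\<^esub> ?Z)"
  \<comment> \<open>No mate of an inverse traciator is computed: in the calculation of mates
    \<open>\<sigma>\<close> enters through \<open>\<tau> \<sigma> = \<psi>\<close>, and
    \<open>mate_\<tau>_\<mu>\<close> at \<open>\<sigma>\<close> then involves only the mate of
    \<open>\<psi>\<close>.\<close>
  define \<sigma> where "\<sigma> = \<tau>neg y (x \<otimes>\<^bsub>M\<^esub> z) \<cdot>\<^bsub>C\<^esub> \<psi>"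
  define \<theta> where "\<theta> = \<tau> (w \<otimes>\<^bsub>M\<^esub> x) y \<cdot>\<^bsub>C\<^esub> T1 (\<AA>\<^sup>-\<^bsub>M\<^esub> w x y) \<cdot>\<^bsub>C\<^esub> \<mu> w (x \<otimes>\<^bsub>M\<^esub> y)"
  define \<kappa> where "\<kappa> = T1 (\<AA>\<^sup>-\<^bsub>M\<^esub> w (x \<otimes>\<^bsub>M\<^esub> z) y) \<cdot>\<^bsub>C\<^esub> \<mu> w ((x \<otimes>\<^bsub>M\<^esub> z) \<otimes>\<^bsub>M\<^esub> y) \<cdot>\<^bsub>C\<^esub> (\<II>\<^bsub>C\<^esub> ?W \<star>\<^bsub>C\<^esub> \<sigma>)"
  \<comment> \<open>\<open>X\<close> is the left side without its outermost inverse traciator and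
    \<open>Y\<close> is the right side, so the goal becomes \<open>X = \<tau> Y\<close>.\<close>
  define X where "X = T1 (\<AA>\<^bsub>M\<^esub> y (w \<otimes>\<^bsub>M\<^esub> x) z) \<cdot>\<^bsub>C\<^esub> \<mu> (y \<otimes>\<^bsub>M\<^esub> w \<otimes>\<^bsub>M\<^esub> x) z \<cdot>\<^bsub>C\<^esub> (\<theta> \<star>\<^bsub>C\<^esub> \<II>\<^bsub>C\<^esub> ?Z)"
  define Y where "Y = T1 (\<AA>\<^sup>-\<^bsub>M\<^esub> w x z \<star>\<^bsub>M\<^esub> \<II>\<^bsub>M\<^esub> y) \<cdot>\<^bsub>C\<^esub> \<kappa> \<cdot>\<^bsub>C\<^esub> \<AA>\<^bsub>C\<^esub> ?W ?V ?Z"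
  \<comment> \<open>The comparison map for three factors. After composing with it the mates of
    \<open>X\<close> and \<open>\<tau> Y\<close> become explicit; its invertibility permits
    cancelling it at the end.\<close>
  define m where "m = \<Phi>mult (?W \<otimes>\<^bsub>C\<^esub> ?V) ?Z \<cdot>\<^bsub>M\<^esub> (\<Phi>mult ?W ?V \<star>\<^bsub>M\<^esub> \<II>\<^bsub>M\<^esub> ?s)"
  define G where "G = (\<II>\<^bsub>M\<^esub> ?p \<star>\<^bsub>M\<^esub> mate (y \<otimes>\<^bsub>M\<^esub> x) (\<tau> x y)) \<star>\<^bsub>M\<^esub> counit z"
  let ?G' = "\<II>\<^bsub>M\<^esub> ?p \<star>\<^bsub>M\<^esub> mate (y \<otimes>\<^bsub>M\<^esub> x) (\<tau> x y) \<star>\<^bsub>M\<^esub> counit z"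
  have \<psi> [simp]: "arr C \<psi>" "Dom \<psi> = ?V \<otimes>\<^bsub>C\<^esub> ?Z" "Cod \<psi> = T (y \<otimes>\<^bsub>M\<^esub> x \<otimes>\<^bsub>M\<^esub> z)"
    by (simp_all add: \<psi>_def)
  have \<sigma> [simp]: "arr C \<sigma>" "Dom \<sigma> = ?V \<otimes>\<^bsub>C\<^esub> ?Z" "Cod \<sigma> = T ((x \<otimes>\<^bsub>M\<^esub> z) \<otimes>\<^bsub>M\<^esub> y)"
    by (simp_all add: \<sigma>_def)
  have \<theta> [simp]: "arr C \<theta>" "Dom \<theta> = ?W \<otimes>\<^bsub>C\<^esub> ?V" "Cod \<theta> = T (y \<otimes>\<^bsub>M\<^esub> w \<otimes>\<^bsub>M\<^esub> x)"
    by (simp_all add: \<theta>_def)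
  have \<kappa> [simp]: "arr C \<kappa>" "Dom \<kappa> = ?W \<otimes>\<^bsub>C\<^esub> ?V \<otimes>\<^bsub>C\<^esub> ?Z" "Cod \<kappa> = T ((w \<otimes>\<^bsub>M\<^esub> x \<otimes>\<^bsub>M\<^esub> z) \<otimes>\<^bsub>M\<^esub> y)"
    by (simp_all add: \<kappa>_def)
  have X [simp]: "arr C X" "Dom X = (?W \<otimes>\<^bsub>C\<^esub> ?V) \<otimes>\<^bsub>C\<^esub> ?Z" "Cod X = T (y \<otimes>\<^bsub>M\<^esub> (w \<otimes>\<^bsub>M\<^esub> x) \<otimes>\<^bsub>M\<^esub> z)"
    by (simp_all add: X_def)
  have Y [simp]: "arr C Y" "Dom Y = (?W \<otimes>\<^bsub>C\<^esub> ?V) \<otimes>\<^bsub>C\<^esub> ?Z" "Cod Y = T (((w \<otimes>\<^bsub>M\<^esub> x) \<otimes>\<^bsub>M\<^esub> z) \<otimes>\<^bsub>M\<^esub> y)"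
    by (simp_all add: Y_def)
  have \<tau>\<sigma>: "\<tau> (x \<otimes>\<^bsub>M\<^esub> z) y \<cdot>\<^bsub>C\<^esub> \<sigma> = \<psi>"
    by (simp add: \<sigma>_def C.acomp_extend[OF \<tau>_\<tau>neg])
  have mate_\<psi>: "mate (y \<otimes>\<^bsub>M\<^esub> x \<otimes>\<^bsub>M\<^esub> z) \<psi> \<cdot>\<^bsub>M\<^esub> \<Phi>mult ?V ?Z
      = \<AA>\<^bsub>M\<^esub> y x z \<cdot>\<^bsub>M\<^esub> (mate (y \<otimes>\<^bsub>M\<^esub> x) (\<tau> x y) \<star>\<^bsub>M\<^esub> counit z)"
    using mate_\<mu>[of "y \<otimes>\<^bsub>M\<^esub> x" z "\<tau> x y" "\<II>\<^bsub>C\<^esub> ?Z"]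
    by (simp add: \<psi>_def mate_T1 M.acomp_assoc mate_id)
  have mate_\<theta>: "mate (y \<otimes>\<^bsub>M\<^esub> w \<otimes>\<^bsub>M\<^esub> x) \<theta> \<cdot>\<^bsub>M\<^esub> \<Phi>mult ?W ?V
      = (\<II>\<^bsub>M\<^esub> y \<star>\<^bsub>M\<^esub> counit w \<star>\<^bsub>M\<^esub> \<II>\<^bsub>M\<^esub> x) \<cdot>\<^bsub>M\<^esub> braid_past M (Z ?W) y x
          \<cdot>\<^bsub>M\<^esub> (\<II>\<^bsub>M\<^esub> ?p \<star>\<^bsub>M\<^esub> mate (y \<otimes>\<^bsub>M\<^esub> x) (\<tau> x y))"
    using mate_\<tau>_\<mu>[of w x y "\<II>\<^bsub>C\<^esub> ?V" ?V] by (simp add: \<theta>_def)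
  have mate_\<kappa>: "mate (y \<otimes>\<^bsub>M\<^esub> w \<otimes>\<^bsub>M\<^esub> x \<otimes>\<^bsub>M\<^esub> z) (\<tau> (w \<otimes>\<^bsub>M\<^esub> x \<otimes>\<^bsub>M\<^esub> z) y \<cdot>\<^bsub>C\<^esub> \<kappa>) \<cdot>\<^bsub>M\<^esub> \<Phi>mult ?W (?V \<otimes>\<^bsub>C\<^esub> ?Z)
      = (\<II>\<^bsub>M\<^esub> y \<star>\<^bsub>M\<^esub> counit w \<star>\<^bsub>M\<^esub> \<II>\<^bsub>M\<^esub> (x \<otimes>\<^bsub>M\<^esub> z)) \<cdot>\<^bsub>M\<^esub> braid_past M (Z ?W) y (x \<otimes>\<^bsub>M\<^esub> z)
          \<cdot>\<^bsub>M\<^esub> (\<II>\<^bsub>M\<^esub> ?p \<star>\<^bsub>M\<^esub> mate (y \<otimes>\<^bsub>M\<^esub> x \<otimes>\<^bsub>M\<^esub> z) \<psi>)"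
    using mate_\<tau>_\<mu>[of w "x \<otimes>\<^bsub>M\<^esub> z" y \<sigma> "?V \<otimes>\<^bsub>C\<^esub> ?Z"] by (simp add: \<kappa>_def \<tau>\<sigma>)
  have slide: "\<AA>\<^bsub>M\<^esub> ?p (y \<otimes>\<^bsub>M\<^esub> x) z \<cdot>\<^bsub>M\<^esub> G = ?G' \<cdot>\<^bsub>M\<^esub> \<AA>\<^bsub>M\<^esub> ?p ?q ?s"
    by (simp add: G_def M.assoc_nat)
  have "mate (y \<otimes>\<^bsub>M\<^esub> (w \<otimes>\<^bsub>M\<^esub> x) \<otimes>\<^bsub>M\<^esub> z) X \<cdot>\<^bsub>M\<^esub> m
      = \<AA>\<^bsub>M\<^esub> y (w \<otimes>\<^bsub>M\<^esub> x) z \<cdot>\<^bsub>M\<^esub> (mate (y \<otimes>\<^bsub>M\<^esub> w \<otimes>\<^bsub>M\<^esub> x) \<theta> \<star>\<^bsub>M\<^esub> counit z) \<cdot>\<^bsub>M\<^esub> (\<Phi>mult ?W ?V \<star>\<^bsub>M\<^esub> \<II>\<^bsub>M\<^esub> ?s)"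
    using M.acomp_extend[OF mate_\<mu>[of "y \<otimes>\<^bsub>M\<^esub> w \<otimes>\<^bsub>M\<^esub> x" z \<theta> "\<II>\<^bsub>C\<^esub> ?Z"]]
    by (simp add: X_def m_def mate_T1 M.acomp_assoc mate_id)
  also have "\<dots> = \<AA>\<^bsub>M\<^esub> y (w \<otimes>\<^bsub>M\<^esub> x) z \<cdot>\<^bsub>M\<^esub> ((\<II>\<^bsub>M\<^esub> y \<star>\<^bsub>M\<^esub> counit w \<star>\<^bsub>M\<^esub> \<II>\<^bsub>M\<^esub> x) \<star>\<^bsub>M\<^esub> \<II>\<^bsub>M\<^esub> z)
      \<cdot>\<^bsub>M\<^esub> (braid_past M (Z ?W) y x \<star>\<^bsub>M\<^esub> \<II>\<^bsub>M\<^esub> z) \<cdot>\<^bsub>M\<^esub> G"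
    by (simp add: M.ainterchange mate_\<theta> G_def)
  also have "\<dots> = (\<II>\<^bsub>M\<^esub> y \<star>\<^bsub>M\<^esub> (counit w \<star>\<^bsub>M\<^esub> \<II>\<^bsub>M\<^esub> x) \<star>\<^bsub>M\<^esub> \<II>\<^bsub>M\<^esub> z)
      \<cdot>\<^bsub>M\<^esub> (\<AA>\<^bsub>M\<^esub> y (?p \<otimes>\<^bsub>M\<^esub> x) z \<cdot>\<^bsub>M\<^esub> (braid_past M (Z ?W) y x \<star>\<^bsub>M\<^esub> \<II>\<^bsub>M\<^esub> z)) \<cdot>\<^bsub>M\<^esub> G"
    by (simp add: M.acomp_extend[OF M.assoc_nat] M.acomp_assoc)
  \<comment> \<open>The essential exchange: so far \<open>?p\<close> passed \<open>y\<close> beside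
    \<open>x\<close> and \<open>z\<close> was tensored on afterwards; from here on it passes
    \<open>y\<close> beside \<open>x \<otimes> z\<close>, as the other side demands.\<close>
  also have "\<dots> = (\<II>\<^bsub>M\<^esub> y \<star>\<^bsub>M\<^esub> (counit w \<star>\<^bsub>M\<^esub> \<II>\<^bsub>M\<^esub> x) \<star>\<^bsub>M\<^esub> \<II>\<^bsub>M\<^esub> z) \<cdot>\<^bsub>M\<^esub> (\<II>\<^bsub>M\<^esub> y \<star>\<^bsub>M\<^esub> \<AA>\<^sup>-\<^bsub>M\<^esub> ?p x z)
      \<cdot>\<^bsub>M\<^esub> braid_past M (Z ?W) y (x \<otimes>\<^bsub>M\<^esub> z) \<cdot>\<^bsub>M\<^esub> (\<II>\<^bsub>M\<^esub> ?p \<star>\<^bsub>M\<^esub> \<AA>\<^bsub>M\<^esub> y x z) \<cdot>\<^bsub>M\<^esub> \<AA>\<^bsub>M\<^esub> ?p (y \<otimes>\<^bsub>M\<^esub> x) z \<cdot>\<^bsub>M\<^esub> G"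
    by (simp add: M.assoc_braid_past M.acomp_assoc)
  also have "\<dots> = (\<II>\<^bsub>M\<^esub> y \<star>\<^bsub>M\<^esub> \<AA>\<^sup>-\<^bsub>M\<^esub> w x z) \<cdot>\<^bsub>M\<^esub> (\<II>\<^bsub>M\<^esub> y \<star>\<^bsub>M\<^esub> counit w \<star>\<^bsub>M\<^esub> \<II>\<^bsub>M\<^esub> (x \<otimes>\<^bsub>M\<^esub> z))
      \<cdot>\<^bsub>M\<^esub> braid_past M (Z ?W) y (x \<otimes>\<^bsub>M\<^esub> z) \<cdot>\<^bsub>M\<^esub> (\<II>\<^bsub>M\<^esub> ?p \<star>\<^bsub>M\<^esub> \<AA>\<^bsub>M\<^esub> y x z) \<cdot>\<^bsub>M\<^esub> ?G' \<cdot>\<^bsub>M\<^esub> \<AA>\<^bsub>M\<^esub> ?p ?q ?s"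
    by (simp add: M.acomp_extend[OF M.ainterchange] M.assoc_inv_nat_left slide)
  \<comment> \<open>Reassembles the mate of \<open>\<psi>\<close>, so that the bracketed composite
    is the right-hand side of \<open>mate_\<kappa>\<close>.\<close>
  also have "\<dots> = (\<II>\<^bsub>M\<^esub> y \<star>\<^bsub>M\<^esub> \<AA>\<^sup>-\<^bsub>M\<^esub> w x z) \<cdot>\<^bsub>M\<^esub> ((\<II>\<^bsub>M\<^esub> y \<star>\<^bsub>M\<^esub> counit w \<star>\<^bsub>M\<^esub> \<II>\<^bsub>M\<^esub> (x \<otimes>\<^bsub>M\<^esub> z))
      \<cdot>\<^bsub>M\<^esub> braid_past M (Z ?W) y (x \<otimes>\<^bsub>M\<^esub> z) \<cdot>\<^bsub>M\<^esub> (\<II>\<^bsub>M\<^esub> ?p \<star>\<^bsub>M\<^esub> mate (y \<otimes>\<^bsub>M\<^esub> x \<otimes>\<^bsub>M\<^esub> z) \<psi>))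
      \<cdot>\<^bsub>M\<^esub> (\<II>\<^bsub>M\<^esub> ?p \<star>\<^bsub>M\<^esub> \<Phi>mult ?V ?Z) \<cdot>\<^bsub>M\<^esub> \<AA>\<^bsub>M\<^esub> ?p ?q ?s"
    by (simp add: M.acomp_assoc M.acomp_extend[OF M.ainterchange] mate_\<psi>)
  also have "\<dots> = (\<II>\<^bsub>M\<^esub> y \<star>\<^bsub>M\<^esub> \<AA>\<^sup>-\<^bsub>M\<^esub> w x z)
      \<cdot>\<^bsub>M\<^esub> mate (y \<otimes>\<^bsub>M\<^esub> w \<otimes>\<^bsub>M\<^esub> x \<otimes>\<^bsub>M\<^esub> z) (\<tau> (w \<otimes>\<^bsub>M\<^esub> x \<otimes>\<^bsub>M\<^esub> z) y \<cdot>\<^bsub>C\<^esub> \<kappa>)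
      \<cdot>\<^bsub>M\<^esub> \<Phi>mult ?W (?V \<otimes>\<^bsub>C\<^esub> ?Z) \<cdot>\<^bsub>M\<^esub> (\<II>\<^bsub>M\<^esub> ?p \<star>\<^bsub>M\<^esub> \<Phi>mult ?V ?Z) \<cdot>\<^bsub>M\<^esub> \<AA>\<^bsub>M\<^esub> ?p ?q ?s"
    by (simp only: mate_\<kappa>[symmetric] M.acomp_assoc)
  also have "\<dots> = (\<II>\<^bsub>M\<^esub> y \<star>\<^bsub>M\<^esub> \<AA>\<^sup>-\<^bsub>M\<^esub> w x z)
      \<cdot>\<^bsub>M\<^esub> mate (y \<otimes>\<^bsub>M\<^esub> w \<otimes>\<^bsub>M\<^esub> x \<otimes>\<^bsub>M\<^esub> z) (\<tau> (w \<otimes>\<^bsub>M\<^esub> x \<otimes>\<^bsub>M\<^esub> z) y \<cdot>\<^bsub>C\<^esub> \<kappa>) \<cdot>\<^bsub>M\<^esub> \<Phi> (\<AA>\<^bsub>C\<^esub> ?W ?V ?Z) \<cdot>\<^bsub>M\<^esub> m"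
    by (simp add: \<Phi>mult_assoc m_def)
  also have "\<dots> = mate (y \<otimes>\<^bsub>M\<^esub> (w \<otimes>\<^bsub>M\<^esub> x) \<otimes>\<^bsub>M\<^esub> z)
      (T1 (\<II>\<^bsub>M\<^esub> y \<star>\<^bsub>M\<^esub> \<AA>\<^sup>-\<^bsub>M\<^esub> w x z) \<cdot>\<^bsub>C\<^esub> (\<tau> (w \<otimes>\<^bsub>M\<^esub> x \<otimes>\<^bsub>M\<^esub> z) y \<cdot>\<^bsub>C\<^esub> \<kappa>) \<cdot>\<^bsub>C\<^esub> \<AA>\<^bsub>C\<^esub> ?W ?V ?Z) \<cdot>\<^bsub>M\<^esub> m"
    by (simp add: mate_T1 M.acomp_assoc) (simp add: mate_comp M.acomp_assoc)
  \<comment> \<open>Naturality moves the associator from after the traciator to before it, where it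
    is the leading factor of \<open>Y\<close>.\<close>
  also have "T1 (\<II>\<^bsub>M\<^esub> y \<star>\<^bsub>M\<^esub> \<AA>\<^sup>-\<^bsub>M\<^esub> w x z) \<cdot>\<^bsub>C\<^esub> (\<tau> (w \<otimes>\<^bsub>M\<^esub> x \<otimes>\<^bsub>M\<^esub> z) y \<cdot>\<^bsub>C\<^esub> \<kappa>) \<cdot>\<^bsub>C\<^esub> \<AA>\<^bsub>C\<^esub> ?W ?V ?Z
      = \<tau> ((w \<otimes>\<^bsub>M\<^esub> x) \<otimes>\<^bsub>M\<^esub> z) y \<cdot>\<^bsub>C\<^esub> Y"
    by (simp add: Y_def C.acomp_assoc C.acomp_extend[OF \<tau>_nat_left])
  finally have eq: "mate (y \<otimes>\<^bsub>M\<^esub> (w \<otimes>\<^bsub>M\<^esub> x) \<otimes>\<^bsub>M\<^esub> z) X \<cdot>\<^bsub>M\<^esub> m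
      = mate (y \<otimes>\<^bsub>M\<^esub> (w \<otimes>\<^bsub>M\<^esub> x) \<otimes>\<^bsub>M\<^esub> z) (\<tau> ((w \<otimes>\<^bsub>M\<^esub> x) \<otimes>\<^bsub>M\<^esub> z) y \<cdot>\<^bsub>C\<^esub> Y) \<cdot>\<^bsub>M\<^esub> m" .
  have m_inv: "m \<cdot>\<^bsub>M\<^esub> (\<Phi>mult_inv ?W ?V \<star>\<^bsub>M\<^esub> \<II>\<^bsub>M\<^esub> ?s) \<cdot>\<^bsub>M\<^esub> \<Phi>mult_inv (?W \<otimes>\<^bsub>C\<^esub> ?V) ?Z
      = \<II>\<^bsub>M\<^esub> (P ((?W \<otimes>\<^bsub>C\<^esub> ?V) \<otimes>\<^bsub>C\<^esub> ?Z))"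
    by (simp add: m_def M.acomp_assoc M.acomp_extend[OF M.ainterchange])
  have "mate (y \<otimes>\<^bsub>M\<^esub> (w \<otimes>\<^bsub>M\<^esub> x) \<otimes>\<^bsub>M\<^esub> z) X
      = mate (y \<otimes>\<^bsub>M\<^esub> (w \<otimes>\<^bsub>M\<^esub> x) \<otimes>\<^bsub>M\<^esub> z) (\<tau> ((w \<otimes>\<^bsub>M\<^esub> x) \<otimes>\<^bsub>M\<^esub> z) y \<cdot>\<^bsub>C\<^esub> Y)"
    by (rule M.cancel_right_inverse[OF eq m_inv]) simp_all
  then have "X = \<tau> ((w \<otimes>\<^bsub>M\<^esub> x) \<otimes>\<^bsub>M\<^esub> z) y \<cdot>\<^bsub>C\<^esub> Y"
    by (rule mate_inject) simp_all
  then have "\<tau>neg y ((w \<otimes>\<^bsub>M\<^esub> x) \<otimes>\<^bsub>M\<^esub> z) \<cdot>\<^bsub>C\<^esub> X = Y"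
    by (simp add: C.acomp_extend[OF \<tau>neg_\<tau>])
  moreover have "Y = ?Y"
    by (simp add: Y_def \<kappa>_def \<sigma>_def \<psi>_def C.lwhisker_comp C.acomp_assoc)
  ultimately show ?thesis
    by (simp add: X_def \<theta>_def C.rwhisker_comp C.acomp_assoc)
qed

end

theorem lemma4p19:
  fixes C :: "('c, 'f) pivcat"
    and M :: "('o, 'm) pivcat"
    and \<Phi>Z :: "('c, 'f, 'o \<times> ('o \<Rightarrow> 'm), 'm) tfunctor"
    and Tr :: "('o, 'm, 'c, 'f) cfunctor"
    and \<epsilon> :: "'o \<Rightarrow> 'm"
    and w x y z :: 'o
  assumes "pivotal_category C"
    and "pivotal_category M"
    and "is_pivotal_functor C (center M) \<Phi>Z"
    and "is_right_adjoint C M (underlying M \<Phi>Z) Tr \<epsilon>"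
    and "w \<in> Obj M" and "x \<in> Obj M" and "y \<in> Obj M" and "z \<in> Obj M"
  shows
    "(let \<mu> = trace_mult C M (underlying M \<Phi>Z) Tr \<epsilon>;
          \<tau> = traciator C M \<Phi>Z Tr \<epsilon>;
          \<tau>neg = traciator_neg C M \<Phi>Z Tr \<epsilon>;
          T = FObj Tr;
          T1 = FArr Tr
      in \<tau>neg y ((w \<otimes>\<^bsub>M\<^esub> x) \<otimes>\<^bsub>M\<^esub> z)
           \<bullet>\<^bsub>C\<^esub> T1 (\<alpha>\<^bsub>M\<^esub> y (w \<otimes>\<^bsub>M\<^esub> x) z)
           \<bullet>\<^bsub>C\<^esub> \<mu> (y \<otimes>\<^bsub>M\<^esub> (w \<otimes>\<^bsub>M\<^esub> x)) z
           \<bullet>\<^bsub>C\<^esub> (\<tau> (w \<otimes>\<^bsub>M\<^esub> x) y \<odot>\<^bsub>C\<^esub> \<iota>\<^bsub>C\<^esub> (T z))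
           \<bullet>\<^bsub>C\<^esub> (T1 (\<alpha>\<^sup>-\<^bsub>M\<^esub> w x y) \<odot>\<^bsub>C\<^esub> \<iota>\<^bsub>C\<^esub> (T z))
           \<bullet>\<^bsub>C\<^esub> (\<mu> w (x \<otimes>\<^bsub>M\<^esub> y) \<odot>\<^bsub>C\<^esub> \<iota>\<^bsub>C\<^esub> (T z))
         = T1 (\<alpha>\<^sup>-\<^bsub>M\<^esub> w x z \<odot>\<^bsub>M\<^esub> \<iota>\<^bsub>M\<^esub> y)
           \<bullet>\<^bsub>C\<^esub> T1 (\<alpha>\<^sup>-\<^bsub>M\<^esub> w (x \<otimes>\<^bsub>M\<^esub> z) y)
           \<bullet>\<^bsub>C\<^esub> \<mu> w ((x \<otimes>\<^bsub>M\<^esub> z) \<otimes>\<^bsub>M\<^esub> y)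
           \<bullet>\<^bsub>C\<^esub> (\<iota>\<^bsub>C\<^esub> (T w) \<odot>\<^bsub>C\<^esub> \<tau>neg y (x \<otimes>\<^bsub>M\<^esub> z))
           \<bullet>\<^bsub>C\<^esub> (\<iota>\<^bsub>C\<^esub> (T w) \<odot>\<^bsub>C\<^esub> T1 (\<alpha>\<^bsub>M\<^esub> y x z))
           \<bullet>\<^bsub>C\<^esub> (\<iota>\<^bsub>C\<^esub> (T w) \<odot>\<^bsub>C\<^esub> \<mu> (y \<otimes>\<^bsub>M\<^esub> x) z)
           \<bullet>\<^bsub>C\<^esub> (\<iota>\<^bsub>C\<^esub> (T w) \<odot>\<^bsub>C\<^esub> (\<tau> x y \<odot>\<^bsub>C\<^esub> \<iota>\<^bsub>C\<^esub> (T z)))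
           \<bullet>\<^bsub>C\<^esub> \<alpha>\<^bsub>C\<^esub> (T w) (T (x \<otimes>\<^bsub>M\<^esub> y)) (T z))"
proof -
  interpret categorified_trace C M \<Phi>Z Tr \<epsilon>
    using assms(1-4)
    by (simp add: categorified_trace_def categorified_trace_axioms_def is_pivotal_functor_def)
  note [simp] = assms(5-8)
  \<comment> \<open>Both sides are well-typed composites, so taking \<open>Body\<close> of the
    equation of typed arrows yields the equation between the bare morphisms.\<close>
  show ?thesis
    using arg_cong[OF trace_relation[OF assms(5-8)], of Body] by (simp add: Let_def)
qed

end
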